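(* Let $\mu$ be a non-negative finite measure on $\mathbb{R}^d$ and suppose there is a family of finite measures $\mu_\delta(dx)=f_\delta(x)dx$, $\delta>0$, with the following property: there exist $m\in\mathbb{N}_*$, constants $C,r,\varepsilon>0$ and a right-continuous non-increasing function $\lambda_m(\delta)$, $\delta\in(0,1)$, such that for all $\delta\in(0,1)$ $$\|f_\delta\|_{2m,2m,1+}\le\lambda_m(\delta)\le C\delta^{-r}\qquad\text{and}\qquad \lambda_m(\delta)^{\frac1{2m}}\,d_1(\mu,\mu_\delta)\le\frac{C}{(\ln(1/\delta))^{2+\frac1{2m}+\varepsilon}} .$$ Then $\mu(dx)=f(x)dx$ with $f\in L^{\mathbf{e}_{\log}}$.
   Context: $\mathbb{N}_*=\{1,2,\dots\}$. For $f$ on $\mathbb{R}^d$, with $\ln^+(x)=\max\{0,\ln|x|\}$, $$\|f\|_{p,1+}=\int(1+|x|)^p|f(x)|\big(1+\ln^+|x|+\ln^+|f(x)|\big)dx,\qquad \|f\|_{k,p,1+}=\sum_{0\le|\alpha|\le k}\|\partial_\alpha f\|_{p,1+},$$ where $\alpha\in\mathbb{N}^d$ are multi-indices. $\mathbf{e}_{\log}(t)=(1+|t|)\ln(1+|t|)$; $\|f\|_{\mathbf{e}_{\log}}=\inf\{c>0:\int\mathbf{e}_{\log}(f(x)/c)dx\le1\}$ and $L^{\mathbf{e}_{\log}}=\{f:\|f\|_{\mathbf{e}_{\log}}<\infty\}$. For finite signed measures $\mu,\nu$ on $\mathbb{R}^d$: $d_1(\mu,\nu)=\sup\{|\int\phi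 d\mu-\int\phi d\nu|:\phi\in C^\infty(\mathbb{R}^d),\ \sum_{0\le|\alpha|\le1}\|\partial_\alpha\phi\|_\infty\le1\}$.
   Formalization: Two assumptions on λ_m are added, without which the claim fails: λ_m > 0 on (0,1), and its jumps are of bounded ratio, i.e. for some constant K, λ_m(η) ≤ K λ_m(δ) for all η < δ close enough to δ (automatic if λ_m is continuous and positive). *)

theory Defs
  imports "HOL-Analysis.Analysis"
begin

section \<open>Multi-indices and classical partial derivatives\<close>

type_synonym 'n multiindex = "'n \<Rightarrow> nat"

definition mi_order :: "('n::finite) multiindex \<Rightarrow> nat" where
  "mi_order \<alpha> = (\<Sum>i\<in>UNIV. \<alpha> i)"

definition partial :: "'n::finite \<Rightarrow> (real ^ 'n \<Rightarrow> real) \<Rightarrow> real ^ 'n \<Rightarrow> real" where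
  "partial i \<phi> x = frechet_derivative \<phi> (at x) (axis i 1)"

fun iterated_partial :: "('n::finite) list \<Rightarrow> (real ^ 'n \<Rightarrow> real) \<Rightarrow> real ^ 'n \<Rightarrow> real" where
  "iterated_partial [] \<phi> = \<phi>"
| "iterated_partial (i # is) \<phi> = partial i (iterated_partial is \<phi>)"

definition smooth :: "(real ^ 'n::finite \<Rightarrow> real) \<Rightarrow> bool" where
  "smooth \<phi> \<longleftrightarrow> (\<forall>is x. iterated_partial is \<phi> differentiable (at x))"

text \<open>The operator \<open>\<partial>\<^sub>\<alpha>\<close> differentiates \<open>\<alpha> i\<close> times in direction \<open>i\<close>. It is only applied to smooth
  functions, for which the order of the differentiations chosen here is irrelevant (Schwarz).\<close>

definition mi_partial :: "('n::finite) multiindex \<Rightarrow> (real ^ 'n \<Rightarrow> real) \<Rightarrow> real ^ 'n \<Rightarrow> real" where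
  "mi_partial \<alpha> \<phi> = iterated_partial (SOME is. \<forall>i. count_list is i = \<alpha> i) \<phi>"

section \<open>Weak derivatives\<close>

definition locally_integrable :: "(real ^ 'n::finite \<Rightarrow> real) \<Rightarrow> bool" where
  "locally_integrable f \<longleftrightarrow>
     f \<in> borel_measurable borel \<and> (\<forall>K. compact K \<longrightarrow> set_integrable lborel K f)"

definition is_weak_partial ::
    "('n::finite) multiindex \<Rightarrow> (real ^ 'n \<Rightarrow> real) \<Rightarrow> (real ^ 'n \<Rightarrow> real) \<Rightarrow> bool" where
  "is_weak_partial \<alpha> f g \<longleftrightarrow> locally_integrable f \<and> locally_integrable g \<and>
     (\<forall>\<phi>. smooth \<phi> \<and> compact (closure {x. \<phi> x \<noteq> 0}) \<longrightarrow>
        (LINT x|lborel. f x * mi_partial \<alpha> \<phi> x)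
          = (- 1) ^ mi_order \<alpha> * (LINT x|lborel. g x * \<phi> x))"

text \<open>Weak derivatives are unique up to null sets, so the choice of a version does not affect the
  norms below. For a function of class \<open>C\<^sup>k\<close> and \<open>mi_order \<alpha> \<le> k\<close>, the classical derivative is a
  version.\<close>

definition weak_partial ::
    "('n::finite) multiindex \<Rightarrow> (real ^ 'n \<Rightarrow> real) \<Rightarrow> real ^ 'n \<Rightarrow> real" where
  "weak_partial \<alpha> f = (SOME g. is_weak_partial \<alpha> f g)"

section \<open>The weighted norms\<close>

text \<open>Since \<open>ln 0 = 0\<close> in Isabelle/HOL, \<open>ln_plus 0 = 0\<close>, which is also the value of the
  usual convention \<open>max 0 (-\<infinity>)\<close>.\<close>

definition ln_plus :: "real \<Rightarrow> real" where
  "ln_plus x = max 0 (ln \<bar>x\<bar>)"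

definition norm_1plus :: "nat \<Rightarrow> (real ^ 'n::finite \<Rightarrow> real) \<Rightarrow> ennreal" where
  "norm_1plus p f =
     (\<integral>\<^sup>+x. ennreal ((1 + norm x) ^ p * \<bar>f x\<bar> * (1 + ln_plus (norm x) + ln_plus (f x))) \<partial>lborel)"

definition sobolev_norm_1plus :: "nat \<Rightarrow> nat \<Rightarrow> (real ^ 'n::finite \<Rightarrow> real) \<Rightarrow> ennreal" where
  "sobolev_norm_1plus k p f =
     (if \<forall>\<alpha>. mi_order \<alpha> \<le> k \<longrightarrow> (\<exists>g. is_weak_partial \<alpha> f g)
      then (\<Sum>\<alpha> | mi_order \<alpha> \<le> k. norm_1plus p (weak_partial \<alpha> f))
      else \<infinity>)"

section \<open>The Orlicz space\<close>

definition e_log :: "real \<Rightarrow> real" where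
  "e_log t = (1 + \<bar>t\<bar>) * ln (1 + \<bar>t\<bar>)"

definition norm_elog :: "(real ^ 'n::finite \<Rightarrow> real) \<Rightarrow> ennreal" where
  "norm_elog f = (INF c\<in>{c::real. 0 < c \<and> (\<integral>\<^sup>+x. ennreal (e_log (f x / c)) \<partial>lborel) \<le> 1}. ennreal c)"

definition L_elog :: "(real ^ 'n::finite \<Rightarrow> real) set" where
  "L_elog = {f \<in> borel_measurable borel. norm_elog f < \<infinity>}"

section \<open>The distance between finite signed measures\<close>

text \<open>A finite signed measure is represented by a pair \<open>(P, N)\<close> of finite non-negative Borel
  measures whose difference it is; integrals do not depend on the representation.\<close>

type_synonym 'n signed_measure = "(real ^ 'n) measure \<times> (real ^ 'n) measure"

definition signed_of :: "(real ^ 'n::finite) measure \<Rightarrow> 'n signed_measure" where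
  "signed_of \<mu> = (\<mu>, null_measure borel)"

text \<open>The signed measure \<open>f(x) dx\<close>; \<open>ennreal\<close> maps negative numbers to \<open>0\<close>, so the two components
  have the densities \<open>f\<^sup>+\<close> and \<open>f\<^sup>-\<close>.\<close>

definition signed_density :: "(real ^ 'n::finite \<Rightarrow> real) \<Rightarrow> 'n signed_measure" where
  "signed_density f =
     (density lborel (\<lambda>x. ennreal (f x)), density lborel (\<lambda>x. ennreal (- f x)))"

definition signed_integral :: "('n::finite) signed_measure \<Rightarrow> (real ^ 'n \<Rightarrow> real) \<Rightarrow> real" where
  "signed_integral \<mu> \<phi> = (LINT x|fst \<mu>. \<phi> x) - (LINT x|snd \<mu>. \<phi> x)"

definition sup_norm :: "(real ^ 'n::finite \<Rightarrow> real) \<Rightarrow> ennreal" where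
  "sup_norm \<phi> = (SUP x. ennreal \<bar>\<phi> x\<bar>)"

definition d1 :: "('n::finite) signed_measure \<Rightarrow> 'n signed_measure \<Rightarrow> ennreal" where
  "d1 \<mu> \<nu> =
     (SUP \<phi>\<in>{\<phi>. smooth \<phi> \<and> (\<Sum>\<alpha> | mi_order \<alpha> \<le> 1. sup_norm (mi_partial \<alpha> \<phi>)) \<le> 1}.
        ennreal \<bar>signed_integral \<mu> \<phi> - signed_integral \<nu> \<phi>\<bar>)"

end

theory Submission
  imports Defs
begin

text \<open>The idea is a dyadic decomposition of \<open>\<mu>\<close>. Fix a smooth compactly supported kernel
  \<open>\<phi>\<close> of integral \<open>1\<close>, put \<open>\<phi>\<^sub>h(x) = h\<^bsup>-d\<^esup> \<phi>(x / h)\<close>, and let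
  \<open>F\<^sub>n(x) = \<integral> \<phi>\<^sub>h(y - x) d\<mu>(y)\<close> with \<open>h = 2\<^bsup>-n\<^esup>\<close>. The \<open>F\<^sub>n\<close>, read as densities, converge
  weakly to \<open>\<mu>\<close>, so it suffices that the increments \<open>F\<^bsub>n+1\<^esub> - F\<^sub>n\<close> are summable in the Luxemburg
  norm of \<open>e_log\<close>: then the \<open>F\<^sub>n\<close> converge almost everywhere and in \<open>L\<^sup>1\<close> to a function in
  \<open>L_elog\<close>, which is the density (\<open>density_from_elog_balls\<close>).

  An increment is compared with the one of \<open>f \<delta>\<close> for a suitable \<open>\<delta> = \<delta>\<^sub>n\<close>.

  \<^item> The kernel is chosen such that \<open>\<phi>\<^sub>h - \<phi>\<^bsub>2h\<^esub>\<close> is \<open>h\<^bsup>2m\<^esup>\<close> times a sum of pure derivatives of order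
    \<open>2m\<close> of kernels at scale \<open>h\<close> (\<open>kernel_1d\<close>, \<open>pker_telescope\<close>). Moving these derivatives to
    \<open>f \<delta>\<close> and using Jensen's inequality for \<open>e_log\<close> (\<open>elog_ball_convolution\<close>) bounds the increment
    of \<open>f \<delta>\<close> by a constant times \<open>2\<^bsup>-2mn\<^esup> (1 + 2 lam \<delta>)\<close>.
  \<^item> The smoothed difference of \<open>\<mu>\<close> and \<open>f \<delta>\<close> is at most a constant times \<open>h\<^bsup>-1\<^esup> d\<^sub>1\<close> in \<open>L\<^sup>1\<close>,
    by duality with the sign of the difference, and at most a constant times \<open>h\<^bsup>-d-1\<^esup> d\<^sub>1\<close> in the
    supremum norm (\<open>d1_mollify_bounds\<close>). The logarithm in \<open>e_log\<close> costs a factor of the order of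
    \<open>ln (1 / h)\<close>, that is \<open>n\<close>, which gives a constant times \<open>n 2\<^sup>n d\<^sub>1\<close>.

  Both bounds are combined in \<open>dyadic_step\<close>. Finally \<open>\<delta>\<^sub>n\<close> is chosen such that \<open>lam \<delta>\<^sub>n\<close> is close to the target
  \<open>2\<^bsup>2mn\<^esup> n\<^bsup>-1-\<epsilon>\<^esup>\<close>; then \<open>ln (1 / \<delta>\<^sub>n)\<close> is at least of the order of \<open>n\<close> by the polynomial growth of \<open>lam\<close>,
  and the hypothesis on \<open>d\<^sub>1\<close>, with exponent \<open>2 + 1 / (2m) + \<epsilon>\<close>, makes \<open>n 2\<^sup>n d\<^sub>1\<close> at most of the order
  of \<open>n\<^bsup>-1-\<epsilon>/2\<^esup>\<close> (\<open>balanced_parameter\<close>). If \<open>lam\<close> never exceeds the target, any small enough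
  \<open>\<delta>\<^sub>n\<close> serves.\<close>

section \<open>Smooth and compactly supported functions of one variable\<close>

text \<open>Infinitely differentiable functions on the line. The derivatives are the iterates of
  \<open>deriv\<close>, which is total; each iterate is required to be differentiable everywhere.\<close>

definition smooth1 :: "(real \<Rightarrow> real) \<Rightarrow> bool" where
  "smooth1 a \<longleftrightarrow> (\<forall>k x. (deriv ^^ k) a field_differentiable (at x))"

text \<open>Test functions on the line: smooth functions that vanish outside a bounded interval.\<close>

definition bump :: "(real \<Rightarrow> real) \<Rightarrow> bool" where
  "bump a \<longleftrightarrow> smooth1 a \<and> (\<exists>R. \<forall>x. R < \<bar>x\<bar> \<longrightarrow> a x = 0)"

lemma smooth1D:
  "smooth1 a \<Longrightarrow> ((deriv ^^ k) a has_real_derivative (deriv ^^ Suc k) a x) (at x)"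
  unfolding smooth1_def by (simp add: DERIV_deriv_iff_field_differentiable)

lemma smooth1_DERIV: "smooth1 a \<Longrightarrow> (a has_real_derivative deriv a x) (at x)"
  using smooth1D[of a 0] by simp

lemma derivs_unique:
  assumes "\<And>k x. (F k has_real_derivative F (Suc k) x) (at x)"
  shows "(deriv ^^ k) (F 0) = F k"
proof (induction k)
  case (Suc k)
  have "deriv (F k) = F (Suc k)"
    using assms by (intro ext DERIV_imp_deriv)
  then show ?case using Suc by simp
qed simp

lemma smooth1I:
  assumes "\<And>k x. (F k has_real_derivative F (Suc k) x) (at x)" and "a = F 0"
  shows "smooth1 a"
  unfolding smooth1_def assms(2) derivs_unique[of F, OF assms(1)]
  using assms(1) field_differentiable_def by blast

text \<open>Coinduction: smoothness holds for each member of a class of functions in which every member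
  has a derivative that belongs to the class again.\<close>

lemma smooth1_coinduct:
  assumes "X a" and "\<And>f. X f \<Longrightarrow> \<exists>g. X g \<and> (\<forall>x. (f has_real_derivative g x) (at x))"
  shows "smooth1 a"
proof -
  have X: "X ((deriv ^^ k) a)" for k
  proof (induction k)
    case (Suc k)
    then obtain g where g: "X g" "\<forall>x. ((deriv ^^ k) a has_real_derivative g x) (at x)"
      using assms(2) by blast
    then have "deriv ((deriv ^^ k) a) = g" by (intro ext DERIV_imp_deriv) auto
    with g show ?case by simp
  qed (use assms(1) in simp)
  show ?thesis unfolding smooth1_def using assms(2)[OF X] field_differentiable_def by blast
qed

lemma smooth1_deriv: "smooth1 a \<Longrightarrow> smooth1 (deriv a)"
  unfolding smooth1_def by (metis funpow_Suc_right comp_apply)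

lemma smooth1_derivs: "smooth1 a \<Longrightarrow> smooth1 ((deriv ^^ k) a)"
  by (induction k) (auto intro: smooth1_deriv)

lemma smooth1_add: "smooth1 a \<Longrightarrow> smooth1 b \<Longrightarrow> smooth1 (\<lambda>x. a x + b x)"
  by (rule smooth1I[where F = "\<lambda>k x. (deriv ^^ k) a x + (deriv ^^ k) b x"])
     (auto intro!: DERIV_add simp del: funpow.simps(2) intro: smooth1D)

lemma has_real_derivative_affine:
  assumes "(f has_real_derivative D) (at (q * x + p))"
  shows "((\<lambda>x::real. c * f (q * x + p)) has_real_derivative c * q * D) (at x)"
proof -
  have "((\<lambda>x. f (q * x + p)) has_real_derivative D * (q * 1 + 0)) (at x)"
    by (rule DERIV_chain2[where f = f and g = "\<lambda>x. q * x + p", OF assms]) (auto intro!: derivative_eq_intros)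
  from DERIV_cmult[OF this, of c] show ?thesis by (simp add: mult_ac)
qed

lemma affine_derivs:
  assumes "smooth1 a"
  shows smooth1_affine: "smooth1 (\<lambda>x. c * a (q * x + p))"
    and derivs_affine: "(deriv ^^ k) (\<lambda>x. c * a (q * x + p)) = (\<lambda>x. c * q ^ k * (deriv ^^ k) a (q * x + p))"
proof -
  let ?F = "\<lambda>k x. c * q ^ k * (deriv ^^ k) a (q * x + p)"
  have F: "(?F k has_real_derivative ?F (Suc k) x) (at x)" for k x
    using has_real_derivative_affine[OF smooth1D[OF assms], where q = q and p = p and c = "c * q ^ k"]
    by (simp only: power_Suc2 mult.assoc)
  show "smooth1 (\<lambda>x. c * a (q * x + p))" by (rule smooth1I[of ?F]) (use F in auto)
  show "(deriv ^^ k) (\<lambda>x. c * a (q * x + p)) = ?F k"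
    using derivs_unique[of ?F, OF F, of k] by simp
qed

text \<open>Finite sums of products of two smooth functions. Differentiation does not leave this class, so
  products are smooth without Leibniz's formula for higher derivatives.\<close>

inductive sum_prod :: "(real \<Rightarrow> real) \<Rightarrow> bool" where
  "smooth1 a \<Longrightarrow> smooth1 b \<Longrightarrow> sum_prod (\<lambda>x. a x * b x)"
| "sum_prod a \<Longrightarrow> sum_prod b \<Longrightarrow> sum_prod (\<lambda>x. a x + b x)"

lemma smooth1_mult:
  assumes "smooth1 a" "smooth1 b" shows "smooth1 (\<lambda>x. a x * b x)"
proof (rule smooth1_coinduct[of sum_prod])
  show "sum_prod (\<lambda>x. a x * b x)" using assms by (rule sum_prod.intros)
next
  fix f assume "sum_prod f"
  then show "\<exists>g. sum_prod g \<and> (\<forall>x. (f has_real_derivative g x) (at x))"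
  proof induction
    case (1 a b)
    have "sum_prod (\<lambda>x. deriv a x * b x + deriv b x * a x)"
      using 1 by (intro sum_prod.intros smooth1_deriv)
    moreover have "((\<lambda>x. a x * b x) has_real_derivative deriv a x * b x + deriv b x * a x) (at x)" for x
      using 1 by (intro DERIV_mult smooth1_DERIV)
    ultimately show ?case by blast
  next
    case (2 a b)
    then obtain g h where "sum_prod g" "\<forall>x. (a has_real_derivative g x) (at x)"
       "sum_prod h" "\<forall>x. (b has_real_derivative h x) (at x)" by blast
    then show ?case
      by (intro exI[of _ "\<lambda>x. g x + h x"]) (auto intro!: sum_prod.intros DERIV_add)
  qed
qed

text \<open>The functions \<open>p(1 / x) exp (- 1 / x)\<close> on the positive half-line, continued by \<open>0\<close>, where \<open>p\<close> is a
  polynomial. They are closed under differentiation, also at the origin.\<close>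

definition flat :: "real poly \<Rightarrow> real \<Rightarrow> real" where
  "flat p x = (if 0 < x then poly p (inverse x) * exp (- inverse x) else 0)"

lemma poly_exp_tendsto_0: "((\<lambda>x::real. poly p x * exp (- x)) \<longlongrightarrow> 0) at_top"
proof -
  have "((\<lambda>x. \<Sum>i\<le>degree p. coeff p i * (x ^ i / exp x)) \<longlongrightarrow> (\<Sum>i\<le>degree p. coeff p i * 0)) at_top"
    by (intro tendsto_intros tendsto_power_div_exp_0)
  moreover have "(\<lambda>x. \<Sum>i\<le>degree p. coeff p i * (x ^ i / exp x)) = (\<lambda>x. poly p x * exp (- x))"
    by (rule ext) (simp add: poly_altdef sum_distrib_right exp_minus divide_inverse mult.assoc)
  ultimately show ?thesis by simp
qed

lemma DERIV_flat:
  "(flat p has_real_derivative flat ([:0, 0, 1:] * (p - pderiv p)) x) (at x)"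
proof -
  consider "x < 0" | "x = 0" | "0 < x" by linarith
  then show ?thesis
  proof cases
    case 1
    have "((\<lambda>_. 0) has_real_derivative 0) (at x)" by simp
    then have "(flat p has_real_derivative 0) (at x)"
      by (rule has_field_derivative_transform_within_open[where S = "{..<0}"]) (use 1 in \<open>auto simp: flat_def\<close>)
    then show ?thesis using 1 by (simp add: flat_def)
  next
    case 3
    have "((\<lambda>x. poly p (inverse x) * exp (- inverse x)) has_real_derivative
       flat ([:0, 0, 1:] * (p - pderiv p)) x) (at x)"
      using 3 by (auto intro!: derivative_eq_intros DERIV_chain2[OF poly_DERIV] simp: flat_def algebra_simps power2_eq_square)
    then show ?thesis
      by (rule has_field_derivative_transform_within_open[where S = "{0<..}"]) (use 3 in \<open>auto simp: flat_def\<close>)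
  next
    case 2
    have "((\<lambda>x. poly ([:0, 1:] * p) (inverse x) * exp (- inverse x)) \<longlongrightarrow> 0) (at_right 0)"
      by (rule filterlim_compose[OF poly_exp_tendsto_0 filterlim_inverse_at_top_right])
    then have "((\<lambda>h. flat p h / h) \<longlongrightarrow> 0) (at_right 0)"
      by (rule Lim_transform_eventually) (auto simp: eventually_at_right_less flat_def divide_inverse intro!: eventually_at_rightI[of 0 1])
    moreover have "((\<lambda>h. flat p h / h) \<longlongrightarrow> 0) (at_left 0)"
      by (rule Lim_transform_eventually[OF tendsto_const]) (auto simp: flat_def intro!: eventually_at_leftI[of "-1" 0])
    ultimately have "((\<lambda>h. flat p h / h) \<longlongrightarrow> 0) (at 0)"
      using filterlim_split_at by blast
    then have "(flat p has_real_derivative 0) (at 0)"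
      by (simp add: DERIV_def flat_def)
    then show ?thesis using 2 by (simp add: flat_def)
  qed
qed

lemma smooth1_flat: "smooth1 (flat p)"
  by (rule smooth1_coinduct[of "\<lambda>f. \<exists>p. f = flat p"]) (use DERIV_flat in blast)+

lemma bumpE:
  assumes "bump a" obtains R where "0 < R" "\<And>x. R < \<bar>x\<bar> \<Longrightarrow> a x = 0"
proof -
  from assms obtain R where "\<forall>x. R < \<bar>x\<bar> \<longrightarrow> a x = 0" unfolding bump_def by blast
  then show thesis using that[of "max R 1"] by auto
qed

lemma bump_smooth1: "bump a \<Longrightarrow> smooth1 a" by (simp add: bump_def)

lemma bump_deriv: assumes "bump a" shows "bump (deriv a)"
proof -
  obtain R where R: "0 < R" "\<And>x. R < \<bar>x\<bar> \<Longrightarrow> a x = 0" using assms by (rule bumpE) blast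
  have "deriv a x = 0" if "R < \<bar>x\<bar>" for x
  proof -
    have "((\<lambda>_. 0) has_real_derivative 0) (at x)" by simp
    then have "(a has_real_derivative 0) (at x)"
      by (rule has_field_derivative_transform_within_open[where S = "{x. R < \<bar>x\<bar>}"])
         (use that R in \<open>auto intro!: open_Collect_less continuous_intros\<close>)
    then show ?thesis by (rule DERIV_imp_deriv)
  qed
  then show ?thesis using assms smooth1_deriv unfolding bump_def by blast
qed

lemma bump_derivs: "bump a \<Longrightarrow> bump ((deriv ^^ k) a)"
  by (induction k) (auto intro: bump_deriv)

lemma bump_add: assumes "bump a" "bump b" shows "bump (\<lambda>x. a x + b x)"
proof -
  obtain R S where "\<And>x. R < \<bar>x\<bar> \<Longrightarrow> a x = 0" "\<And>x. S < \<bar>x\<bar> \<Longrightarrow> b x = 0"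
    using assms by (metis bumpE)
  then have "\<forall>x. max R S < \<bar>x\<bar> \<longrightarrow> a x + b x = 0" by simp
  then show ?thesis using assms smooth1_add unfolding bump_def by blast
qed

lemma bump_rescale: assumes "bump a" "q \<noteq> 0" shows "bump (\<lambda>x. c * a (q * x))"
proof -
  obtain R where R: "0 < R" "\<And>x. R < \<bar>x\<bar> \<Longrightarrow> a x = 0" using assms(1) by (rule bumpE) blast
  have "c * a (q * x) = 0" if "R / \<bar>q\<bar> < \<bar>x\<bar>" for x
    using that R(2)[of "q * x"] assms(2) by (simp add: field_simps abs_mult)
  then show ?thesis
    using smooth1_affine[OF bump_smooth1[OF assms(1)], of c q 0] unfolding bump_def by auto
qed

lemma bump_continuous: "bump a \<Longrightarrow> continuous_on S a"
  by (meson bump_smooth1 smooth1_DERIV DERIV_isCont continuous_at_imp_continuous_on)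

lemma bump_bounded: assumes "bump a" obtains B where "0 < B" "\<And>x. \<bar>a x\<bar> \<le> B"
proof -
  obtain R where R: "0 < R" "\<And>x. R < \<bar>x\<bar> \<Longrightarrow> a x = 0" using assms(1) by (rule bumpE) blast
  have "compact (a ` {-R..R})" by (intro compact_continuous_image bump_continuous assms) auto
  then obtain B where B: "\<And>x. x \<in> {-R..R} \<Longrightarrow> \<bar>a x\<bar> \<le> B"
    using compact_imp_bounded by (fastforce simp: bounded_iff)
  have "\<bar>a x\<bar> \<le> max B 1" for x
    using B[of x] R(2)[of x] by (cases "R < \<bar>x\<bar>") (auto simp: abs_if split: if_splits)
  then show thesis by (intro that[of "max B 1"]) auto
qed

lemma bump_integrable: assumes "bump a" shows "integrable lborel a"
proof -
  obtain R where R: "0 < R" "\<And>x. R < \<bar>x\<bar> \<Longrightarrow> a x = 0" using assms(1) by (rule bumpE) blast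
  have "set_integrable lborel {-R..R} a"
    by (intro borel_integrable_atLeastAtMost' bump_continuous assms)
  moreover have "(\<lambda>x. indicat_real {-R..R} x *\<^sub>R a x) = a"
    by (rule ext) (use R(2) in \<open>auto simp: indicator_def abs_if not_less split: if_splits; force\<close>)
  ultimately show ?thesis unfolding set_integrable_def by simp
qed

lemma bump_exists: "\<exists>b. bump b \<and> integral\<^sup>L lborel b = 1"
proof -
  define b where "b x = flat 1 (1 * x + 1) * flat 1 ((-1) * x + 1)" for x
  have "smooth1 b" unfolding b_def
    using smooth1_affine[OF smooth1_flat, of 1 1 1 1] smooth1_affine[OF smooth1_flat, of 1 1 "-1" 1]
    by (intro smooth1_mult) simp_all
  then have bb: "bump b" unfolding bump_def by (auto simp: b_def flat_def intro!: exI[of _ 1])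
  have nn: "0 \<le> b x" for x by (simp add: b_def flat_def)
  have "integral\<^sup>L lborel b \<noteq> 0"
  proof
    assume "integral\<^sup>L lborel b = 0"
    then have "AE x in lborel. b x = 0"
      using integral_nonneg_eq_0_iff_AE[OF bump_integrable[OF bb]] nn by simp
    then have "AE x in lborel. x \<notin> {-1<..<1::real}"
      by eventually_elim (auto simp: b_def flat_def split: if_splits)
    then have "emeasure lborel {-1<..<1::real} = 0"
      by (subst (asm) AE_iff_measurable[where N = "{-1<..<1::real}"]) auto
    then show False by simp
  qed
  then have "integral\<^sup>L lborel (\<lambda>x. (1 / integral\<^sup>L lborel b) * b x) = 1" by simp
  moreover have "bump (\<lambda>x. (1 / integral\<^sup>L lborel b) * b x)"
    using bump_rescale[OF bb, of 1 "1 / integral\<^sup>L lborel b"] by simp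
  ultimately show ?thesis by blast
qed

section \<open>A kernel whose dyadic difference is a high derivative\<close>

text \<open>An antiderivative \<open>P\<close> of a test function is constant near \<open>-\<infinity>\<close> and near \<open>\<infinity>\<close>. Therefore
  \<open>P (x / 2) - P x\<close> has compact support, although \<open>P\<close> itself need not.\<close>

lemma bump_antiderivative_difference:
  assumes "bump a" shows "\<exists>t. bump t \<and> (\<forall>x. (t has_real_derivative a (x / 2) / 2 - a x) (at x))"
proof -
  obtain R where R: "0 < R" "\<And>x. R < \<bar>x\<bar> \<Longrightarrow> a x = 0" using assms(1) by (rule bumpE) blast
  have "isCont a x" for x using bump_continuous[OF assms, of UNIV] continuous_on_eq_continuous_at by blast
  then obtain P where P: "(P has_real_derivative a x) (at x)" for x
    using einterval_antiderivative[of "-\<infinity>" \<infinity> a] by (auto simp: has_real_derivative_iff_has_vector_derivative)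
  have const: "P x = P y" if "\<And>z. z \<in> S \<Longrightarrow> R < \<bar>z\<bar>" "convex S" "x \<in> S" "y \<in> S" for x y S
    using has_field_derivative_zero_constant[of S P] P R(2) that
    by (metis has_field_derivative_at_within)
  define t where "t x = P (x / 2) - P x" for x
  have D: "(t has_real_derivative a (x / 2) / 2 - a x) (at x)" for x
    unfolding t_def
    using has_real_derivative_affine[OF P, where q = "1/2" and x = x and p = 0 and c = 1] P by (auto intro!: DERIV_diff)
  have "smooth1 t"
  proof (rule smooth1_coinduct[of "\<lambda>f. f = t \<or> smooth1 f"])
    fix f assume "f = t \<or> smooth1 f"
    then show "\<exists>g. (g = t \<or> smooth1 g) \<and> (\<forall>x. (f has_real_derivative g x) (at x))"
    proof
      assume "f = t"
      moreover have "smooth1 (\<lambda>x. a (x / 2) / 2 - a x)"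
        using smooth1_add[OF smooth1_affine smooth1_affine, OF bump_smooth1 bump_smooth1, OF assms assms, of "1/2" "1/2" 0 "-1" 1 0]
        by simp
      ultimately show ?thesis using D by blast
    next
      assume "smooth1 f" then show ?thesis using smooth1_deriv smooth1_DERIV by blast
    qed
  qed simp
  moreover have "t x = 0" if "2 * R < \<bar>x\<bar>" for x
  proof (cases "0 < x")
    case True
    then have "P (x / 2) = P x" using that R by (intro const[of "{R<..}"]) auto
    then show ?thesis by (simp add: t_def)
  next
    case False
    then have "P (x / 2) = P x" using that R by (intro const[of "{..<-R}"]) auto
    then show ?thesis by (simp add: t_def)
  qed
  ultimately have "bump t" unfolding bump_def by blast
  with D show ?thesis by blast
qed

text \<open>Let \<open>S\<close> denote the rescaling of \<open>\<rho>\<close> to \<open>\<rho> (x / 2) / 2\<close>. If \<open>\<rho> - S \<rho>\<close> is the \<open>N\<close>-th derivative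
  of \<open>\<sigma>\<close>, then \<open>\<rho>' = (S \<rho> - 2\<^sup>N \<rho>) / (1 - 2\<^sup>N)\<close> has the same integral, and \<open>\<rho>' - S \<rho>'\<close> is a multiple of the \<open>N\<close>-th
  derivative of \<open>S \<sigma> - \<sigma>\<close>, because the \<open>N\<close>-th derivative of \<open>S \<sigma>\<close> carries the factor \<open>2\<^bsup>-N\<^esup>\<close>.
  The previous lemma supplies one more antiderivative.\<close>

lemma kernel_1d:
  assumes "1 \<le> N"
  shows "\<exists>\<rho> \<sigma>. bump \<rho> \<and> bump \<sigma> \<and> integral\<^sup>L lborel \<rho> = 1 \<and> (\<forall>x. \<rho> x - \<rho> (x / 2) / 2 = (deriv ^^ N) \<sigma> x)"
  using assms
proof (induction N rule: nat_induct_at_least)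
  case base
  obtain b where b: "bump b" "integral\<^sup>L lborel b = 1" using bump_exists by blast
  obtain t where t: "bump t" "\<And>x. (t has_real_derivative b (x / 2) / 2 - b x) (at x)"
    using bump_antiderivative_difference[OF b(1)] by blast
  have "bump (\<lambda>x. -1 * t (1 * x))" by (rule bump_rescale) (use t in auto)
  moreover have "deriv (\<lambda>x. -1 * t (1 * x)) x = b x - b (x / 2) / 2" for x
    by (rule DERIV_imp_deriv) (use DERIV_minus[OF t(2)[of x]] in simp)
  ultimately show ?case using b by (intro exI[of _ b] exI[of _ "\<lambda>x. -1 * t (1 * x)"]) auto
next
  case (Suc N)
  then obtain \<rho> \<sigma> where *: "bump \<rho>" "bump \<sigma>" "integral\<^sup>L lborel \<rho> = 1"
     "\<And>x. \<rho> x - \<rho> (x / 2) / 2 = (deriv ^^ N) \<sigma> x" by blast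
  obtain t where t: "bump t" "\<And>x. (t has_real_derivative \<sigma> (x / 2) / 2 - \<sigma> x) (at x)"
    using bump_antiderivative_difference[OF *(2)] by blast
  \<comment> \<open>nonzero, as the induction starts at \<open>N = 1\<close>\<close>
  define c :: real where "c = 1 - 2 ^ N"
  have c: "c \<noteq> 0" using power_increasing[of 1 N "2::real"] Suc(1) by (auto simp: c_def)
  define \<rho>' where "\<rho>' x = (1 / (2 * c)) * \<rho> (1/2 * x) + (- (2 ^ N) / c) * \<rho> (1 * x)" for x
  define \<sigma>' where "\<sigma>' x = (2 ^ N / c) * t (1 * x)" for x
  have b: "bump \<rho>'" "bump \<sigma>'"
    unfolding \<rho>'_def \<sigma>'_def by (intro bump_add bump_rescale * t; simp)+
  have int2: "(\<integral>x. \<rho> (1/2 * x) \<partial>lborel) = 2"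
    using lborel_integral_real_affine[of "1/2" \<rho> 0] *(3) by simp
  have "integral\<^sup>L lborel \<rho>' = (1 / (2 * c)) * 2 + (- (2 ^ N) / c) * 1"
    unfolding \<rho>'_def
    by (subst Bochner_Integration.integral_add)
       (use bump_integrable[OF bump_rescale[OF *(1), of "1/2" 1]] bump_integrable[OF *(1)] int2 *(3) in simp_all)
  also have "\<dots> = 1" using c by (simp add: field_simps c_def)
  finally have i: "integral\<^sup>L lborel \<rho>' = 1" .
  have "(deriv ^^ Suc N) \<sigma>' x = \<rho>' x - \<rho>' (x / 2) / 2" for x
  proof -
    have d: "deriv \<sigma>' = (\<lambda>x. (2 ^ N / (2 * c)) * \<sigma> (1/2 * x + 0) + (- (2 ^ N) / c) * \<sigma> (1 * x + 0))"
      unfolding \<sigma>'_def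
      by (rule ext, rule DERIV_imp_deriv)
         (use has_real_derivative_affine[OF t(2), where q = 1 and p = 0 and c = "2 ^ N / c"] c in \<open>simp add: field_simps\<close>)
    let ?F = "\<lambda>k x. (2 ^ N / (2 * c)) * (1/2) ^ k * (deriv ^^ k) \<sigma> (1/2 * x + 0)
        + (- (2 ^ N) / c) * 1 ^ k * (deriv ^^ k) \<sigma> (1 * x + 0)"
    have F: "(?F k has_real_derivative ?F (Suc k) x) (at x)" for k x
    proof (rule DERIV_add)
      note A = has_real_derivative_affine[OF smooth1D[OF bump_smooth1[OF *(2)], of k]]
      show "((\<lambda>x. (2 ^ N / (2 * c)) * (1/2) ^ k * (deriv ^^ k) \<sigma> (1/2 * x + 0)) has_real_derivative
        (2 ^ N / (2 * c)) * (1/2) ^ Suc k * (deriv ^^ Suc k) \<sigma> (1/2 * x + 0)) (at x)"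
        using A[where q = "1/2" and x = x and p = 0 and c = "(2 ^ N / (2 * c)) * (1/2) ^ k"] by (simp only: power_Suc2 mult.assoc)
      show "((\<lambda>x. (- (2 ^ N) / c) * 1 ^ k * (deriv ^^ k) \<sigma> (1 * x + 0)) has_real_derivative
        (- (2 ^ N) / c) * 1 ^ Suc k * (deriv ^^ Suc k) \<sigma> (1 * x + 0)) (at x)"
        using A[where q = 1 and x = x and p = 0 and c = "(- (2 ^ N) / c) * 1 ^ k"] by (simp only: power_Suc2 mult.assoc)
    qed
    have "(deriv ^^ N) (?F 0) = ?F N" by (rule derivs_unique[of ?F, OF F])
    moreover have "(deriv ^^ Suc N) \<sigma>' = (deriv ^^ N) (?F 0)"
      unfolding funpow_Suc_right comp_apply d by simp
    ultimately have "(deriv ^^ Suc N) \<sigma>' x = ?F N x" by simp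
    also have "\<dots> = (1 / (2 * c)) * (deriv ^^ N) \<sigma> (x / 2) - (2 ^ N / c) * (deriv ^^ N) \<sigma> x"
      by (simp add: power_one_over field_simps)
    also have "\<dots> = \<rho>' x - \<rho>' (x / 2) / 2"
      unfolding *(4)[symmetric] \<rho>'_def using c by (simp add: field_simps)
    finally show ?thesis .
  qed
  with b i show ?case by (intro exI[of _ \<rho>'] exI[of _ \<sigma>']) auto
qed

section \<open>Product kernels\<close>

text \<open>The tensor product of the one-variable functions \<open>a j\<close>. All kernels below are of this form,
  so that their partial derivatives, and the one that \<open>mi_partial\<close> selects, are explicit.\<close>

definition pker :: "('n::finite \<Rightarrow> real \<Rightarrow> real) \<Rightarrow> real ^ 'n \<Rightarrow> real" where
  "pker a x = (\<Prod>j\<in>UNIV. a j (x $ j))"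

text \<open>The factors of the \<open>k\<close>-th partial derivative in direction \<open>i\<close> of \<open>pker a\<close>.\<close>

definition pderiv_at :: "'n \<Rightarrow> nat \<Rightarrow> ('n \<Rightarrow> real \<Rightarrow> real) \<Rightarrow> 'n \<Rightarrow> real \<Rightarrow> real" where
  "pderiv_at i k a = a(i := (deriv ^^ k) (a i))"

lemma pker_upd: "pker (a(i := b)) x = b (x $ i) * (\<Prod>j\<in>UNIV - {i}. a j (x $ j))"
proof -
  have "pker (a(i := b)) x = (a(i := b)) i (x $ i) * (\<Prod>j\<in>UNIV - {i}. (a(i := b)) j (x $ j))"
    unfolding pker_def by (rule prod.remove) auto
  also have "(\<Prod>j\<in>UNIV - {i}. (a(i := b)) j (x $ j)) = (\<Prod>j\<in>UNIV - {i}. a j (x $ j))"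
    by (rule prod.cong) auto
  finally show ?thesis unfolding fun_upd_same .
qed

lemma has_derivative_pker:
  assumes "\<And>j. smooth1 (a j)"
  shows "((\<lambda>y. pker a (y - x)) has_derivative
     (\<lambda>v. \<Sum>i\<in>UNIV. v $ i * pker (pderiv_at i 1 a) (y - x))) (at y)"
proof -
  have "((\<lambda>y. a j ((y - x) $ j)) has_derivative (\<lambda>v. deriv (a j) ((y - x) $ j) * v $ j)) (at y)" for j
  proof -
    have c: "((\<lambda>y. (y - x) $ j) has_derivative (\<lambda>v. v $ j)) (at y)"
      by (auto intro!: derivative_eq_intros bounded_linear_imp_has_derivative bounded_linear_vec_nth)
    have "(a j has_derivative (*) (deriv (a j) ((y - x) $ j))) (at ((y - x) $ j))"
      using smooth1_DERIV[OF assms] by (simp add: has_field_derivative_def)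
    from has_derivative_compose[OF c this] show ?thesis .
  qed
  from has_derivative_prod[where I = UNIV, OF this]
  show ?thesis unfolding pderiv_at_def pker_upd by (simp add: pker_def[abs_def] mult_ac)
qed

lemma partial_eq: 
  assumes "(f has_derivative (\<lambda>v. \<Sum>i\<in>UNIV. v $ i * D i)) (at (y :: real ^ 'n))"
  shows "partial i f y = D i"
proof -
  have "frechet_derivative f (at y) = (\<lambda>v. \<Sum>i\<in>UNIV. v $ i * D i)"
    using frechet_derivative_at[OF assms] by simp
  then show ?thesis unfolding partial_def by (simp add: axis_def if_distrib[of "\<lambda>u. u * _"] cong: if_cong)
qed

text \<open>The factors of \<open>iterated_partial l\<close> applied to \<open>pker a\<close>: only the number of occurrences of
  each coordinate in \<open>l\<close> matters.\<close>

definition list_derivs :: "'n list \<Rightarrow> ('n \<Rightarrow> real \<Rightarrow> real) \<Rightarrow> 'n \<Rightarrow> real \<Rightarrow> real" where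
  "list_derivs l a j = (deriv ^^ count_list l j) (a j)"

lemma pderiv_at_list_derivs: "pderiv_at i 1 (list_derivs l a) = list_derivs (i # l) a"
  by (rule ext) (simp add: pderiv_at_def list_derivs_def)

lemma iterated_partial_pker:
  assumes "\<And>j. smooth1 (a j)"
  shows "iterated_partial l (\<lambda>y. pker a (y - x)) = (\<lambda>y. pker (list_derivs l a) (y - x))"
proof (induction l)
  case Nil
  show ?case by (simp add: list_derivs_def[abs_def])
next
  case (Cons i l)
  have "smooth1 (list_derivs l a j)" for j
    unfolding list_derivs_def by (rule smooth1_derivs[OF assms])
  from partial_eq[OF has_derivative_pker[of "list_derivs l a", OF this]]
  show ?case unfolding iterated_partial.simps Cons pderiv_at_list_derivs by blast
qed

lemma smooth_pker:
  assumes "\<And>j. smooth1 (a j)"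
  shows "smooth (\<lambda>y. pker a (y - x))"
  unfolding smooth_def iterated_partial_pker[OF assms]
  using has_derivative_pker[of "list_derivs _ a" x] smooth1_derivs[OF assms]
  unfolding list_derivs_def differentiable_def by blast

section \<open>Multi-indices supported on one coordinate\<close>

text \<open>The multi-index \<open>k\<close> times the \<open>i\<close>-th unit vector.\<close>

definition single_mi :: "'n \<Rightarrow> nat \<Rightarrow> 'n \<Rightarrow> nat" where
  "single_mi i k = (\<lambda>j. if j = i then k else 0)"

lemma mi_order_single [simp]: "mi_order (single_mi i k) = k"
  by (simp add: mi_order_def single_mi_def)

lemma count_list_replicate_same: "count_list (replicate k i) i = k"
  by (induction k) auto

lemma count_list_replicate_other: "j \<noteq> i \<Longrightarrow> count_list (replicate k i) j = 0"
  by (induction k) auto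

lemma count_list_single_mi: "(\<forall>j. count_list l j = single_mi i k j) \<longleftrightarrow> l = replicate k i"
proof
  assume *: "\<forall>j. count_list l j = single_mi i k j"
  have "j = i" if "j \<in> set l" for j
    using that * count_list_0_iff[of l j] by (auto simp: single_mi_def split: if_splits)
  then have "l = replicate (length l) i" by (metis replicate_eqI)
  moreover from this have "count_list l i = length l"
    by (metis count_list_replicate_same)
  ultimately show "l = replicate k i" using * by (auto simp: single_mi_def)
qed (auto simp: single_mi_def count_list_replicate_same count_list_replicate_other)

text \<open>For such a multi-index only one list of differentiations is possible, hence the choice in
  \<open>mi_partial\<close> is determined without Schwarz's theorem.\<close>

lemma mi_partial_single: "mi_partial (single_mi i k) \<phi> = iterated_partial (replicate k i) \<phi>"
  unfolding mi_partial_def count_list_single_mi by simp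

lemma list_derivs_replicate: "list_derivs (replicate k i) a = pderiv_at i k a"
  by (rule ext) (auto simp: list_derivs_def pderiv_at_def count_list_replicate_same count_list_replicate_other)

lemma finite_mi_order_le: "finite {\<alpha> :: ('n::finite) multiindex. mi_order \<alpha> \<le> k}"
proof (rule finite_subset)
  show "{\<alpha> :: 'n multiindex. mi_order \<alpha> \<le> k} \<subseteq> PiE UNIV (\<lambda>_. {..k})"
  proof
    fix \<alpha> :: "'n multiindex" assume "\<alpha> \<in> {\<alpha>. mi_order \<alpha> \<le> k}"
    moreover have "\<alpha> i \<le> mi_order \<alpha>" for i
      unfolding mi_order_def by (rule member_le_sum) auto
    ultimately show "\<alpha> \<in> PiE UNIV (\<lambda>_. {..k})" by (auto intro: order_trans)
  qed
  show "finite (PiE UNIV (\<lambda>_. {..k}) :: 'n multiindex set)" by (intro finite_PiE) auto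
qed

lemma mi_order_le_1: "{\<alpha> :: ('n::finite) multiindex. mi_order \<alpha> \<le> 1} = insert (\<lambda>_. 0) (range (\<lambda>i. single_mi i 1))"
proof (intro subset_antisym subsetI)
  fix \<alpha> :: "'n multiindex" assume a: "\<alpha> \<in> {\<alpha>. mi_order \<alpha> \<le> 1}"
  show "\<alpha> \<in> insert (\<lambda>_. 0) (range (\<lambda>i. single_mi i 1))"
  proof (cases "\<forall>i. \<alpha> i = 0")
    case False
    then obtain i where i: "\<alpha> i \<noteq> 0" by blast
    have "mi_order \<alpha> = \<alpha> i + (\<Sum>j\<in>UNIV - {i}. \<alpha> j)" unfolding mi_order_def by (rule sum.remove) auto
    moreover have "mi_order \<alpha> \<le> 1" using a by simp
    ultimately have "\<alpha> i = 1" "(\<Sum>j\<in>UNIV - {i}. \<alpha> j) = 0" using i by linarith+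
    then have "\<alpha> j = 0" if "j \<noteq> i" for j using that by simp
    with \<open>\<alpha> i = 1\<close> have "\<alpha> j = single_mi i 1 j" for j by (simp add: single_mi_def)
    then have "\<alpha> = single_mi i 1" by blast
    then show ?thesis by blast
  qed auto
qed (auto simp: mi_order_def single_mi_def)

lemma sum_mi_order_le_1:
  "(\<Sum>\<alpha> | mi_order \<alpha> \<le> 1. sup_norm (mi_partial \<alpha> \<phi>)) = sup_norm \<phi> + (\<Sum>i\<in>UNIV. sup_norm (partial i \<phi>))"
  for \<phi> :: "real ^ 'n::finite \<Rightarrow> real"
proof -
  have inj: "inj (\<lambda>i :: 'n. single_mi i 1)"
    by (rule injI) (auto simp: single_mi_def fun_eq_iff split: if_splits)
  have "(\<lambda>_. 0) = (single_mi undefined 0 :: 'n multiindex)" by (auto simp: single_mi_def)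
  then have 0: "mi_partial (\<lambda>_. 0) \<phi> = \<phi>" using mi_partial_single[of undefined 0 \<phi>] by simp
  have "(\<lambda>_. 0) \<notin> range (\<lambda>i :: 'n. single_mi i 1)"
  proof
    assume "(\<lambda>_. 0) \<in> range (\<lambda>i :: 'n. single_mi i 1)"
    then obtain i :: 'n where "(\<lambda>_. 0) = single_mi i 1" by blast
    from fun_cong[OF this, of i] show False by (simp add: single_mi_def)
  qed
  moreover have "mi_partial (single_mi i 1) \<phi> = partial i \<phi>" for i
    by (simp add: mi_partial_single)
  ultimately show ?thesis
    unfolding mi_order_le_1 by (subst sum.insert) (simp_all add: sum.reindex[OF inj] 0 del: One_nat_def)
qed

section \<open>Testing with unnormalised functions\<close>

lemma iterated_partial_cmult:
  assumes "smooth \<phi>"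
  shows "iterated_partial l (\<lambda>x. c * \<phi> x) = (\<lambda>x. c * iterated_partial l \<phi> x)"
proof (induction l)
  case (Cons i l)
  have "partial i (\<lambda>x. c * iterated_partial l \<phi> x) x = c * partial i (iterated_partial l \<phi>) x" for x
  proof -
    have "(iterated_partial l \<phi> has_derivative frechet_derivative (iterated_partial l \<phi>) (at x)) (at x)"
      using assms unfolding smooth_def frechet_derivative_works by blast
    then have "((\<lambda>x. c * iterated_partial l \<phi> x) has_derivative (\<lambda>v. c * frechet_derivative (iterated_partial l \<phi>) (at x) v)) (at x)"
      by (rule has_derivative_mult_right)
    from frechet_derivative_at[OF this] show ?thesis unfolding partial_def by metis
  qed
  then show ?case using Cons by auto
qed simp

lemma smooth_cmult: "smooth \<phi> \<Longrightarrow> smooth (\<lambda>x. c * \<phi> x)"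
  unfolding smooth_def using iterated_partial_cmult[of \<phi> _ c] smooth_def by (metis differentiable_cmult_left_iff)

lemma partial_cmult: "smooth \<phi> \<Longrightarrow> partial i (\<lambda>x. c * \<phi> x) = (\<lambda>x. c * partial i \<phi> x)"
  using iterated_partial_cmult[of \<phi> "[i]" c] by simp

lemma sup_norm_le: "(\<And>x. \<bar>f x\<bar> \<le> B) \<Longrightarrow> sup_norm f \<le> ennreal B"
  unfolding sup_norm_def by (intro SUP_least ennreal_leI)

lemma signed_integral_cmult: "signed_integral \<sigma> (\<lambda>x. c * \<phi> x) = c * signed_integral \<sigma> \<phi>"
  unfolding signed_integral_def by (simp add: algebra_simps)

text \<open>The distance \<open>d1\<close> as an inequality for arbitrary smooth functions with bounded first
  derivatives, obtained by normalising the test function.\<close>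

lemma d1_test:
  fixes \<phi> :: "real ^ 'n::finite \<Rightarrow> real" and d B B' :: real
  assumes d: "d1 \<sigma> \<tau> \<le> ennreal d" "0 \<le> d"
    and \<phi>: "smooth \<phi>" "\<And>x. \<bar>\<phi> x\<bar> \<le> B" "\<And>i x. \<bar>partial i \<phi> x\<bar> \<le> B'"
  shows "\<bar>signed_integral \<sigma> \<phi> - signed_integral \<tau> \<phi>\<bar> \<le> (B + CARD('n) * B') * d"
proof -
  have B: "0 \<le> B" "0 \<le> B'" using \<phi>(2,3) abs_ge_zero order_trans by blast+
  define A where "A = B + CARD('n) * B'"
  have bound: "\<bar>signed_integral \<sigma> \<phi> - signed_integral \<tau> \<phi>\<bar> \<le> A' * d" if A': "A \<le> A'" "0 < A'" for A'
  proof -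
    define \<psi> where "\<psi> x = (1 / A') * \<phi> x" for x
    have "sup_norm \<psi> \<le> ennreal (B / A')"
      by (rule sup_norm_le) (use \<phi>(2) A' in \<open>auto simp: \<psi>_def divide_right_mono\<close>)
    moreover have "sup_norm (partial i \<psi>) \<le> ennreal (B' / A')" for i
    proof -
      have "partial i \<psi> = (\<lambda>x. (1 / A') * partial i \<phi> x)"
        unfolding \<psi>_def by (rule partial_cmult[OF \<phi>(1)])
      then show ?thesis using \<phi>(3) A' by (auto simp: divide_right_mono intro!: sup_norm_le)
    qed
    ultimately have "sup_norm \<psi> + (\<Sum>i\<in>UNIV. sup_norm (partial i \<psi>)) \<le> ennreal (B / A') + (\<Sum>i\<in>(UNIV::'n set). ennreal (B' / A'))"
      by (intro add_mono sum_mono)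
    also have "\<dots> = ennreal (B / A' + CARD('n) * (B' / A'))"
      using B A' by (simp add: ennreal_of_nat_eq_real_of_nat ennreal_mult'[symmetric])
    also have "\<dots> \<le> ennreal 1" using A' by (intro ennreal_leI) (simp add: A_def field_simps)
    finally have "smooth \<psi> \<and> (\<Sum>\<alpha> | mi_order \<alpha> \<le> 1. sup_norm (mi_partial \<alpha> \<psi>)) \<le> 1"
      using smooth_cmult[OF \<phi>(1), of "1 / A'"] unfolding sum_mi_order_le_1 by (simp add: \<psi>_def[abs_def])
    then have "ennreal \<bar>signed_integral \<sigma> \<psi> - signed_integral \<tau> \<psi>\<bar> \<le> d1 \<sigma> \<tau>"
      unfolding d1_def by (intro SUP_upper) simp
    then have "ennreal \<bar>signed_integral \<sigma> \<psi> - signed_integral \<tau> \<psi>\<bar> \<le> ennreal d" using d(1) by order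
    then have "\<bar>signed_integral \<sigma> \<psi> - signed_integral \<tau> \<psi>\<bar> \<le> d" using d(2) by simp
    moreover have "signed_integral \<sigma> \<psi> - signed_integral \<tau> \<psi> = (signed_integral \<sigma> \<phi> - signed_integral \<tau> \<phi>) / A'"
      unfolding \<psi>_def signed_integral_cmult by (simp add: diff_divide_distrib)
    ultimately show ?thesis using A' by (simp add: field_simps)
  qed
  show ?thesis
  proof (cases "0 < A")
    case True then show ?thesis using bound[of A] by (simp add: A_def)
  next
    case False
    moreover have "0 \<le> A" using B by (simp add: A_def)
    ultimately have "A = 0" by simp
    \<comment> \<open>here \<open>\<phi>\<close> is zero, and any positive number serves as normalisation\<close>
    have "\<bar>signed_integral \<sigma> \<phi> - signed_integral \<tau> \<phi>\<bar> \<le> 0 + e" if "0 < e" for e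
    proof -
      have "\<bar>signed_integral \<sigma> \<phi> - signed_integral \<tau> \<phi>\<bar> \<le> (e / (d + 1)) * d"
        by (rule bound) (use that d \<open>A = 0\<close> in auto)
      also have "\<dots> \<le> e" using that d by (simp add: field_simps)
      finally show ?thesis by simp
    qed
    from field_le_epsilon[OF this] show ?thesis using \<open>A = 0\<close> by (simp add: A_def)
  qed
qed

section \<open>Affine substitutions\<close>

lemma lborel_integral_affine:
  fixes t :: "'a::euclidean_space" and c :: real and g :: "'a \<Rightarrow> real"
  assumes [measurable]: "g \<in> borel_measurable borel" and c: "c \<noteq> 0"
  shows "(\<integral>x. g x \<partial>lborel) = \<bar>c\<bar> ^ DIM('a) * (\<integral>x. g (t + c *\<^sub>R x) \<partial>lborel)"
  by (subst lborel_affine[OF c, of t])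
     (simp add: integral_density integral_distr)

lemma lborel_integrable_affine:
  fixes t :: "'a::euclidean_space" and c :: real and g :: "'a \<Rightarrow> real"
  assumes g: "integrable lborel g" and c: "c \<noteq> 0"
  shows "integrable lborel (\<lambda>x. g (t + c *\<^sub>R x))"
proof -
  have [measurable]: "g \<in> borel_measurable borel" using g by auto
  have "integrable (density (distr lborel borel (\<lambda>x. t + c *\<^sub>R x)) (\<lambda>_. ennreal (\<bar>c\<bar> ^ DIM('a)))) g"
    using g lborel_affine[OF c, of t] by simp
  then show ?thesis using c
    by (simp add: integrable_density integrable_distr_eq)
qed

lemma reflect_integral:
  fixes g :: "'a::euclidean_space \<Rightarrow> real"
  assumes "integrable lborel g"
  shows "integrable lborel (\<lambda>x. g (y - x))" "(\<integral>x. g (y - x) \<partial>lborel) = (\<integral>x. g x \<partial>lborel)"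
  using lborel_integrable_affine[OF assms, of "-1" y] lborel_integral_affine[of g "-1" y] assms by auto

section \<open>Compactly supported product kernels\<close>

text \<open>All factors are test functions.\<close>

definition bumps :: "('n \<Rightarrow> real \<Rightarrow> real) \<Rightarrow> bool" where
  "bumps a \<longleftrightarrow> (\<forall>j. bump (a j))"

text \<open>Dilation by \<open>h\<close> that preserves integrals: \<open>pker (scale h a) x = h\<^bsup>-d\<^esup> pker a (x / h)\<close>.\<close>

definition scale :: "real \<Rightarrow> ('n \<Rightarrow> real \<Rightarrow> real) \<Rightarrow> 'n \<Rightarrow> real \<Rightarrow> real" where
  "scale h a = (\<lambda>j t. (1 / h) * a j ((1 / h) * t))"

text \<open>The \<open>L\<^sup>1\<close> norm of a kernel.\<close>

definition knorm :: "('n::finite \<Rightarrow> real \<Rightarrow> real) \<Rightarrow> real" where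
  "knorm a = (\<integral>x. \<bar>pker a x\<bar> \<partial>lborel)"

lemma bumps_smooth1: "bumps a \<Longrightarrow> smooth1 (a j)"
  by (simp add: bumps_def bump_def)

lemma bumps_pderiv_at: "bumps a \<Longrightarrow> bumps (pderiv_at i k a)"
  by (simp add: bumps_def pderiv_at_def bump_derivs)

lemma bumps_list_derivs: "bumps a \<Longrightarrow> bumps (list_derivs l a)"
  by (simp add: bumps_def list_derivs_def bump_derivs)

lemma bumps_scale: "bumps a \<Longrightarrow> h \<noteq> 0 \<Longrightarrow> bumps (scale h a)"
  unfolding bumps_def scale_def using bump_rescale[of "a _" "1 / h" "1 / h"] by simp

lemma pker_scale: "pker (scale h a) x = (1 / h) ^ CARD('n) * pker a ((1 / h) *\<^sub>R x)"
  for x :: "real ^ 'n::finite"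
  unfolding pker_def scale_def prod.distrib by simp

lemma pker_pderiv_at_scale:
  assumes "bumps a"
  shows "pker (pderiv_at i k (scale h a)) x = (1 / h) ^ k * pker (scale h (pderiv_at i k a)) x"
proof -
  have "(deriv ^^ k) (scale h a i) = (\<lambda>x. (1 / h) * (1 / h) ^ k * (deriv ^^ k) (a i) ((1 / h) * x))"
    unfolding scale_def
    using derivs_affine[OF bumps_smooth1[OF assms], of k "1 / h" i "1 / h" 0] by simp
  moreover have "scale h (pderiv_at i k a) = (scale h a)(i := (\<lambda>x. (1 / h) * (deriv ^^ k) (a i) ((1 / h) * x)))"
    by (rule ext) (simp add: scale_def pderiv_at_def)
  ultimately show ?thesis
    unfolding pderiv_at_def pker_upd by (simp add: pker_upd mult_ac)
qed

lemma pker_continuous: assumes "bumps a" shows "continuous_on S (pker a)"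
proof -
  have "continuous_on S (\<lambda>x. a j (x $ j))" for j
    using assms continuous_on_compose2[OF bump_continuous[of "a j" UNIV], of S "\<lambda>x. x $ j"]
    by (simp add: bumps_def continuous_on_component)
  then show ?thesis unfolding pker_def[abs_def] by (intro continuous_on_prod)
qed

lemma pker_measurable [measurable]: "bumps a \<Longrightarrow> pker a \<in> borel_measurable borel"
  by (intro borel_measurable_continuous_onI pker_continuous)

lemma pker_support:
  fixes a :: "'n::finite \<Rightarrow> real \<Rightarrow> real"
  assumes "bumps a"
  obtains R where "0 < R" "\<And>x. R < norm x \<Longrightarrow> pker a x = 0"
proof -
  have "\<exists>R. 0 < R \<and> (\<forall>x. R < \<bar>x\<bar> \<longrightarrow> a j x = 0)" for j
    using bumpE[of "a j"] assms unfolding bumps_def by metis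
  then obtain R where R: "\<And>j. 0 < R j" "\<And>j x. R j < \<bar>x\<bar> \<Longrightarrow> a j x = 0" by metis
  have "pker a x = 0" if "(\<Sum>j\<in>UNIV. R j) < norm x" for x
  proof -
    have "\<exists>j. R j < \<bar>x $ j\<bar>"
    proof (rule ccontr)
      assume "\<not> ?thesis"
      then have "(\<Sum>j\<in>UNIV. \<bar>x $ j\<bar>) \<le> (\<Sum>j\<in>UNIV. R j)" by (intro sum_mono) (meson not_le)
      with norm_le_l1_cart[of x] that show False by linarith
    qed
    then show ?thesis unfolding pker_def using R(2) by (auto intro!: prod_zero)
  qed
  moreover have "0 < (\<Sum>j\<in>UNIV. R j)" using R(1) by (intro sum_pos) auto
  ultimately show thesis using that by blast
qed

lemma pker_bounded:
  fixes a :: "'n::finite \<Rightarrow> real \<Rightarrow> real"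
  assumes "bumps a" obtains B where "0 < B" "\<And>x. \<bar>pker a x\<bar> \<le> B"
proof -
  have "\<exists>B. 0 < B \<and> (\<forall>x. \<bar>a j x\<bar> \<le> B)" for j
    using bump_bounded[of "a j"] assms unfolding bumps_def by metis
  then obtain B where B: "\<And>j. 0 < B j" "\<And>j x. \<bar>a j x\<bar> \<le> B j" by metis
  have "\<bar>pker a x\<bar> \<le> (\<Prod>j\<in>UNIV. B j)" for x
    unfolding pker_def abs_prod by (intro prod_mono) (use B in auto)
  moreover have "0 < (\<Prod>j\<in>UNIV. B j)" using B(1) by (intro prod_pos) auto
  ultimately show thesis using that by blast
qed

lemma pker_integrable:
  assumes "bumps a" shows "integrable lborel (pker a)"
proof -
  obtain R where R: "0 < R" "\<And>x. R < norm x \<Longrightarrow> pker a x = 0" using pker_support[OF assms] by blast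
  obtain B where B: "0 < B" "\<And>x. \<bar>pker a x\<bar> \<le> B" using pker_bounded[OF assms] by blast
  have "integrable lborel (\<lambda>x. B * indicator (cball 0 R) x)"
    by (intro integrable_mult_right integrable_real_indicator) (use emeasure_bounded_finite[OF bounded_cball] in auto)
  then show ?thesis
  proof (rule Bochner_Integration.integrable_bound)
    show "AE x in lborel. norm (pker a x) \<le> norm (B * indicator (cball 0 R) x)"
      using R B by (intro AE_I2) (auto simp: indicator_def not_le)
  qed (use assms in measurable)
qed

lemma pker_reflect_integrable: "bumps a \<Longrightarrow> integrable lborel (\<lambda>x. pker a (y - x))"
  by (intro reflect_integral pker_integrable)

lemma knorm_reflect: "bumps a \<Longrightarrow> (\<integral>x. \<bar>pker a (y - x)\<bar> \<partial>lborel) = knorm a"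
  unfolding knorm_def using reflect_integral(2)[OF integrable_abs[OF pker_integrable]] .

lemma knorm_translate: "bumps a \<Longrightarrow> (\<integral>x. \<bar>pker a (x - y)\<bar> \<partial>lborel) = knorm a"
  unfolding knorm_def using lborel_integral_affine[of "\<lambda>x. \<bar>pker a x\<bar>" 1 "-y"] by simp

lemma knorm_nonneg [simp]: "0 \<le> knorm a" unfolding knorm_def by simp

lemma knorm_scale: 
  assumes "bumps a" "0 < h" shows "knorm (scale h a) = knorm a"
proof -
  have "knorm a = \<bar>1 / h\<bar> ^ CARD('a) * (\<integral>x. \<bar>pker a (0 + (1 / h) *\<^sub>R x)\<bar> \<partial>lborel)"
    unfolding knorm_def by (subst lborel_integral_affine[of _ "1 / h" 0]) (use assms in auto)
  also have "\<dots> = knorm (scale h a)"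
    unfolding knorm_def pker_scale abs_mult using assms(2) by simp
  finally show ?thesis by simp
qed

lemma integral_pker:
  fixes a :: "'n::finite \<Rightarrow> real \<Rightarrow> real"
  assumes "bumps a" shows "(\<integral>x. pker a x \<partial>lborel) = (\<Prod>j\<in>UNIV. integral\<^sup>L lborel (a j))"
proof -
  interpret product_sigma_finite "\<lambda>_::real ^ 'n. lborel :: real measure" by standard
  \<comment> \<open>Lebesgue measure is a product over \<open>Basis\<close>, so the factors are indexed by basis vectors\<close>
  define f where "f b = a (SOME j. b = axis j 1)" for b :: "real ^ 'n"
  have f_axis: "f (axis j 1) = a j" for j unfolding f_def by (simp add: axis_eq_axis)
  have inj: "inj (\<lambda>j :: 'n. axis j (1 :: real))" by (rule injI) (simp add: axis_eq_axis)
  have Basis: "(Basis :: (real ^ 'n) set) = range (\<lambda>j. axis j 1)" by (auto simp: Basis_vec_def)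
  have pk: "pker a x = (\<Prod>b\<in>Basis. f b (x \<bullet> b))" for x
    unfolding Basis pker_def by (simp add: prod.reindex[OF inj] f_axis inner_axis)
  have fi: "integrable lborel (f b)" for b unfolding f_def using assms by (auto simp: bumps_def intro: bump_integrable)
  have [measurable]: "f b \<in> borel_measurable borel" for b using fi[of b] by auto
  have meas: "(\<lambda>f. \<Sum>b\<in>Basis. f b *\<^sub>R b) \<in> borel_measurable (\<Pi>\<^sub>M b\<in>(Basis :: (real ^ 'n) set). lborel)"
  proof (intro borel_measurable_sum borel_measurable_scaleR borel_measurable_const)
    fix b :: "real ^ 'n" assume "b \<in> Basis"
    from measurable_component_singleton[OF this, of "\<lambda>_. lborel"]
    show "(\<lambda>f. f b) \<in> borel_measurable (\<Pi>\<^sub>M b\<in>(Basis :: (real ^ 'n) set). lborel)" by simp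
  qed
  have "(\<integral>x. pker a x \<partial>lborel) = (\<integral>u. (\<Prod>b\<in>Basis. f b (u b)) \<partial>(\<Pi>\<^sub>M b\<in>Basis. lborel))"
    unfolding pk using meas by (subst lborel_eq, subst integral_distr) (auto intro!: Bochner_Integration.integral_cong prod.cong simp: inner_sum_left_Basis)
  also have "\<dots> = (\<Prod>b\<in>Basis. integral\<^sup>L lborel (f b))"
    by (rule product_integral_prod) (use fi in auto)
  also have "\<dots> = (\<Prod>j\<in>UNIV. integral\<^sup>L lborel (a j))"
    unfolding Basis by (simp add: prod.reindex[OF inj] f_axis)
  finally show ?thesis .
qed

section \<open>Differentiation under the integral sign\<close>

text \<open>Only a Lipschitz bound near the point \<open>y\<close> is needed; dominated convergence is applied to the
  difference quotients of the remainder.\<close>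

lemma has_derivative_integral_dominated:
  fixes K :: "'a::real_normed_vector \<Rightarrow> 'x \<Rightarrow> real"
  assumes D: "\<And>x. ((\<lambda>y. K y x) has_derivative K' x) (at y)"
    and K: "\<And>z. integrable M (K z)" and K': "\<And>v. integrable M (\<lambda>x. K' x v)" and W: "integrable M W"
    and lip: "\<And>z x. norm (z - y) \<le> 1 \<Longrightarrow> \<bar>K z x - K y x\<bar> \<le> W x * norm (z - y)"
    and bd: "\<And>x v. \<bar>K' x v\<bar> \<le> W x * norm v"
  shows "((\<lambda>z. \<integral>x. K z x \<partial>M) has_derivative (\<lambda>v. \<integral>x. K' x v \<partial>M)) (at y)"
  unfolding has_derivative_at
proof
  have lin: "linear (K' x)" for x using has_derivative_linear[OF D] .
  show "bounded_linear (\<lambda>v. \<integral>x. K' x v \<partial>M)"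
  proof (rule bounded_linear_intro[where K = "integral\<^sup>L M W"])
    fix v show "norm (\<integral>x. K' x v \<partial>M) \<le> norm v * integral\<^sup>L M W"
    proof -
      have "norm (\<integral>x. K' x v \<partial>M) \<le> (\<integral>x. \<bar>K' x v\<bar> \<partial>M)" using integral_norm_bound[of M "\<lambda>x. K' x v"] by simp
      also have "\<dots> \<le> (\<integral>x. W x * norm v \<partial>M)"
        using bd K' W by (intro integral_mono) auto
      finally show ?thesis by (simp add: mult_ac)
    qed
  qed (use K' in \<open>auto simp: linear_add[OF lin] linear_cmul[OF lin]\<close>)
  show "((\<lambda>h. norm ((\<integral>x. K (y + h) x \<partial>M) - (\<integral>x. K y x \<partial>M) - (\<integral>x. K' x h \<partial>M)) / norm h) \<longlongrightarrow> 0) (at 0)"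
    unfolding tendsto_at_iff_sequentially comp_def
  proof (intro allI impI)
    fix X :: "nat \<Rightarrow> 'a" assume X0: "\<forall>i. X i \<in> UNIV - {0}" and X: "X \<longlonglongrightarrow> 0"
    let ?q = "\<lambda>i x. \<bar>K (y + X i) x - K y x - K' x (X i)\<bar> / norm (X i)"
    have "eventually (\<lambda>i. norm (X i) < 1) sequentially"
      using order_tendstoD(2)[OF tendsto_norm[OF X], of 1] by simp
    then obtain N where N: "\<And>i. N \<le> i \<Longrightarrow> norm (X i) < 1" by (auto simp: eventually_sequentially)
    have q: "integrable M (?q i)" for i using K K' by auto
    have "(\<lambda>i. integral\<^sup>L M (?q (i + N))) \<longlonglongrightarrow> integral\<^sup>L M (\<lambda>_. 0 :: real)"
    proof (rule integral_dominated_convergence[where w = "\<lambda>x. 2 * W x"])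
      show "AE x in M. (\<lambda>i. ?q (i + N) x) \<longlonglongrightarrow> 0"
      proof (intro AE_I2)
        fix x
        have "((\<lambda>h. norm (K (y + h) x - K y x - K' x h) / norm h) \<longlongrightarrow> 0) (at 0)"
          using D[of x] unfolding has_derivative_at by blast
        then have "(\<lambda>i. ?q i x) \<longlonglongrightarrow> 0"
          unfolding tendsto_at_iff_sequentially comp_def using X0 X by auto
        then show "(\<lambda>i. ?q (i + N) x) \<longlonglongrightarrow> 0" by (rule LIMSEQ_ignore_initial_segment)
      qed
      show "AE x in M. norm (?q (i + N) x) \<le> 2 * W x" for i
      proof (intro AE_I2)
        fix x
        have "\<bar>K (y + X (i + N)) x - K y x - K' x (X (i + N))\<bar> \<le> 2 * W x * norm (X (i + N))"
          using lip[of "y + X (i + N)" x] bd[of x "X (i + N)"] N[of "i + N"] by auto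
        then show "norm (?q (i + N) x) \<le> 2 * W x" using X0 by (auto simp: divide_le_eq)
      qed
    qed (use q W in auto)
    then have "(\<lambda>i. integral\<^sup>L M (?q (i + N))) \<longlonglongrightarrow> 0" by simp
    then have "(\<lambda>i. integral\<^sup>L M (?q i)) \<longlonglongrightarrow> 0" by (rule LIMSEQ_offset)
    then show "(\<lambda>i. norm ((\<integral>x. K (y + X i) x \<partial>M) - (\<integral>x. K y x \<partial>M) - (\<integral>x. K' x (X i) \<partial>M)) / norm (X i)) \<longlonglongrightarrow> 0"
    proof (rule tendsto_sandwich[OF _ _ tendsto_const, rotated 2])
      show "\<forall>\<^sub>F i in sequentially. norm ((\<integral>x. K (y + X i) x \<partial>M) - (\<integral>x. K y x \<partial>M) - (\<integral>x. K' x (X i) \<partial>M)) / norm (X i) \<le> integral\<^sup>L M (?q i)"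
      proof (intro always_eventually allI)
        fix i
        have "(\<integral>x. K (y + X i) x \<partial>M) - (\<integral>x. K y x \<partial>M) - (\<integral>x. K' x (X i) \<partial>M) = (\<integral>x. K (y + X i) x - K y x - K' x (X i) \<partial>M)"
          using K K' by simp
        also have "norm \<dots> \<le> (\<integral>x. \<bar>K (y + X i) x - K y x - K' x (X i)\<bar> \<partial>M)"
          using integral_norm_bound[of M "\<lambda>x. K (y + X i) x - K y x - K' x (X i)"] by simp
        finally show "norm ((\<integral>x. K (y + X i) x \<partial>M) - (\<integral>x. K y x \<partial>M) - (\<integral>x. K' x (X i) \<partial>M)) / norm (X i) \<le> integral\<^sup>L M (?q i)"
          by (simp add: divide_right_mono)
      qed
    qed auto
  qed
qed

section \<open>Regularised test functions\<close>

text \<open>The convolution of a bounded measurable function \<open>s\<close> with a kernel, the adjoint of the smoothing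
  of measures below. It turns \<open>s\<close>, which need not be continuous, into a test function for \<open>d1\<close>.\<close>

definition smear :: "('n::finite \<Rightarrow> real \<Rightarrow> real) \<Rightarrow> (real ^ 'n \<Rightarrow> real) \<Rightarrow> real ^ 'n \<Rightarrow> real" where
  "smear a s y = (\<integral>x. s x * pker a (y - x) \<partial>lborel)"

lemma smear_integrable:
  assumes "bumps a" and [measurable]: "s \<in> borel_measurable borel" and "\<And>x. \<bar>s x\<bar> \<le> B"
  shows "integrable lborel (\<lambda>x. s x * pker a (y - x))"
proof (rule Bochner_Integration.integrable_bound)
  show "integrable lborel (\<lambda>x. B * pker a (y - x))" by (intro integrable_mult_right pker_reflect_integrable assms)
  have "\<bar>s x\<bar> \<le> \<bar>B\<bar>" for x using assms(3)[of x] by linarith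
  then show "AE x in lborel. norm (s x * pker a (y - x)) \<le> norm (B * pker a (y - x))"
    by (auto simp: abs_mult intro!: mult_right_mono)
  have "pker a \<in> borel_measurable borel" using assms(1) by (rule pker_measurable)
  then show "(\<lambda>x. s x * pker a (y - x)) \<in> borel_measurable lborel" by measurable
qed

lemma smear_bound:
  assumes "bumps a" and [measurable]: "s \<in> borel_measurable borel" and "\<And>x. \<bar>s x\<bar> \<le> B"
  shows "\<bar>smear a s y\<bar> \<le> B * knorm a"
proof -
  have "\<bar>smear a s y\<bar> \<le> (\<integral>x. \<bar>s x * pker a (y - x)\<bar> \<partial>lborel)"
    unfolding smear_def using integral_norm_bound[of lborel "\<lambda>x. s x * pker a (y - x)"] by simp
  also have "\<dots> \<le> (\<integral>x. B * \<bar>pker a (y - x)\<bar> \<partial>lborel)"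
  proof (rule integral_mono)
    show "integrable lborel (\<lambda>x. \<bar>s x * pker a (y - x)\<bar>)"
      by (intro integrable_abs smear_integrable[OF assms])
    show "integrable lborel (\<lambda>x. B * \<bar>pker a (y - x)\<bar>)"
      by (intro integrable_mult_right integrable_abs pker_reflect_integrable[OF assms(1)])
  qed (use assms(3) in \<open>auto simp: abs_mult intro!: mult_right_mono\<close>)
  also have "\<dots> = B * knorm a" using knorm_reflect[OF assms(1)] by simp
  finally show ?thesis .
qed

lemma pker_lipschitz:
  fixes a :: "'n::finite \<Rightarrow> real \<Rightarrow> real"
  assumes "bumps a"
  obtains B where "0 < B" "\<And>x y. \<bar>pker a x - pker a y\<bar> \<le> B * norm (x - y)"
     "\<And>x v. \<bar>\<Sum>i\<in>UNIV. v $ i * pker (pderiv_at i 1 a) x\<bar> \<le> B * norm v"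
proof -
  have "\<exists>B. 0 < B \<and> (\<forall>x. \<bar>pker (pderiv_at i 1 a) x\<bar> \<le> B)" for i
    using pker_bounded[OF bumps_pderiv_at[OF assms]] by metis
  then obtain B where B: "\<And>i. 0 < B i" "\<And>i x. \<bar>pker (pderiv_at i 1 a) x\<bar> \<le> B i" by metis
  let ?D = "\<lambda>x v. \<Sum>i\<in>UNIV. v $ i * pker (pderiv_at i 1 a) x"
  have bd: "\<bar>?D x v\<bar> \<le> (\<Sum>i\<in>UNIV. B i) * norm v" for x v
  proof -
    have "\<bar>?D x v\<bar> \<le> (\<Sum>i\<in>UNIV. \<bar>v $ i * pker (pderiv_at i 1 a) x\<bar>)" by (rule sum_abs)
    also have "\<dots> \<le> (\<Sum>i\<in>UNIV. B i * norm v)"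
      unfolding abs_mult
    proof (rule sum_mono)
      fix i
      have "\<bar>v $ i\<bar> * \<bar>pker (pderiv_at i 1 a) x\<bar> \<le> norm v * B i"
        by (rule mult_mono) (use component_le_norm_cart[of v i] B in auto)
      then show "\<bar>v $ i\<bar> * \<bar>pker (pderiv_at i 1 a) x\<bar> \<le> B i * norm v" by (simp add: mult_ac)
    qed
    finally show ?thesis by (simp add: sum_distrib_right)
  qed
  have "\<bar>pker a x - pker a y\<bar> \<le> (\<Sum>i\<in>UNIV. B i) * norm (x - y)" for x y
  proof -
    have "norm (pker a x - pker a y) \<le> (\<Sum>i\<in>UNIV. B i) * norm (x - y)"
    proof (rule differentiable_bound[where S = UNIV and f' = ?D])
      show "(pker a has_derivative ?D z) (at z)" for z
        using has_derivative_pker[OF bumps_smooth1[OF assms], where x = 0 and y = z] by simp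
      show "onorm (?D z) \<le> (\<Sum>i\<in>UNIV. B i)" for z
        by (rule onorm_le) (use bd[of _ z] in auto)
    qed auto
    then show ?thesis by simp
  qed
  moreover have "0 < (\<Sum>i\<in>UNIV. B i)" using B(1) by (intro sum_pos) auto
  ultimately show thesis using bd that by blast
qed

lemma has_derivative_smear:
  assumes a: "bumps a" and s [measurable]: "s \<in> borel_measurable borel" and B: "\<And>x. \<bar>s x\<bar> \<le> B"
  shows "(smear a s has_derivative (\<lambda>v. \<Sum>i\<in>UNIV. v $ i * smear (pderiv_at i 1 a) s y)) (at y)"
proof -
  obtain L where L: "0 < L" "\<And>x y. \<bar>pker a x - pker a y\<bar> \<le> L * norm (x - y)"
     "\<And>x v. \<bar>\<Sum>i\<in>UNIV. v $ i * pker (pderiv_at i 1 a) x\<bar> \<le> L * norm v"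
    using pker_lipschitz[OF a] by blast
  have B0: "0 \<le> B" using B[of 0] by linarith
  have "\<exists>R. 0 < R \<and> (\<forall>x. R < norm x \<longrightarrow> pker (pderiv_at i 1 a) x = 0)" for i
    using pker_support[OF bumps_pderiv_at[OF a]] by metis
  then obtain R where R: "\<And>i. 0 < R i" "\<And>i x. R i < norm x \<Longrightarrow> pker (pderiv_at i 1 a) x = 0" by metis
  obtain R0 where R0: "0 < R0" "\<And>x. R0 < norm x \<Longrightarrow> pker a x = 0" using pker_support[OF a] by blast
  define S where "S = R0 + (\<Sum>i\<in>UNIV. R i) + 1"
  have RS: "R i \<le> (\<Sum>i\<in>UNIV. R i)" for i by (rule member_le_sum) (use R(1) in \<open>auto intro: less_imp_le\<close>)
  have sR: "0 < (\<Sum>i\<in>UNIV. R i)" using R(1) by (intro sum_pos) auto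
  define W where "W x = B * L * indicator (cball y S) x" for x
  have W: "integrable lborel W" unfolding W_def
    by (intro integrable_mult_right integrable_real_indicator) (use emeasure_bounded_finite[OF bounded_cball] in auto)
  let ?D = "\<lambda>x v. \<Sum>i\<in>UNIV. v $ i * pker (pderiv_at i 1 a) (y - x)"
  have "((\<lambda>z. \<integral>x. s x * pker a (z - x) \<partial>lborel) has_derivative (\<lambda>v. \<integral>x. s x * ?D x v \<partial>lborel)) (at y)"
  proof (rule has_derivative_integral_dominated[OF _ _ _ W])
    show "((\<lambda>y. s x * pker a (y - x)) has_derivative (\<lambda>v. s x * ?D x v)) (at y)" for x
      by (intro has_derivative_mult_right has_derivative_pker bumps_smooth1 a)
    show "integrable lborel (\<lambda>x. s x * pker a (z - x))" for z by (rule smear_integrable[OF a s B])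
    have "integrable lborel (\<lambda>x. \<Sum>i\<in>UNIV. v $ i * (s x * pker (pderiv_at i 1 a) (y - x)))" for v :: "real ^ 'a"
      by (intro Bochner_Integration.integrable_sum integrable_mult_right smear_integrable[OF bumps_pderiv_at[OF a] s B])
    then show "integrable lborel (\<lambda>x. s x * ?D x v)" for v
      by (simp add: sum_distrib_left mult_ac)
    show "\<bar>s x * pker a (z - x) - s x * pker a (y - x)\<bar> \<le> W x * norm (z - y)" if z: "norm (z - y) \<le> 1" for z x
    proof (cases "x \<in> cball y S")
      case True
      have "\<bar>s x\<bar> * \<bar>pker a (z - x) - pker a (y - x)\<bar> \<le> B * (L * norm ((z - x) - (y - x)))"
        by (intro mult_mono B L) (use B0 in auto)
      then show ?thesis using True by (simp add: W_def abs_mult[symmetric] right_diff_distrib mult_ac)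
    next
      case False
      then have "S < norm (y - x)" by (simp add: dist_norm)
      moreover have "norm (y - x) \<le> norm (z - x) + norm (z - y)"
        using norm_triangle_ineq4[of "z - x" "z - y"] by simp
      ultimately have "R0 < norm (z - x)" "R0 < norm (y - x)" using z sR by (auto simp: S_def)
      then show ?thesis using False R0 by (simp add: W_def)
    qed
    show "\<bar>s x * ?D x v\<bar> \<le> W x * norm v" for x v
    proof (cases "x \<in> cball y S")
      case True
      have "\<bar>s x\<bar> * \<bar>?D x v\<bar> \<le> B * (L * norm v)"
        by (intro mult_mono B L) (use B0 in auto)
      then show ?thesis using True by (simp add: W_def abs_mult mult_ac)
    next
      case False
      then have "R i < norm (y - x)" for i using RS[of i] R0(1) by (simp add: dist_norm S_def)
      then show ?thesis using False R by (simp add: W_def)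
    qed
  qed
  moreover have "(\<integral>x. s x * ?D x v \<partial>lborel) = (\<Sum>i\<in>UNIV. v $ i * smear (pderiv_at i 1 a) s y)" for v
  proof -
    have "(\<integral>x. s x * ?D x v \<partial>lborel) = (\<integral>x. (\<Sum>i\<in>UNIV. v $ i * (s x * pker (pderiv_at i 1 a) (y - x))) \<partial>lborel)"
      by (simp add: sum_distrib_left mult_ac)
    also have "\<dots> = (\<Sum>i\<in>UNIV. \<integral>x. v $ i * (s x * pker (pderiv_at i 1 a) (y - x)) \<partial>lborel)"
      by (intro Bochner_Integration.integral_sum integrable_mult_right smear_integrable[OF bumps_pderiv_at[OF a] s B])
    finally show ?thesis unfolding smear_def by simp
  qed
  ultimately show ?thesis unfolding smear_def[abs_def] by simp
qed

lemma iterated_partial_smear: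
  assumes a: "bumps a" and s: "s \<in> borel_measurable borel" and B: "\<And>x. \<bar>s x\<bar> \<le> B"
  shows "iterated_partial l (smear a s) = smear (list_derivs l a) s"
proof (induction l)
  case Nil
  show ?case by (simp add: list_derivs_def[abs_def])
next
  case (Cons i l)
  show ?case unfolding iterated_partial.simps Cons
    by (rule ext, subst partial_eq[OF has_derivative_smear[OF bumps_list_derivs[OF a] s B]])
       (simp only: pderiv_at_list_derivs)
qed

lemma smooth_smear:
  assumes a: "bumps a" and s: "s \<in> borel_measurable borel" and B: "\<And>x. \<bar>s x\<bar> \<le> B"
  shows "smooth (smear a s)"
  unfolding smooth_def iterated_partial_smear[OF assms] differentiable_def
  using has_derivative_smear[OF bumps_list_derivs[OF a] s B] by blast

section \<open>Smoothing a measure\<close>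

text \<open>Both components of the pair are finite Borel measures.\<close>

definition finite_signed :: "('n::finite) signed_measure \<Rightarrow> bool" where
  "finite_signed \<sigma> \<longleftrightarrow> finite_measure (fst \<sigma>) \<and> finite_measure (snd \<sigma>)
     \<and> sets (fst \<sigma>) = sets borel \<and> sets (snd \<sigma>) = sets borel"

text \<open>The smoothed signed measure as a function. The kernel is applied to \<open>y - x\<close>, where \<open>y\<close> is the
  variable of integration, so that derivatives of the test function produce no signs.\<close>

definition mollify :: "('n::finite) signed_measure \<Rightarrow> ('n \<Rightarrow> real \<Rightarrow> real) \<Rightarrow> real ^ 'n \<Rightarrow> real" where
  "mollify \<sigma> a x = signed_integral \<sigma> (\<lambda>y. pker a (y - x))"

lemma smear_fubini:
  fixes M :: "(real ^ 'n::finite) measure"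
  assumes M: "finite_measure M" and sets: "sets M = sets borel"
    and a: "bumps a" and s [measurable]: "s \<in> borel_measurable borel" and B: "\<And>x. \<bar>s x\<bar> \<le> B"
  shows "integrable M (smear a s)"
    and "integrable lborel (\<lambda>x. s x * (\<integral>y. pker a (y - x) \<partial>M))"
    and "(\<integral>x. s x * (\<integral>y. pker a (y - x) \<partial>M) \<partial>lborel) = (\<integral>y. smear a s y \<partial>M)"
proof -
  interpret M: finite_measure M by fact
  interpret P: pair_sigma_finite M lborel ..
  note sets [measurable_cong]
  have [measurable]: "pker a \<in> borel_measurable borel" using a by (rule pker_measurable)
  let ?G = "\<lambda>y x. s x * pker a (y - x)"
  have G: "integrable (M \<Otimes>\<^sub>M lborel) (case_prod ?G)"
  proof (rule P.Fubini_integrable)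
    show "case_prod ?G \<in> borel_measurable (M \<Otimes>\<^sub>M lborel)" by measurable
    show "AE y in M. integrable lborel (\<lambda>x. (case_prod ?G) (y, x))"
      using smear_integrable[OF a s B] by simp
    have "B * knorm a \<ge> (\<integral>x. \<bar>?G y x\<bar> \<partial>lborel)" for y
    proof -
      \<comment> \<open>the absolute value is absorbed into the bounded factor\<close>
      have "(\<integral>x. \<bar>?G y x\<bar> \<partial>lborel) = smear (\<lambda>j. a j) (\<lambda>x. s x * sgn (s x * pker a (y - x))) y"
        unfolding smear_def by (intro Bochner_Integration.integral_cong) (auto simp: abs_sgn)
      also have "\<dots> \<le> B * knorm a"
        using smear_bound[OF a, of "\<lambda>x. s x * sgn (s x * pker a (y - x))" B y] B
        by (force simp: abs_mult sgn_if abs_le_iff split: if_splits)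
      finally show ?thesis .
    qed
    then show "integrable M (\<lambda>y. \<integral>x. norm ((case_prod ?G) (y, x)) \<partial>lborel)"
      by (intro M.integrable_const_bound[where B = "B * knorm a"]) auto
  qed
  from P.integrable_fst[OF G] show "integrable M (smear a s)" by (simp add: smear_def[abs_def])
  from P.integrable_snd[OF G] show "integrable lborel (\<lambda>x. s x * (\<integral>y. pker a (y - x) \<partial>M))" by simp
  from P.Fubini_integral[OF G] show "(\<integral>x. s x * (\<integral>y. pker a (y - x) \<partial>M) \<partial>lborel) = (\<integral>y. smear a s y \<partial>M)"
    by (simp add: smear_def[abs_def])
qed

lemma mollify_integrable: 
  assumes "finite_signed \<sigma>" "bumps a" shows "integrable lborel (mollify \<sigma> a)"
  unfolding mollify_def[abs_def] signed_integral_def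
  using smear_fubini(2)[OF _ _ assms(2), of _ "\<lambda>_. 1" 1] assms(1)
  by (intro Bochner_Integration.integrable_diff) (auto simp: finite_signed_def)

lemma mollify_duality:
  assumes \<sigma>: "finite_signed \<sigma>" and a: "bumps a" and s: "s \<in> borel_measurable borel" and B: "\<And>x. \<bar>s x\<bar> \<le> B"
  shows "integrable lborel (\<lambda>x. s x * mollify \<sigma> a x)"
    and "(\<integral>x. s x * mollify \<sigma> a x \<partial>lborel) = signed_integral \<sigma> (smear a s)"
  using smear_fubini[of "fst \<sigma>" a s B] smear_fubini[of "snd \<sigma>" a s B] assms
  by (auto simp: mollify_def[abs_def] signed_integral_def finite_signed_def right_diff_distrib)

lemma mollify_measurable [measurable]:
  "finite_signed \<sigma> \<Longrightarrow> bumps a \<Longrightarrow> mollify \<sigma> a \<in> borel_measurable borel"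
  using mollify_integrable borel_measurable_integrable by fastforce

text \<open>Duality: the sign of the difference, smeared by the kernel, is an admissible test function.\<close>

lemma d1_L1:
  fixes a :: "'n::finite \<Rightarrow> real \<Rightarrow> real" and d :: real
  assumes d: "d1 \<sigma> \<tau> \<le> ennreal d" "0 \<le> d" and fin: "finite_signed \<sigma>" "finite_signed \<tau>" and a: "bumps a"
  shows "(\<integral>x. \<bar>mollify \<sigma> a x - mollify \<tau> a x\<bar> \<partial>lborel)
     \<le> (knorm a + CARD('n) * (\<Sum>i\<in>UNIV. knorm (pderiv_at i 1 a))) * d"
proof -
  note [measurable] = mollify_measurable[OF fin(1) a] mollify_measurable[OF fin(2) a]
  define s where "s x = sgn (mollify \<sigma> a x - mollify \<tau> a x)" for x
  have s: "s \<in> borel_measurable borel" "\<And>x. \<bar>s x\<bar> \<le> 1" by (auto simp: s_def[abs_def] abs_sgn_eq)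
  have "(\<integral>x. \<bar>mollify \<sigma> a x - mollify \<tau> a x\<bar> \<partial>lborel) = (\<integral>x. s x * mollify \<sigma> a x - s x * mollify \<tau> a x \<partial>lborel)"
    by (intro Bochner_Integration.integral_cong) (simp_all add: s_def abs_sgn algebra_simps)
  also have "\<dots> = signed_integral \<sigma> (smear a s) - signed_integral \<tau> (smear a s)"
    using mollify_duality[OF fin(1) a s] mollify_duality[OF fin(2) a s] by simp
  also have "\<dots> \<le> \<bar>\<dots>\<bar>" by simp
  also have "\<dots> \<le> (knorm a + CARD('n) * (\<Sum>i\<in>UNIV. knorm (pderiv_at i 1 a))) * d"
  proof (rule d1_test[OF d smooth_smear[OF a s]])
    show "\<bar>smear a s x\<bar> \<le> knorm a" for x using smear_bound[OF a s, of x] by simp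
    show "\<bar>partial i (smear a s) x\<bar> \<le> (\<Sum>i\<in>UNIV. knorm (pderiv_at i 1 a))" for i x
    proof -
      have "\<bar>partial i (smear a s) x\<bar> = \<bar>smear (pderiv_at i 1 a) s x\<bar>"
        using partial_eq[OF has_derivative_smear[OF a s]] by simp
      also have "\<dots> \<le> knorm (pderiv_at i 1 a)" using smear_bound[OF bumps_pderiv_at[OF a] s, of i 1 x] by simp
      also have "\<dots> \<le> (\<Sum>i\<in>UNIV. knorm (pderiv_at i 1 a))" by (rule member_le_sum) auto
      finally show ?thesis .
    qed
  qed
  finally show ?thesis .
qed

lemma d1_Linf:
  fixes a :: "'n::finite \<Rightarrow> real \<Rightarrow> real" and d B B' :: real
  assumes d: "d1 \<sigma> \<tau> \<le> ennreal d" "0 \<le> d" and a: "bumps a"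
    and B: "\<And>x. \<bar>pker a x\<bar> \<le> B" "\<And>i x. \<bar>pker (pderiv_at i 1 a) x\<bar> \<le> B'"
  shows "\<bar>mollify \<sigma> a x - mollify \<tau> a x\<bar> \<le> (B + CARD('n) * B') * d"
  unfolding mollify_def
proof (rule d1_test[OF d smooth_pker[where a = a, OF bumps_smooth1[OF a]]])
  show "\<bar>partial i (\<lambda>y. pker a (y - x)) y\<bar> \<le> B'" for i y
    using partial_eq[OF has_derivative_pker[where a = a, OF bumps_smooth1[OF a]]] B by simp
qed (use B in auto)

lemma d1_mollify_bounds:
  fixes a :: "'n::finite \<Rightarrow> real \<Rightarrow> real"
  assumes a: "bumps a"
  obtains A where "0 < A"
    "\<And>h \<sigma> \<tau> (d :: real). \<lbrakk>0 < h; h \<le> 1; d1 \<sigma> \<tau> \<le> ennreal d; 0 \<le> d; finite_signed \<sigma>; finite_signed \<tau>\<rbrakk> \<Longrightarrow>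
        (\<integral>x. \<bar>mollify \<sigma> (scale h a) x - mollify \<tau> (scale h a) x\<bar> \<partial>lborel) \<le> A * (1 / h) * d"
    "\<And>h \<sigma> \<tau> (d :: real) x. \<lbrakk>0 < h; h \<le> 1; d1 \<sigma> \<tau> \<le> ennreal d; 0 \<le> d\<rbrakk> \<Longrightarrow>
        \<bar>mollify \<sigma> (scale h a) x - mollify \<tau> (scale h a) x\<bar> \<le> A * (1 / h) ^ (CARD('n) + 1) * d"
proof -
  obtain B where B: "0 < B" "\<And>x. \<bar>pker a x\<bar> \<le> B" using pker_bounded[OF a] by blast
  have "\<exists>B. 0 < B \<and> (\<forall>x. \<bar>pker (pderiv_at i 1 a) x\<bar> \<le> B)" for i
    using pker_bounded[OF bumps_pderiv_at[OF a]] by metis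
  then obtain B1 where B1: "\<And>i. 0 < B1 i" "\<And>i x. \<bar>pker (pderiv_at i 1 a) x\<bar> \<le> B1 i" by metis
  have B1s: "\<bar>pker (pderiv_at i 1 a) x\<bar> \<le> (\<Sum>i\<in>UNIV. B1 i)" for i x
    using B1(2)[of i x] member_le_sum[of i UNIV B1] B1(1) by (fastforce intro: less_imp_le order_trans)
  define K where "K = (\<Sum>i\<in>UNIV. knorm (pderiv_at i 1 a))"
  define S where "S = (\<Sum>i\<in>UNIV. B1 i)"
  have K0: "0 \<le> K" unfolding K_def by (intro sum_nonneg) auto
  have S0: "0 \<le> S" unfolding S_def by (intro sum_nonneg) (use B1 in \<open>auto intro: less_imp_le\<close>)
  define A where "A = knorm a + CARD('n) * K + B + CARD('n) * S"
  have A: "0 < A" unfolding A_def using B(1) K0 S0 by (simp add: add_nonneg_pos add_pos_nonneg)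
  show thesis
  proof (rule that[OF A])
    fix h :: real and \<sigma> \<tau> :: "'n signed_measure" and d :: real
    assume h: "0 < h" "h \<le> 1" and d: "d1 \<sigma> \<tau> \<le> ennreal d" "0 \<le> d"
    have h1: "1 \<le> 1 / h" using h by simp
    have sa: "bumps (scale h a)" using bumps_scale[OF a] h by simp
    {
      assume fin: "finite_signed \<sigma>" "finite_signed \<tau>"
      have k: "knorm (pderiv_at i 1 (scale h a)) = (1 / h) * knorm (pderiv_at i 1 a)" for i
      proof -
        have "knorm (pderiv_at i 1 (scale h a)) = (1 / h) * knorm (scale h (pderiv_at i 1 a))"
          unfolding knorm_def pker_pderiv_at_scale[OF a] abs_mult using h by simp
        then show ?thesis using knorm_scale[OF bumps_pderiv_at[OF a] h(1)] by simp
      qed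
      have "(\<integral>x. \<bar>mollify \<sigma> (scale h a) x - mollify \<tau> (scale h a) x\<bar> \<partial>lborel)
        \<le> (knorm a + CARD('n) * ((1 / h) * K)) * d"
        using d1_L1[OF d fin sa] unfolding k knorm_scale[OF a h(1)] K_def sum_distrib_left by simp
      also have "\<dots> \<le> (A * (1 / h)) * d"
      proof (rule mult_right_mono[OF _ d(2)])
        have "knorm a * 1 \<le> knorm a * (1 / h)" by (intro mult_left_mono h1) simp
        moreover have "0 \<le> (B + CARD('n) * S) * (1 / h)" using B S0 h by simp
        ultimately show "knorm a + CARD('n) * ((1 / h) * K) \<le> A * (1 / h)"
          unfolding A_def by (simp add: algebra_simps)
      qed
      finally show "(\<integral>x. \<bar>mollify \<sigma> (scale h a) x - mollify \<tau> (scale h a) x\<bar> \<partial>lborel) \<le> A * (1 / h) * d" .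
    }
    fix x
    have "\<bar>mollify \<sigma> (scale h a) x - mollify \<tau> (scale h a) x\<bar>
       \<le> ((1 / h) ^ (CARD('n) + 1) * B + CARD('n) * ((1 / h) ^ (CARD('n) + 1) * S)) * d"
    proof (rule d1_Linf[OF d sa])
      fix z
      have "\<bar>pker (scale h a) z\<bar> = (1 / h) ^ CARD('n) * \<bar>pker a ((1 / h) *\<^sub>R z)\<bar>"
        unfolding pker_scale abs_mult using h by simp
      also have "\<dots> \<le> (1 / h) ^ (CARD('n) + 1) * B"
        by (intro mult_mono power_increasing B h1) (use h in auto)
      finally show "\<bar>pker (scale h a) z\<bar> \<le> (1 / h) ^ (CARD('n) + 1) * B" .
      fix i
      have "\<bar>pker (pderiv_at i 1 (scale h a)) z\<bar> = (1 / h) ^ (CARD('n) + 1) * \<bar>pker (pderiv_at i 1 a) ((1 / h) *\<^sub>R z)\<bar>"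
        unfolding pker_pderiv_at_scale[OF a] pker_scale abs_mult using h by simp
      also have "\<dots> \<le> (1 / h) ^ (CARD('n) + 1) * S"
        unfolding S_def by (intro mult_left_mono B1s) (use h in auto)
      finally show "\<bar>pker (pderiv_at i 1 (scale h a)) z\<bar> \<le> (1 / h) ^ (CARD('n) + 1) * S" .
    qed
    also have "\<dots> \<le> (A * (1 / h) ^ (CARD('n) + 1)) * d"
    proof (rule mult_right_mono[OF _ d(2)])
      define q where "q = (1 / h) ^ (CARD('n) + 1)"
      have "0 \<le> (knorm a + CARD('n) * K) * q" using K0 h by (simp add: q_def)
      then show "(1 / h) ^ (CARD('n) + 1) * B + CARD('n) * ((1 / h) ^ (CARD('n) + 1) * S) \<le> A * (1 / h) ^ (CARD('n) + 1)"
        unfolding A_def q_def[symmetric] by (simp add: algebra_simps)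
    qed
    finally show "\<bar>mollify \<sigma> (scale h a) x - mollify \<tau> (scale h a) x\<bar> \<le> A * (1 / h) ^ (CARD('n) + 1) * d" .
  qed
qed

section \<open>The difference of two consecutive kernels\<close>

text \<open>The factors \<open>\<rho>'\<close> are replaced by \<open>\<rho>\<close> one coordinate after the other; each replacement
  contributes one pure derivative.\<close>

lemma pker_telescope:
  fixes \<rho> \<rho>' \<sigma> :: "real \<Rightarrow> real"
  assumes b: "bump \<rho>" "bump \<rho>'" "bump \<sigma>" and d: "\<And>t. \<rho> t - \<rho>' t = (deriv ^^ N) \<sigma> t"
  shows "\<exists>b :: 'n::finite \<Rightarrow> 'n \<Rightarrow> real \<Rightarrow> real. (\<forall>i. bumps (b i)) \<and>
     (\<forall>x. pker (\<lambda>_. \<rho>) x - pker (\<lambda>_. \<rho>') x = (\<Sum>i\<in>UNIV. pker (pderiv_at i N (b i)) x))"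
proof -
  let ?P = "\<lambda>A j. if j \<in> A then \<rho> else \<rho>'"
  have "\<exists>b :: 'n \<Rightarrow> 'n \<Rightarrow> real \<Rightarrow> real. (\<forall>i. bumps (b i)) \<and>
     (\<forall>x. pker (?P A) x - pker (?P {}) x = (\<Sum>i\<in>A. pker (pderiv_at i N (b i)) x))" if "finite A" for A :: "'n set"
    using that
  proof (induction A)
    case empty
    show ?case using b by (intro exI[of _ "\<lambda>_ _. \<rho>"]) (auto simp: bumps_def)
  next
    case (insert i A)
    then obtain b where b': "\<And>i. bumps (b i)"
       "\<And>x. pker (?P A) x - pker (?P {}) x = (\<Sum>i\<in>A. pker (pderiv_at i N (b i)) x)" by blast
    define c where "c = (?P A)(i := \<sigma>)"
    have c: "bumps c" using b by (auto simp: c_def bumps_def)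
    have "pker (?P (insert i A)) x - pker (?P A) x = pker (pderiv_at i N c) x" for x
    proof -
      have "?P (insert i A) = (?P A)(i := \<rho>)" "?P A = (?P A)(i := \<rho>')" using insert(2) by auto
      then have "pker (?P (insert i A)) x - pker (?P A) x = pker ((?P A)(i := \<rho>)) x - pker ((?P A)(i := \<rho>')) x"
        by simp
      also have "\<dots> = pker ((?P A)(i := (deriv ^^ N) \<sigma>)) x"
        unfolding pker_upd d[symmetric] by (simp add: left_diff_distrib)
      finally show ?thesis by (simp add: pderiv_at_def c_def)
    qed
    then have "pker (?P (insert i A)) x - pker (?P {}) x = (\<Sum>k\<in>insert i A. pker (pderiv_at k N ((b(i := c)) k)) x)" for x
      using insert(1,2) b'(2)[of x] by (simp add: sum.insert) (smt (verit) sum.cong)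
    then show ?case using b' c by (intro exI[of _ "b(i := c)"]) auto
  qed
  from this[of UNIV] show ?thesis by simp
qed

section \<open>Weak derivatives against kernels\<close>

text \<open>For an even order the sign in the definition of weak derivatives disappears.\<close>

lemma weak_partial_kernel:
  fixes a :: "'n::finite \<Rightarrow> real \<Rightarrow> real"
  assumes w: "is_weak_partial (single_mi i k) f u" and a: "bumps a" and "even k"
  shows "(\<integral>y. f y * pker (pderiv_at i k a) (y - x) \<partial>lborel) = (\<integral>y. u y * pker a (y - x) \<partial>lborel)"
proof -
  obtain R where R: "0 < R" "\<And>x. R < norm x \<Longrightarrow> pker a x = 0" using pker_support[OF a] by blast
  have "{y. pker a (y - x) \<noteq> 0} \<subseteq> cball x R"
    using R(2) by (auto simp: dist_norm norm_minus_commute) (meson not_le)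
  then have "closure {y. pker a (y - x) \<noteq> 0} \<subseteq> cball x R" by (simp add: closure_minimal)
  then have "compact (closure {y. pker a (y - x) \<noteq> 0})"
    using compact_cball bounded_subset bounded_cball compact_eq_bounded_closed by (metis closed_closure)
  with w smooth_pker[where a = a and x = x, OF bumps_smooth1[OF a]]
  have "(\<integral>y. f y * mi_partial (single_mi i k) (\<lambda>y. pker a (y - x)) y \<partial>lborel)
      = (- 1) ^ mi_order (single_mi i k) * (\<integral>y. u y * pker a (y - x) \<partial>lborel)"
    unfolding is_weak_partial_def by blast
  then show ?thesis
    unfolding mi_partial_single iterated_partial_pker[where a = a, OF bumps_smooth1[OF a]] list_derivs_replicate
    using \<open>even k\<close> by simp
qed

lemma signed_density_finite: 
  assumes "integrable lborel f" shows "finite_signed (signed_density f)"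
proof -
  have fin: "finite_measure (density lborel (\<lambda>x. ennreal (g x)))" if g: "integrable lborel g" for g :: "real ^ 'a \<Rightarrow> real"
  proof (rule finite_measureI)
    have [measurable]: "g \<in> borel_measurable borel" using g by auto
    have "emeasure (density lborel (\<lambda>x. ennreal (g x))) (space (density lborel (\<lambda>x. ennreal (g x)))) = (\<integral>\<^sup>+x. ennreal (g x) \<partial>lborel)"
      by (simp add: emeasure_density)
    also have "\<dots> \<le> (\<integral>\<^sup>+x. ennreal (norm (g x)) \<partial>lborel)" by (intro nn_integral_mono ennreal_leI) auto
    also have "\<dots> < \<infinity>" using g unfolding integrable_iff_bounded by blast
    finally show "emeasure (density lborel (\<lambda>x. ennreal (g x))) (space (density lborel (\<lambda>x. ennreal (g x)))) \<noteq> \<infinity>" by simp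
  qed
  show ?thesis unfolding finite_signed_def signed_density_def
    using fin[OF assms] fin[of "\<lambda>x. - f x"] assms by auto
qed

lemma signed_of_finite: "finite_measure \<mu> \<Longrightarrow> sets \<mu> = sets borel \<Longrightarrow> finite_signed (signed_of \<mu>)"
  unfolding finite_signed_def signed_of_def by (auto intro!: finite_measureI)

lemma signed_integral_density:
  assumes f: "integrable lborel f" and [measurable]: "\<phi> \<in> borel_measurable borel" and B: "\<And>x. \<bar>\<phi> x\<bar> \<le> B"
  shows "signed_integral (signed_density f) \<phi> = (\<integral>x. f x * \<phi> x \<partial>lborel)"
proof -
  have fm[measurable]: "f \<in> borel_measurable borel" using f by auto
  have int: "integrable lborel (\<lambda>x. max 0 (g x) * \<phi> x)" if g: "integrable lborel g" for g
  proof (rule Bochner_Integration.integrable_bound)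
    have [measurable]: "g \<in> borel_measurable borel" using g by auto
    show "(\<lambda>x. max 0 (g x) * \<phi> x) \<in> borel_measurable lborel" by measurable
    show "integrable lborel (\<lambda>x. B * g x)" using g by simp
    have "\<bar>max 0 (g x)\<bar> * \<bar>\<phi> x\<bar> \<le> \<bar>g x\<bar> * \<bar>B\<bar>" for x
      by (intro mult_mono) (use B[of x] in auto)
    then show "AE x in lborel. norm (max 0 (g x) * \<phi> x) \<le> norm (B * g x)"
      by (auto simp: abs_mult mult_ac)
  qed
  have e: "density lborel (\<lambda>x. ennreal (g x)) = density lborel (\<lambda>x. ennreal (max 0 (g x)))" for g :: "real ^ 'a \<Rightarrow> real"
    by (rule arg_cong[where f = "density lborel"]) (auto simp: max_def ennreal_neg)
  have "signed_integral (signed_density f) \<phi> = (\<integral>x. max 0 (f x) * \<phi> x \<partial>lborel) - (\<integral>x. max 0 (- f x) * \<phi> x \<partial>lborel)"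
    unfolding signed_integral_def signed_density_def fst_conv snd_conv e[of f] e[of "\<lambda>x. - f x"]
    by (simp add: integral_density)
  also have "\<dots> = (\<integral>x. max 0 (f x) * \<phi> x - max 0 (- f x) * \<phi> x \<partial>lborel)"
    using int[OF f] int[of "\<lambda>x. - f x"] f by simp
  also have "\<dots> = (\<integral>x. f x * \<phi> x \<partial>lborel)"
    by (intro Bochner_Integration.integral_cong) (auto simp: max_def)
  finally show ?thesis .
qed

lemma mollify_density:
  assumes f: "integrable lborel f" and a: "bumps a"
  shows "mollify (signed_density f) a x = (\<integral>y. f y * pker a (y - x) \<partial>lborel)"
proof -
  obtain B where "0 < B" "\<And>x. \<bar>pker a x\<bar> \<le> B" using pker_bounded[OF a] by blast
  then show ?thesis unfolding mollify_def
    using signed_integral_density[OF f, of "\<lambda>y. pker a (y - x)" B] pker_measurable[OF a] by simp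
qed

section \<open>The Young function and its Luxemburg balls\<close>

lemma e_log_nonneg [simp]: "0 \<le> e_log t" by (simp add: e_log_def)

lemma e_log_0 [simp]: "e_log 0 = 0" by (simp add: e_log_def)

lemma e_log_mono: "\<bar>s\<bar> \<le> \<bar>t\<bar> \<Longrightarrow> e_log s \<le> e_log t"
  unfolding e_log_def by (intro mult_mono) auto

lemma continuous_e_log: "continuous_on UNIV e_log"
  unfolding e_log_def[abs_def] by (intro continuous_intros) auto

lemma e_log_measurable [measurable]: "e_log \<in> borel_measurable borel"
  by (intro borel_measurable_continuous_onI continuous_e_log)

text \<open>The tangent inequality for the convex function \<open>e_log\<close> on the half-line. Convexity, the bound
  by \<open>\<bar>t\<bar>\<close> from below, and Jensen's inequality are consequences.\<close>

lemma e_log_tangent: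
  assumes "0 \<le> s" "0 \<le> t" shows "e_log t + (1 + ln (1 + t)) * (s - t) \<le> e_log s"
proof -
  have "ln ((1 + t) / (1 + s)) \<le> (1 + t) / (1 + s) - 1"
    by (rule ln_le_minus_one) (use assms in auto)
  then have "ln (1 + t) - ln (1 + s) \<le> (t - s) / (1 + s)"
    using assms by (simp add: ln_div field_simps)
  then have "(1 + s) * (ln (1 + t) - ln (1 + s)) \<le> t - s"
    using assms by (simp add: le_divide_eq mult.commute)
  then show ?thesis unfolding e_log_def using assms by (simp add: algebra_simps)
qed

lemma e_log_ge: "\<bar>t\<bar> \<le> e_log t"
  using e_log_tangent[of "\<bar>t\<bar>" 0] by (simp add: e_log_def)

lemma e_log_le: "e_log t \<le> \<bar>t\<bar> * (1 + ln (1 + \<bar>t\<bar>))"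
  unfolding e_log_def using ln_add_one_self_le_self[of "\<bar>t\<bar>"] by (simp add: algebra_simps)

lemma e_log_convex:
  assumes "0 \<le> p" "0 \<le> q" "p + q = 1" shows "e_log (p * x + q * y) \<le> p * e_log x + q * e_log y"
proof -
  define t where "t = p * \<bar>x\<bar> + q * \<bar>y\<bar>"
  have t: "0 \<le> t" using assms by (simp add: t_def)
  have "\<bar>p * x + q * y\<bar> \<le> t"
    unfolding t_def using abs_triangle_ineq[of "p * x" "q * y"] assms by (simp add: abs_mult)
  then have "e_log (p * x + q * y) \<le> e_log t" using t by (intro e_log_mono) simp
  also have "e_log t = p * (e_log t + (1 + ln (1 + t)) * (\<bar>x\<bar> - t)) + q * (e_log t + (1 + ln (1 + t)) * (\<bar>y\<bar> - t))"
  proof -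
    have "p * (e_log t + (1 + ln (1 + t)) * (\<bar>x\<bar> - t)) + q * (e_log t + (1 + ln (1 + t)) * (\<bar>y\<bar> - t))
       = (p + q) * e_log t + (1 + ln (1 + t)) * (p * \<bar>x\<bar> + q * \<bar>y\<bar> - (p + q) * t)"
      by (simp add: algebra_simps)
    then show ?thesis unfolding assms(3) by (simp add: t_def)
  qed
  also have "\<dots> \<le> p * e_log \<bar>x\<bar> + q * e_log \<bar>y\<bar>"
    using assms t by (intro add_mono mult_left_mono e_log_tangent) auto
  finally show ?thesis by (simp add: e_log_def)
qed

lemma e_log_shrink: "0 \<le> p \<Longrightarrow> p \<le> 1 \<Longrightarrow> e_log (p * x) \<le> p * e_log x"
  using e_log_convex[of p "1 - p" x 0] by simp

text \<open>The Luxemburg norm of \<open>u\<close> for \<open>e_log\<close> is at most \<open>N\<close>, stated with the real radius \<open>N > 0\<close>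
  itself as a witness for the infimum in \<open>norm_elog\<close>.\<close>

definition elog_ball :: "real \<Rightarrow> (real ^ 'n::finite \<Rightarrow> real) \<Rightarrow> bool" where
  "elog_ball N u \<longleftrightarrow> 0 < N \<and> u \<in> borel_measurable borel \<and> (\<integral>\<^sup>+x. ennreal (e_log (u x / N)) \<partial>lborel) \<le> 1"

lemma elog_ball_pos: "elog_ball N u \<Longrightarrow> 0 < N" by (simp add: elog_ball_def)

lemma elog_ball_measurable: "elog_ball N u \<Longrightarrow> u \<in> borel_measurable borel" by (simp add: elog_ball_def)

lemma elog_ball_in_L_elog: "elog_ball N u \<Longrightarrow> u \<in> L_elog"
proof -
  assume N: "elog_ball N u"
  have "norm_elog u \<le> ennreal N" unfolding norm_elog_def
    by (rule INF_lower) (use N in \<open>auto simp: elog_ball_def\<close>)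
  then show ?thesis using N by (auto simp: L_elog_def elog_ball_def intro: le_less_trans)
qed

lemma elog_ball_cmult: "elog_ball N u \<Longrightarrow> 0 < c \<Longrightarrow> elog_ball (c * N) (\<lambda>x. c * u x)"
  unfolding elog_ball_def by (auto intro: borel_measurable_times)

lemma elog_ball_uminus: "elog_ball N u \<Longrightarrow> elog_ball N (\<lambda>x. - u x)"
  unfolding elog_ball_def by (auto simp: e_log_def cong: nn_integral_cong)

lemma elog_ball_add:
  assumes "elog_ball N u" "elog_ball N' u'" shows "elog_ball (N + N') (\<lambda>x. u x + u' x)"
proof -
  have N: "0 < N" "0 < N'" and [measurable]: "u \<in> borel_measurable borel" "u' \<in> borel_measurable borel"
    using assms by (auto simp: elog_ball_def)
  define p q where "p = N / (N + N')" and "q = N' / (N + N')"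
  have pq: "0 \<le> p" "0 \<le> q" "p + q = 1" using N by (auto simp: p_def q_def add_divide_distrib[symmetric])
  have "(\<integral>\<^sup>+x. ennreal (e_log ((u x + u' x) / (N + N'))) \<partial>lborel)
     \<le> (\<integral>\<^sup>+x. ennreal p * ennreal (e_log (u x / N)) + ennreal q * ennreal (e_log (u' x / N')) \<partial>lborel)"
  proof (rule nn_integral_mono)
    fix x
    have "(u x + u' x) / (N + N') = p * (u x / N) + q * (u' x / N')"
      using N by (simp add: p_def q_def add_divide_distrib)
    then have "e_log ((u x + u' x) / (N + N')) \<le> p * e_log (u x / N) + q * e_log (u' x / N')"
      using e_log_convex[OF pq, of "u x / N" "u' x / N'"] by metis
    then show "ennreal (e_log ((u x + u' x) / (N + N'))) \<le> ennreal p * ennreal (e_log (u x / N)) + ennreal q * ennreal (e_log (u' x / N'))"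
      using pq by (simp add: ennreal_mult[symmetric] ennreal_plus[symmetric] ennreal_leI del: ennreal_plus)
  qed
  also have "\<dots> = ennreal p * (\<integral>\<^sup>+x. ennreal (e_log (u x / N)) \<partial>lborel) + ennreal q * (\<integral>\<^sup>+x. ennreal (e_log (u' x / N')) \<partial>lborel)"
    by (subst nn_integral_add) (simp_all add: nn_integral_cmult)
  also have "\<dots> \<le> ennreal p * 1 + ennreal q * 1"
    using assms by (intro add_mono mult_left_mono) (auto simp: elog_ball_def)
  also have "\<dots> = 1" using pq by (simp add: ennreal_plus[symmetric] del: ennreal_plus)
  finally show ?thesis using N by (simp add: elog_ball_def)
qed

lemma elog_ball_zero: "0 < N \<Longrightarrow> elog_ball N (\<lambda>_. 0)"
  by (simp add: elog_ball_def)

lemma elog_ball_mono: "elog_ball N u \<Longrightarrow> N \<le> N' \<Longrightarrow> elog_ball N' u"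
  using elog_ball_add[OF _ elog_ball_zero[of "N' - N"], of N u] by (cases "N = N'") auto

lemma elog_ball_sum:
  assumes "finite A" "\<And>i. i \<in> A \<Longrightarrow> elog_ball (N i) (u i)" "elog_ball N0 u0"
  shows "elog_ball (N0 + (\<Sum>i\<in>A. N i)) (\<lambda>x. u0 x + (\<Sum>i\<in>A. u i x))"
  using assms(1,2)
proof (induction A)
  case (insert i A)
  then have "elog_ball ((N0 + (\<Sum>i\<in>A. N i)) + N i) (\<lambda>x. (u0 x + (\<Sum>i\<in>A. u i x)) + u i x)"
    by (intro elog_ball_add[where u' = "u i"]) auto
  then show ?case using insert(1,2) by (simp add: add_ac)
qed (use assms(3) in simp)

lemma elog_ball_L1:
  assumes "elog_ball N u" shows "integrable lborel u" "(\<integral>x. \<bar>u x\<bar> \<partial>lborel) \<le> N"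
proof -
  have N: "0 < N" and [measurable]: "u \<in> borel_measurable borel" using assms by (auto simp: elog_ball_def)
  have "(\<integral>\<^sup>+x. ennreal (norm (u x)) \<partial>lborel) \<le> (\<integral>\<^sup>+x. ennreal N * ennreal (e_log (u x / N)) \<partial>lborel)"
  proof (rule nn_integral_mono)
    fix x
    have "\<bar>u x\<bar> \<le> N * e_log (u x / N)" using e_log_ge[of "u x / N"] N by (simp add: field_simps)
    then show "ennreal (norm (u x)) \<le> ennreal N * ennreal (e_log (u x / N))"
      using N by (simp add: ennreal_mult[symmetric] ennreal_leI)
  qed
  also have "\<dots> = ennreal N * (\<integral>\<^sup>+x. ennreal (e_log (u x / N)) \<partial>lborel)"
    by (rule nn_integral_cmult) measurable
  also have "\<dots> \<le> ennreal N * 1"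
    using assms by (intro mult_left_mono) (auto simp: elog_ball_def)
  finally have le: "(\<integral>\<^sup>+x. ennreal (norm (u x)) \<partial>lborel) \<le> ennreal N" by simp
  then show int: "integrable lborel u"
    by (intro integrableI_bounded) (auto intro: le_less_trans)
  have "ennreal (\<integral>x. norm (u x) \<partial>lborel) = (\<integral>\<^sup>+x. ennreal (norm (u x)) \<partial>lborel)"
    by (rule nn_integral_eq_integral[symmetric]) (use int in auto)
  with le have "ennreal (\<integral>x. norm (u x) \<partial>lborel) \<le> ennreal N" by metis
  with N show "(\<integral>x. \<bar>u x\<bar> \<partial>lborel) \<le> N" by simp
qed

text \<open>For functions that are bounded by \<open>M\<close>, the Luxemburg norm exceeds the \<open>L\<^sup>1\<close> norm by a factor
  that is only logarithmic in \<open>M / N\<close>.\<close>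

lemma elog_ball_from_L1_Linf:
  assumes int: "integrable lborel P" and a: "(\<integral>x. \<bar>P x\<bar> \<partial>lborel) \<le> a" and M: "\<And>x. \<bar>P x\<bar> \<le> M"
    and N: "0 < N" "a * (1 + ln (1 + M / N)) \<le> N"
  shows "elog_ball N P"
proof -
  have [measurable]: "P \<in> borel_measurable borel" using int by auto
  have M0: "0 \<le> M" using M[of 0] by linarith
  define c where "c = (1 + ln (1 + M / N)) / N"
  have c: "0 \<le> c" using M0 N by (simp add: c_def)
  have "(\<integral>\<^sup>+x. ennreal (e_log (P x / N)) \<partial>lborel) \<le> (\<integral>\<^sup>+x. ennreal (c * \<bar>P x\<bar>) \<partial>lborel)"
  proof (intro nn_integral_mono ennreal_leI)
    fix x
    have "e_log (P x / N) \<le> \<bar>P x / N\<bar> * (1 + ln (1 + \<bar>P x / N\<bar>))" by (rule e_log_le)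
    also have "\<dots> \<le> \<bar>P x / N\<bar> * (1 + ln (1 + M / N))"
    proof (intro mult_left_mono add_left_mono)
      have "\<bar>P x / N\<bar> \<le> M / N" using M[of x] N by (simp add: divide_right_mono)
      then show "ln (1 + \<bar>P x / N\<bar>) \<le> ln (1 + M / N)"
        by (intro ln_mono) (auto intro: add_pos_nonneg)
    qed auto
    also have "\<dots> = c * \<bar>P x\<bar>" using N by (simp add: c_def)
    finally show "e_log (P x / N) \<le> c * \<bar>P x\<bar>" .
  qed
  also have "\<dots> = ennreal (\<integral>x. c * \<bar>P x\<bar> \<partial>lborel)"
    by (rule nn_integral_eq_integral) (use int c in auto)
  also have "\<dots> \<le> ennreal 1"
  proof (rule ennreal_leI)
    have "(\<integral>x. c * \<bar>P x\<bar> \<partial>lborel) = c * (\<integral>x. \<bar>P x\<bar> \<partial>lborel)" by simp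
    also have "\<dots> \<le> c * a" by (intro mult_left_mono a c)
    also have "\<dots> \<le> 1" using N by (simp add: c_def mult.commute)
    finally show "(\<integral>x. c * \<bar>P x\<bar> \<partial>lborel) \<le> 1" .
  qed
  finally show ?thesis using N by (simp add: elog_ball_def)
qed

lemma elog_ball_AE_limit:
  assumes F: "\<And>k. elog_ball N (F k)" and lim: "AE x in lborel. (\<lambda>k. F k x) \<longlonglongrightarrow> G x"
    and [measurable]: "G \<in> borel_measurable borel"
  shows "elog_ball N G"
proof -
  have N: "0 < N" and [measurable]: "F k \<in> borel_measurable borel" for k
    using F by (auto simp: elog_ball_def)
  have "(\<integral>\<^sup>+x. ennreal (e_log (G x / N)) \<partial>lborel) = (\<integral>\<^sup>+x. liminf (\<lambda>k. ennreal (e_log (F k x / N))) \<partial>lborel)"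
  proof (rule nn_integral_cong_AE)
    show "AE x in lborel. ennreal (e_log (G x / N)) = liminf (\<lambda>k. ennreal (e_log (F k x / N)))"
      using lim
    proof eventually_elim
      fix x assume "(\<lambda>k. F k x) \<longlonglongrightarrow> G x"
      then have "(\<lambda>k. F k x / N) \<longlonglongrightarrow> G x / N" by (intro tendsto_divide) (use N in auto)
      then have "(\<lambda>k. e_log (F k x / N)) \<longlonglongrightarrow> e_log (G x / N)"
        by (rule continuous_on_tendsto_compose[OF continuous_e_log]) auto
      then have "(\<lambda>k. ennreal (e_log (F k x / N))) \<longlonglongrightarrow> ennreal (e_log (G x / N))" by (rule tendsto_ennrealI)
      from lim_imp_Liminf[OF _ this] show "ennreal (e_log (G x / N)) = liminf (\<lambda>k. ennreal (e_log (F k x / N)))"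
        by simp
    qed
  qed
  also have "\<dots> \<le> liminf (\<lambda>k. \<integral>\<^sup>+x. ennreal (e_log (F k x / N)) \<partial>lborel)"
    by (rule nn_integral_liminf) measurable
  also have "\<dots> \<le> liminf (\<lambda>k. 1 :: ennreal)"
    by (intro Liminf_mono always_eventually allI) (use F in \<open>auto simp: elog_ball_def\<close>)
  finally show ?thesis using N by (simp add: elog_ball_def Liminf_const)
qed

text \<open>Jensen's inequality for a weight of total variation at most \<open>1\<close>, which may be less than \<open>1\<close>
  because \<open>e_log 0 = 0\<close>. Without integrability of \<open>u \<kappa>\<close> the left-hand side is \<open>e_log 0\<close>, and without that of
  \<open>e_log (u) \<bar>\<kappa>\<bar>\<close> the right-hand side is infinite.\<close>

lemma e_log_integral_le:
  assumes k: "integrable M \<kappa>" "(\<integral>y. \<bar>\<kappa> y\<bar> \<partial>M) \<le> 1" and u [measurable]: "u \<in> borel_measurable M"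
  shows "ennreal (e_log (\<integral>y. u y * \<kappa> y \<partial>M)) \<le> (\<integral>\<^sup>+y. ennreal (e_log (u y) * \<bar>\<kappa> y\<bar>) \<partial>M)"
proof (cases "integrable M (\<lambda>y. u y * \<kappa> y) \<and> integrable M (\<lambda>y. e_log (u y) * \<bar>\<kappa> y\<bar>)")
  case True
  have [measurable]: "\<kappa> \<in> borel_measurable M" using k by auto
  define t where "t = \<bar>\<integral>y. u y * \<kappa> y \<partial>M\<bar>"
  define s where "s = 1 + ln (1 + t)"
  define L where "L = (\<integral>y. \<bar>\<kappa> y\<bar> \<partial>M)"
  have t: "0 \<le> t" "0 \<le> s" by (auto simp: t_def s_def)
  have i1: "integrable M (\<lambda>y. \<bar>u y\<bar> * \<bar>\<kappa> y\<bar>)" using True integrable_abs[of M "\<lambda>y. u y * \<kappa> y"] by (simp add: abs_mult)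
  have "t \<le> (\<integral>y. \<bar>u y\<bar> * \<bar>\<kappa> y\<bar> \<partial>M)"
    unfolding t_def using integral_abs_bound[of M "\<lambda>y. u y * \<kappa> y"] by (simp add: abs_mult)
  then have "s * t \<le> s * (\<integral>y. \<bar>u y\<bar> * \<bar>\<kappa> y\<bar> \<partial>M)" using t by (intro mult_left_mono)
  moreover have "0 \<le> (1 - L) * (s * t - e_log t)"
  proof (rule mult_nonneg_nonneg)
    show "0 \<le> s * t - e_log t"
      unfolding s_def e_log_def using t ln_add_one_self_le_self[of t] by (simp add: algebra_simps)
  qed (use k in \<open>simp add: L_def\<close>)
  ultimately have "e_log t \<le> (e_log t - s * t) * L + s * (\<integral>y. \<bar>u y\<bar> * \<bar>\<kappa> y\<bar> \<partial>M)"
    by (simp add: algebra_simps)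
  also have "\<dots> = (\<integral>y. (e_log t - s * t) * \<bar>\<kappa> y\<bar> + s * (\<bar>u y\<bar> * \<bar>\<kappa> y\<bar>) \<partial>M)"
    unfolding L_def using k i1 by simp
  also have "\<dots> \<le> (\<integral>y. e_log (u y) * \<bar>\<kappa> y\<bar> \<partial>M)"
  proof (rule integral_mono)
    fix y
    have "(e_log t + s * (\<bar>u y\<bar> - t)) * \<bar>\<kappa> y\<bar> \<le> e_log \<bar>u y\<bar> * \<bar>\<kappa> y\<bar>"
      unfolding s_def by (intro mult_right_mono e_log_tangent t) auto
    then show "(e_log t - s * t) * \<bar>\<kappa> y\<bar> + s * (\<bar>u y\<bar> * \<bar>\<kappa> y\<bar>) \<le> e_log (u y) * \<bar>\<kappa> y\<bar>"
      by (simp add: e_log_def algebra_simps)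
  qed (use True k i1 in auto)
  finally have "e_log (\<integral>y. u y * \<kappa> y \<partial>M) \<le> (\<integral>y. e_log (u y) * \<bar>\<kappa> y\<bar> \<partial>M)"
    by (simp add: t_def e_log_def)
  moreover have "(\<integral>\<^sup>+y. ennreal (e_log (u y) * \<bar>\<kappa> y\<bar>) \<partial>M) = ennreal (\<integral>y. e_log (u y) * \<bar>\<kappa> y\<bar> \<partial>M)"
    by (rule nn_integral_eq_integral) (use True in auto)
  ultimately show ?thesis by (simp add: ennreal_leI)
next
  case False
  then consider "\<not> integrable M (\<lambda>y. u y * \<kappa> y)" | "\<not> integrable M (\<lambda>y. e_log (u y) * \<bar>\<kappa> y\<bar>)" by blast
  then show ?thesis
  proof cases
    case 1
    then show ?thesis by (simp add: not_integrable_integral_eq)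
  next
    case 2
    have [measurable]: "\<kappa> \<in> borel_measurable M" using k by auto
    have "(\<integral>\<^sup>+y. ennreal (e_log (u y) * \<bar>\<kappa> y\<bar>) \<partial>M) = \<infinity>"
      using 2 by (auto simp: integrable_iff_bounded abs_mult top_unique less_top[symmetric])
    then show ?thesis by simp
  qed
qed

lemma elog_ball_convolution:
  fixes a :: "'n::finite \<Rightarrow> real \<Rightarrow> real"
  assumes a: "bumps a" and u [measurable]: "u \<in> borel_measurable borel"
    and L: "(\<integral>\<^sup>+x. ennreal (e_log (u x)) \<partial>lborel) \<le> ennreal L" "1 \<le> L"
  shows "elog_ball ((knorm a + 1) * L) (\<lambda>x. \<integral>y. u y * pker a (y - x) \<partial>lborel)"
proof -
  have [measurable]: "pker a \<in> borel_measurable borel" using a by (rule pker_measurable)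
  define k where "k = 1 / (knorm a + 1)"
  have k1: "0 < knorm a + 1" using knorm_nonneg[of a] by linarith
  have k: "0 < k" "k * knorm a \<le> 1" unfolding k_def using k1 by (auto simp: divide_simps)
  define \<kappa> where "\<kappa> z = k * pker a z" for z
  have [measurable]: "\<kappa> \<in> borel_measurable borel" unfolding \<kappa>_def[abs_def] by measurable
  have ki: "integrable lborel \<kappa>" unfolding \<kappa>_def using pker_integrable[OF a] by simp
  have ti: "integrable lborel (\<lambda>y. \<kappa> (y - x))" for x
    using lborel_integrable_affine[OF ki, of 1 "-x"] by simp
  have kn: "(\<integral>y. \<bar>\<kappa> (y - x)\<bar> \<partial>lborel) \<le> 1" for x
    unfolding \<kappa>_def abs_mult using knorm_translate[OF a, of x] k by simp
  have rn: "(\<integral>\<^sup>+x. ennreal \<bar>\<kappa> (y - x)\<bar> \<partial>lborel) \<le> 1" for y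
  proof -
    have i: "integrable lborel (\<lambda>x. \<kappa> (y - x))" by (rule reflect_integral[OF ki])
    have "(\<integral>\<^sup>+x. ennreal \<bar>\<kappa> (y - x)\<bar> \<partial>lborel) = ennreal (\<integral>x. \<bar>\<kappa> (y - x)\<bar> \<partial>lborel)"
      by (rule nn_integral_eq_integral) (use i in auto)
    also have "\<dots> \<le> ennreal 1" unfolding \<kappa>_def abs_mult using knorm_reflect[OF a, of y] k by (intro ennreal_leI) simp
    finally show ?thesis by simp
  qed
  have L0: "0 < L" using L(2) by simp
  let ?w = "\<lambda>x. \<integral>y. u y * \<kappa> (y - x) \<partial>lborel"
  have w: "(\<integral>y. u y * pker a (y - x) \<partial>lborel) / ((knorm a + 1) * L) = (1 / L) * ?w x" for x
  proof -
    have "?w x = k * (\<integral>y. u y * pker a (y - x) \<partial>lborel)"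
      unfolding \<kappa>_def by (subst integral_mult_right_zero[symmetric]) (simp add: mult_ac)
    then show ?thesis unfolding k_def by simp
  qed
  have "(\<integral>\<^sup>+x. ennreal (e_log ((1 / L) * ?w x)) \<partial>lborel) \<le> (\<integral>\<^sup>+x. ennreal (1 / L) * (\<integral>\<^sup>+y. ennreal (e_log (u y) * \<bar>\<kappa> (y - x)\<bar>) \<partial>lborel) \<partial>lborel)"
  proof (rule nn_integral_mono)
    fix x
    have "ennreal (e_log ((1 / L) * ?w x)) \<le> ennreal ((1 / L) * e_log (?w x))"
      by (intro ennreal_leI e_log_shrink) (use L in auto)
    also have "\<dots> = ennreal (1 / L) * ennreal (e_log (?w x))" using L0 by (intro ennreal_mult) auto
    also have "\<dots> \<le> ennreal (1 / L) * (\<integral>\<^sup>+y. ennreal (e_log (u y) * \<bar>\<kappa> (y - x)\<bar>) \<partial>lborel)"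
      by (intro mult_left_mono e_log_integral_le ti kn) (use u in auto)
    finally show "ennreal (e_log ((1 / L) * ?w x)) \<le> \<dots>" .
  qed
  also have "\<dots> = ennreal (1 / L) * (\<integral>\<^sup>+x. (\<integral>\<^sup>+y. ennreal (e_log (u y) * \<bar>\<kappa> (y - x)\<bar>) \<partial>lborel) \<partial>lborel)"
    by (rule nn_integral_cmult) measurable
  also have "(\<integral>\<^sup>+x. (\<integral>\<^sup>+y. ennreal (e_log (u y) * \<bar>\<kappa> (y - x)\<bar>) \<partial>lborel) \<partial>lborel)
     = (\<integral>\<^sup>+y. (\<integral>\<^sup>+x. ennreal (e_log (u y) * \<bar>\<kappa> (y - x)\<bar>) \<partial>lborel) \<partial>lborel)"
    by (rule lborel_pair.Fubini') measurable
  also have "\<dots> = (\<integral>\<^sup>+y. ennreal (e_log (u y)) * (\<integral>\<^sup>+x. ennreal \<bar>\<kappa> (y - x)\<bar> \<partial>lborel) \<partial>lborel)"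
    by (intro nn_integral_cong) (simp add: ennreal_mult nn_integral_cmult)
  also have "\<dots> \<le> (\<integral>\<^sup>+y. ennreal (e_log (u y)) * 1 \<partial>lborel)"
    by (intro nn_integral_mono mult_left_mono rn) auto
  also have "\<dots> \<le> ennreal L" using L by simp
  finally have "(\<integral>\<^sup>+x. ennreal (e_log ((1 / L) * ?w x)) \<partial>lborel) \<le> ennreal (1 / L) * ennreal L"
    by (simp add: mult_left_mono)
  also have "\<dots> = 1" using L0 by (simp add: ennreal_mult[symmetric])
  finally show ?thesis unfolding elog_ball_def w using L0 knorm_nonneg[of a]
    by (auto intro!: mult_pos_pos add_nonneg_pos simp del: times_divide_eq_left)
qed

lemma e_log_le_ln_plus: "e_log t \<le> 2 * (\<bar>t\<bar> * (1 + ln_plus t))"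
proof -
  have "ln (1 + \<bar>t\<bar>) \<le> 1 + ln_plus t"
  proof (cases "\<bar>t\<bar> \<le> 1")
    case True
    have "ln (1 + \<bar>t\<bar>) \<le> \<bar>t\<bar>" by (rule ln_add_one_self_le_self) simp
    then show ?thesis using True by (simp add: ln_plus_def)
  next
    case False
    have "ln (1 + \<bar>t\<bar>) \<le> ln (2 * \<bar>t\<bar>)" using False by (intro ln_mono) auto
    also have "\<dots> = ln 2 + ln \<bar>t\<bar>" using False by (subst ln_mult) auto
    also have "\<dots> \<le> 1 + ln_plus t" using ln_2_less_1 by (simp add: ln_plus_def)
    finally show ?thesis .
  qed
  moreover have "0 \<le> ln_plus t" by (simp add: ln_plus_def)
  ultimately have "1 + ln (1 + \<bar>t\<bar>) \<le> 2 * (1 + ln_plus t)" by simp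
  from mult_left_mono[OF this, of "\<bar>t\<bar>"] e_log_le[of t] show ?thesis by (simp add: algebra_simps)
qed

lemma e_log_le_norm_1plus: "(\<integral>\<^sup>+x. ennreal (e_log (u x)) \<partial>lborel) \<le> 2 * norm_1plus p u"
  if [measurable]: "u \<in> borel_measurable borel"
proof -
  have lp: "0 \<le> ln_plus t" for t by (simp add: ln_plus_def)
  have "(\<integral>\<^sup>+x. ennreal (e_log (u x)) \<partial>lborel) \<le> (\<integral>\<^sup>+x. 2 * ennreal ((1 + norm x) ^ p * \<bar>u x\<bar> * (1 + ln_plus (norm x) + ln_plus (u x))) \<partial>lborel)"
  proof (rule nn_integral_mono)
    fix x
    have "1 * (\<bar>u x\<bar> * (1 + ln_plus (u x))) \<le> (1 + norm x) ^ p * (\<bar>u x\<bar> * (1 + ln_plus (norm x) + ln_plus (u x)))"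
      by (intro mult_mono mult_nonneg_nonneg) (use lp in \<open>auto simp: add_nonneg_nonneg\<close>)
    then have "e_log (u x) \<le> 2 * ((1 + norm x) ^ p * \<bar>u x\<bar> * (1 + ln_plus (norm x) + ln_plus (u x)))"
      using e_log_le_ln_plus[of "u x"] by (simp add: mult.assoc)
    then have "ennreal (e_log (u x)) \<le> ennreal (2 * ((1 + norm x) ^ p * \<bar>u x\<bar> * (1 + ln_plus (norm x) + ln_plus (u x))))"
      by (rule ennreal_leI)
    also have "\<dots> = 2 * ennreal ((1 + norm x) ^ p * \<bar>u x\<bar> * (1 + ln_plus (norm x) + ln_plus (u x)))"
      using lp by (subst ennreal_mult) (auto intro!: mult_nonneg_nonneg add_nonneg_nonneg)
    finally show "ennreal (e_log (u x)) \<le> \<dots>" .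
  qed
  also have "\<dots> = 2 * norm_1plus p u"
    unfolding norm_1plus_def ln_plus_def by (rule nn_integral_cmult) measurable
  finally show ?thesis .
qed

section \<open>Identification of the limit\<close>

text \<open>The indicator of an open set as the limit of the continuous functions
  \<open>min 1 (k dist(x, U\<^sup>c))\<close>, or of the constant \<open>1\<close> if \<open>U\<close> is the whole space.\<close>

lemma bounded_continuous_approx_open:
  fixes U :: "'a::euclidean_space set"
  assumes U: "open U"
  obtains \<psi> :: "nat \<Rightarrow> 'a \<Rightarrow> real" where "\<And>k. continuous_on UNIV (\<psi> k)" "\<And>k x. \<bar>\<psi> k x\<bar> \<le> 1"
    "\<And>K. finite_measure K \<Longrightarrow> sets K = sets borel \<Longrightarrow> (\<lambda>k. \<integral>x. \<psi> k x \<partial>K) \<longlonglongrightarrow> measure K U"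
proof (cases "U = UNIV")
  case True
  have "(\<lambda>k. \<integral>x. 1 \<partial>K) \<longlonglongrightarrow> measure K U" if "sets K = sets borel" for K
    using True sets_eq_imp_space_eq[OF that] by simp
  then show thesis by (intro that[of "\<lambda>_ _. 1"]) auto
next
  case False
  define \<psi> where "\<psi> k x = min 1 (real k * infdist x (- U))" for k x
  have c: "continuous_on UNIV (\<psi> k)" for k unfolding \<psi>_def[abs_def] by (intro continuous_intros)
  have b: "\<bar>\<psi> k x\<bar> \<le> 1" for k x
  proof -
    have "0 \<le> real k * infdist x (- U)" by (intro mult_nonneg_nonneg infdist_nonneg) simp
    then show ?thesis unfolding \<psi>_def by linarith
  qed
  have lim: "(\<lambda>k. \<psi> k x) \<longlonglongrightarrow> indicator U x" for x
  proof (cases "x \<in> U")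
    case True
    have "infdist x (- U) > 0"
      using True U False infdist_pos_not_in_closed[of "- U" x] by auto
    then obtain n where n: "1 \<le> real n * infdist x (- U)"
      using reals_Archimedean3 less_imp_le by metis
    have "\<psi> k x = 1" if "n \<le> k" for k
    proof -
      have "real n * infdist x (- U) \<le> real k * infdist x (- U)" using that by (intro mult_right_mono infdist_nonneg) auto
      then show ?thesis using n by (simp add: \<psi>_def)
    qed
    then have "eventually (\<lambda>k. \<psi> k x = 1) sequentially" by (auto simp: eventually_sequentially)
    then show ?thesis using True by (simp add: tendsto_eventually)
  next
    case False
    then show ?thesis by (simp add: \<psi>_def)
  qed
  have L: "(\<lambda>k. \<integral>x. \<psi> k x \<partial>K) \<longlonglongrightarrow> measure K U" if K: "finite_measure K" and sK: "sets K = sets borel" for K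
  proof -
    interpret K: finite_measure K by fact
    note sK [measurable_cong]
    have [measurable]: "\<psi> k \<in> borel_measurable borel" for k by (intro borel_measurable_continuous_onI c)
    have [measurable]: "U \<in> sets borel" using U by auto
    have "(\<lambda>k. \<integral>x. \<psi> k x \<partial>K) \<longlonglongrightarrow> (\<integral>x. indicator U x \<partial>K)"
      by (rule integral_dominated_convergence[where w = "\<lambda>_. 1"]) (use lim b in auto)
    then show ?thesis using sets_eq_imp_space_eq[OF sK] by simp
  qed
  with c b L show thesis by (intro that[of \<psi>])
qed

text \<open>Finite Borel measures are determined by their integrals of bounded continuous functions. The
  version for the identity \<open>M + Q = P\<close> avoids subtracting measures.\<close>

lemma measure_add_eqI:
  fixes M Q P :: "'a::euclidean_space measure"
  assumes fin: "finite_measure M" "finite_measure Q" "finite_measure P"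
    and sets: "sets M = sets borel" "sets Q = sets borel" "sets P = sets borel"
    and eq: "\<And>(\<psi> :: 'a \<Rightarrow> real) B. continuous_on UNIV \<psi> \<Longrightarrow> (\<And>x. \<bar>\<psi> x\<bar> \<le> B) \<Longrightarrow>
       (\<integral>x. \<psi> x \<partial>M) + (\<integral>x. \<psi> x \<partial>Q) = (\<integral>x. \<psi> x \<partial>P)"
    and A: "A \<in> sets borel"
  shows "measure M A + measure Q A = measure P A"
proof -
  have op: "measure M U + measure Q U = measure P U" if U: "open U" for U
  proof -
    obtain \<psi> :: "nat \<Rightarrow> 'a \<Rightarrow> real" where \<psi>: "\<And>k. continuous_on UNIV (\<psi> k)" "\<And>k x. \<bar>\<psi> k x\<bar> \<le> 1"
      "\<And>K. finite_measure K \<Longrightarrow> sets K = sets borel \<Longrightarrow> (\<lambda>k. \<integral>x. \<psi> k x \<partial>K) \<longlonglongrightarrow> measure K U"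
      using bounded_continuous_approx_open[OF U] by blast
    have "(\<lambda>k. (\<integral>x. \<psi> k x \<partial>M) + (\<integral>x. \<psi> k x \<partial>Q)) \<longlonglongrightarrow> measure M U + measure Q U"
      by (intro tendsto_add \<psi>(3) fin sets)
    moreover have "(\<lambda>k. (\<integral>x. \<psi> k x \<partial>M) + (\<integral>x. \<psi> k x \<partial>Q)) = (\<lambda>k. \<integral>x. \<psi> k x \<partial>P)"
      by (rule ext) (rule eq[OF \<psi>(1,2)])
    ultimately show ?thesis using \<psi>(3)[OF fin(3) sets(3)] LIMSEQ_unique by metis
  qed
  have cm: "measure K (UNIV - X) = measure K UNIV - measure K X"
    if "finite_measure K" "sets K = sets borel" "X \<in> sets borel" for K and X :: "'a set"
    using finite_measure.finite_measure_compl[OF that(1), of X] sets_eq_imp_space_eq[OF that(2)] that by simp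
  have un: "(\<lambda>i. measure K (X i)) sums measure K (\<Union>i. X i)"
    if "finite_measure K" "sets K = sets borel" "disjoint_family X" "\<And>i. X i \<in> sets borel" for K and X :: "nat \<Rightarrow> 'a set"
    using that finite_measure.finite_measure_UNION[OF that(1), of X] by auto
  have "Int_stable {S :: 'a set. open S}" by (auto simp: Int_stable_def)
  moreover have "{S :: 'a set. open S} \<subseteq> Pow UNIV" by simp
  moreover have "A \<in> sigma_sets UNIV {S. open S}" using A by (simp add: borel_def sets_measure_of)
  ultimately show ?thesis
  proof (induction rule: sigma_sets_induct_disjoint)
    case (basic X) then show ?case using op by simp
  next
    case empty then show ?case by simp
  next
    case (compl X)
    then have X: "X \<in> sets borel" by (simp add: borel_def sets_measure_of)
    show ?case using compl(2) op[of UNIV] by (simp add: cm[OF fin(1) sets(1) X] cm[OF fin(2) sets(2) X] cm[OF fin(3) sets(3) X])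
  next
    case (union X)
    then have X: "X i \<in> sets borel" for i by (auto simp: borel_def sets_measure_of)
    have "(\<lambda>i. measure M (X i) + measure Q (X i)) sums (measure M (\<Union>i. X i) + measure Q (\<Union>i. X i))"
      by (intro sums_add un fin sets union(1) X)
    moreover have "(\<lambda>i. measure P (X i)) sums measure P (\<Union>i. X i)" by (intro un fin sets union(1) X)
    ultimately show ?case using union(3) sums_unique2 by simp
  qed
qed

lemma mollify_weak_convergence:
  fixes a :: "'n::finite \<Rightarrow> real \<Rightarrow> real"
  assumes M: "finite_measure M" "sets M = sets borel" and a: "bumps a" "(\<integral>x. pker a x \<partial>lborel) = 1"
    and \<psi>: "continuous_on UNIV \<psi>" "\<And>x. \<bar>\<psi> x\<bar> \<le> B" and h: "\<And>k. 0 < h k" "h \<longlonglongrightarrow> 0"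
  shows "(\<lambda>k. \<integral>x. \<psi> x * mollify (signed_of M) (scale (h k) a) x \<partial>lborel) \<longlonglongrightarrow> (\<integral>x. \<psi> x \<partial>M)"
proof -
  interpret M: finite_measure M by fact
  note M(2) [measurable_cong]
  have \<psi>m [measurable]: "\<psi> \<in> borel_measurable borel" by (intro borel_measurable_continuous_onI \<psi>)
  have pm [measurable]: "pker a \<in> borel_measurable borel" by (intro pker_measurable a)
  have fin: "finite_signed (signed_of M)" by (intro signed_of_finite M)
  have sb: "bumps (scale (h k) a)" for k using bumps_scale[OF a(1), of "h k"] h(1)[of k] by simp
  have sm: "smear (scale (h k) a) \<psi> y = (\<integral>z. \<psi> (y - h k *\<^sub>R z) * pker a z \<partial>lborel)" for k y
  proof -
    have "smear (scale (h k) a) \<psi> y = (\<integral>x. (1 / h k) ^ CARD('n) * (\<psi> x * pker a ((1 / h k) *\<^sub>R (y - x))) \<partial>lborel)"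
      unfolding smear_def pker_scale by (simp add: mult_ac)
    also have "\<dots> = (1 / h k) ^ CARD('n) * (\<integral>x. \<psi> x * pker a ((1 / h k) *\<^sub>R (y - x)) \<partial>lborel)"
      by (rule integral_mult_right_zero)
    also have "(\<integral>x. \<psi> x * pker a ((1 / h k) *\<^sub>R (y - x)) \<partial>lborel)
       = \<bar>- h k\<bar> ^ DIM(real ^ 'n) * (\<integral>z. \<psi> (y + (- h k) *\<^sub>R z) * pker a ((1 / h k) *\<^sub>R (y - (y + (- h k) *\<^sub>R z))) \<partial>lborel)"
      by (rule lborel_integral_affine) (use h(1)[of k] in auto)
    finally show ?thesis using h(1)[of k] by (simp add: power_one_over)
  qed
  have lim: "(\<lambda>k. smear (scale (h k) a) \<psi> y) \<longlonglongrightarrow> \<psi> y" for y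
  proof -
    have "(\<lambda>k. \<integral>z. \<psi> (y - h k *\<^sub>R z) * pker a z \<partial>lborel) \<longlonglongrightarrow> (\<integral>z. \<psi> y * pker a z \<partial>lborel)"
    proof (rule integral_dominated_convergence[where w = "\<lambda>z. B * \<bar>pker a z\<bar>"])
      show "AE z in lborel. (\<lambda>k. \<psi> (y - h k *\<^sub>R z) * pker a z) \<longlonglongrightarrow> \<psi> y * pker a z"
      proof (intro AE_I2 tendsto_mult tendsto_const)
        fix z
        have "(\<lambda>k. y - h k *\<^sub>R z) \<longlonglongrightarrow> y - 0 *\<^sub>R z" by (intro tendsto_intros h)
        then show "(\<lambda>k. \<psi> (y - h k *\<^sub>R z)) \<longlonglongrightarrow> \<psi> y"
          by (intro continuous_on_tendsto_compose[OF \<psi>(1)]) auto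
      qed
      show "integrable lborel (\<lambda>z. B * \<bar>pker a z\<bar>)" using pker_integrable[OF a(1)] by simp
    qed (use \<psi>(2) in \<open>auto simp: abs_mult intro!: mult_right_mono\<close>)
    then show ?thesis unfolding sm using a(2) by simp
  qed
  have "(\<lambda>k. \<integral>y. smear (scale (h k) a) \<psi> y \<partial>M) \<longlonglongrightarrow> (\<integral>y. \<psi> y \<partial>M)"
  proof (rule integral_dominated_convergence[where w = "\<lambda>_. B * knorm a"])
    show "AE y in M. norm (smear (scale (h k) a) \<psi> y) \<le> B * knorm a" for k
      using smear_bound[OF sb \<psi>m \<psi>(2)] knorm_scale[OF a(1) h(1)] by simp
    show "smear (scale (h k) a) \<psi> \<in> borel_measurable M" for k
      using smear_fubini(1)[OF M sb \<psi>m \<psi>(2)] by (rule borel_measurable_integrable)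
  qed (use lim in auto)
  moreover have "(\<integral>x. \<psi> x * mollify (signed_of M) (scale (h k) a) x \<partial>lborel) = (\<integral>y. smear (scale (h k) a) \<psi> y \<partial>M)" for k
    using mollify_duality(2)[OF fin sb \<psi>m \<psi>(2)] by (simp add: signed_integral_def signed_of_def)
  ultimately show ?thesis by simp
qed

text \<open>Summable Luxemburg norms of the increments give the limit density. The limit \<open>G\<close> of the
  functions \<open>F k\<close>, which may change sign, satisfies \<open>\<mu> + G\<^sup>- dx = G\<^sup>+ dx\<close>. Evaluated on \<open>{G < 0}\<close> this shows that \<open>G\<close> is nonnegative
  almost everywhere.\<close>

lemma density_from_elog_balls:
  fixes \<mu> :: "(real ^ 'n::finite) measure" and F :: "nat \<Rightarrow> real ^ 'n \<Rightarrow> real"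
  assumes \<mu>: "finite_measure \<mu>" "sets \<mu> = sets borel"
    and F0: "elog_ball N0 (F 0)" and FS: "\<And>k. elog_ball (N k) (\<lambda>x. F (Suc k) x - F k x)" and N: "summable N"
    and weak: "\<And>\<psi> B. continuous_on UNIV \<psi> \<Longrightarrow> (\<And>x. \<bar>\<psi> x\<bar> \<le> B) \<Longrightarrow> (\<lambda>k. \<integral>x. \<psi> x * F k x \<partial>lborel) \<longlonglongrightarrow> (\<integral>x. \<psi> x \<partial>\<mu>)"
  shows "\<exists>g. g \<in> L_elog \<and> (\<forall>x. 0 \<le> g x) \<and> \<mu> = density lborel (\<lambda>x. ennreal (g x))"
proof -
  interpret \<mu>: finite_measure \<mu> by fact
  define D where "D k x = F (Suc k) x - F k x" for k x
  have D: "elog_ball (N k) (D k)" for k unfolding D_def using FS .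
  have Npos: "0 < N k" for k using D by (rule elog_ball_pos)
  have Di: "integrable lborel (D k)" "(\<integral>x. \<bar>D k x\<bar> \<partial>lborel) \<le> N k" for k
    using elog_ball_L1[OF D[of k]] by auto
  have F0i: "integrable lborel (F 0)" using elog_ball_L1[OF F0] by auto
  have F_eq: "F k x = F 0 x + (\<Sum>j<k. D j x)" for k x
    by (induction k) (auto simp: D_def)
  have sumD: "summable (\<lambda>k. \<integral>x. norm (D k x) \<partial>lborel)"
    by (rule summable_comparison_test'[OF N]) (use Di in auto)
  have AEsum: "AE x in lborel. summable (\<lambda>k. norm (D k x))"
  proof -
    have "(\<integral>\<^sup>+x. (\<Sum>k. ennreal (norm (D k x))) \<partial>lborel) = (\<Sum>k. \<integral>\<^sup>+x. ennreal (norm (D k x)) \<partial>lborel)"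
      using Di by (intro nn_integral_suminf) auto
    also have "\<dots> = (\<Sum>k. ennreal (\<integral>x. norm (D k x) \<partial>lborel))"
      using Di by (intro suminf_cong nn_integral_eq_integral) auto
    also have "\<dots> \<noteq> \<infinity>" using sumD by (simp add: suminf_ennreal_eq sums_def ennreal_suminf_neq_top)
    finally have "AE x in lborel. (\<Sum>k. ennreal (norm (D k x))) \<noteq> \<infinity>"
      using Di by (intro nn_integral_PInf_AE) auto
    then show ?thesis by eventually_elim (auto intro!: summable_suminf_not_top)
  qed
  have [measurable]: "D k \<in> borel_measurable borel" "F 0 \<in> borel_measurable borel" for k
    using elog_ball_measurable D F0 by blast+
  define G where "G x = F 0 x + (\<Sum>k. D k x)" for x
  have Gm [measurable]: "G \<in> borel_measurable borel" unfolding G_def[abs_def] by measurable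
  have lim: "AE x in lborel. (\<lambda>k. F k x) \<longlonglongrightarrow> G x"
    using AEsum
  proof eventually_elim
    fix x assume "summable (\<lambda>k. norm (D k x))"
    then have "summable (\<lambda>k. D k x)" by (rule summable_norm_cancel)
    then show "(\<lambda>k. F k x) \<longlonglongrightarrow> G x"
      unfolding ext[of "\<lambda>k. F k x", OF F_eq] G_def by (intro tendsto_add tendsto_const summable_LIMSEQ)
  qed
  have ball: "elog_ball (N0 + suminf N) (F k)" for k
  proof (rule elog_ball_mono)
    show "elog_ball (N0 + (\<Sum>j<k. N j)) (F k)"
      using elog_ball_sum[of "{..<k}" N D N0 "F 0"] D F0 unfolding ext[of "F k", OF F_eq] by simp
    show "N0 + (\<Sum>j<k. N j) \<le> N0 + suminf N"
      using sum_le_suminf[OF N, of "{..<k}"] Npos by (auto intro: less_imp_le)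
  qed
  have Gball: "elog_ball (N0 + suminf N) G" by (rule elog_ball_AE_limit[OF ball lim Gm])
  have Gi: "integrable lborel G" using elog_ball_L1[OF Gball] by auto
  have int: "(\<integral>x. \<psi> x * G x \<partial>lborel) = (\<integral>x. \<psi> x \<partial>\<mu>)"
    if \<psi>: "continuous_on UNIV \<psi>" "\<And>x. \<bar>\<psi> x\<bar> \<le> B" for \<psi> B
  proof -
    have [measurable]: "\<psi> \<in> borel_measurable borel" by (intro borel_measurable_continuous_onI \<psi>)
    have prod: "integrable lborel (\<lambda>x. \<psi> x * u x)" if u: "integrable lborel u" for u
    proof (rule Bochner_Integration.integrable_bound)
      have [measurable]: "u \<in> borel_measurable borel" using u by auto
      show "(\<lambda>x. \<psi> x * u x) \<in> borel_measurable lborel" by measurable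
      have "\<bar>\<psi> x\<bar> \<le> \<bar>B\<bar>" for x using \<psi>(2)[of x] by linarith
      then show "AE x in lborel. norm (\<psi> x * u x) \<le> norm (B * u x)" by (auto simp: abs_mult intro!: mult_right_mono)
      show "integrable lborel (\<lambda>x. B * u x)" using u by simp
    qed
    have B0: "0 \<le> B" using \<psi>(2)[of 0] by linarith
    have le: "norm (\<psi> x * D k x) \<le> B * norm (D k x)" for k x using \<psi>(2)[of x] by (auto simp: abs_mult intro!: mult_right_mono)
    have sums: "(\<lambda>k. \<integral>x. \<psi> x * D k x \<partial>lborel) sums (\<integral>x. (\<Sum>k. \<psi> x * D k x) \<partial>lborel)"
    proof (rule sums_integral)
      show "AE x in lborel. summable (\<lambda>k. norm (\<psi> x * D k x))"
        using AEsum by eventually_elim (rule summable_comparison_test'[OF summable_mult[of _ B]], use le in auto)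
      show "summable (\<lambda>k. \<integral>x. norm (\<psi> x * D k x) \<partial>lborel)"
      proof (rule summable_comparison_test'[OF summable_mult[OF sumD, of B]])
        fix k
        have "(\<integral>x. norm (\<psi> x * D k x) \<partial>lborel) \<le> (\<integral>x. B * norm (D k x) \<partial>lborel)"
          using le by (intro integral_mono integrable_norm prod Di integrable_mult_right) auto
        then show "norm (\<integral>x. norm (\<psi> x * D k x) \<partial>lborel) \<le> B * (\<integral>x. norm (D k x) \<partial>lborel)" by simp
      qed
    qed (intro prod Di)
    have part: "(\<integral>x. \<psi> x * F k x \<partial>lborel) = (\<integral>x. \<psi> x * F 0 x \<partial>lborel) + (\<Sum>j<k. \<integral>x. \<psi> x * D j x \<partial>lborel)" for k
      unfolding F_eq[of k] distrib_left sum_distrib_left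
      by (subst Bochner_Integration.integral_add) (auto intro!: prod F0i Di Bochner_Integration.integrable_sum Bochner_Integration.integral_sum)
    have "(\<lambda>k. \<integral>x. \<psi> x * F k x \<partial>lborel) \<longlonglongrightarrow> (\<integral>x. \<psi> x * F 0 x \<partial>lborel) + (\<integral>x. (\<Sum>k. \<psi> x * D k x) \<partial>lborel)"
      unfolding ext[of "\<lambda>k. \<integral>x. \<psi> x * F k x \<partial>lborel", OF part] using sums by (intro tendsto_add tendsto_const) (simp add: sums_def)
    then have "(\<integral>x. \<psi> x \<partial>\<mu>) = (\<integral>x. \<psi> x * F 0 x \<partial>lborel) + (\<integral>x. (\<Sum>k. \<psi> x * D k x) \<partial>lborel)"
      using weak[OF \<psi>] LIMSEQ_unique by blast
    also have "(\<integral>x. (\<Sum>k. \<psi> x * D k x) \<partial>lborel) = (\<integral>x. \<psi> x * G x - \<psi> x * F 0 x \<partial>lborel)"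
    proof (rule integral_cong_AE)
      show "AE x in lborel. (\<Sum>k. \<psi> x * D k x) = \<psi> x * G x - \<psi> x * F 0 x"
        using AEsum by eventually_elim
          (auto simp: G_def distrib_left intro!: suminf_mult summable_rabs_cancel)
    qed measurable
    also have "\<dots> = (\<integral>x. \<psi> x * G x \<partial>lborel) - (\<integral>x. \<psi> x * F 0 x \<partial>lborel)"
      by (intro Bochner_Integration.integral_diff prod Gi F0i)
    finally show ?thesis by simp
  qed
  define P where "P = density lborel (\<lambda>x. ennreal (G x))"
  define Q where "Q = density lborel (\<lambda>x. ennreal (- G x))"
  have PQ: "finite_measure P" "finite_measure Q" "sets P = sets borel" "sets Q = sets borel"
    using signed_density_finite[OF Gi] by (auto simp: finite_signed_def signed_density_def P_def Q_def)
  have Gm' [measurable]: "{x. G x < 0} \<in> sets borel" by measurable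
  have split: "measure \<mu> A + measure Q A = measure P A" if "A \<in> sets borel" for A
  proof (rule measure_add_eqI[OF \<mu>(1) PQ(2,1) \<mu>(2) PQ(4,3) _ that])
    fix \<psi> :: "real ^ 'n \<Rightarrow> real" and B assume \<psi>: "continuous_on UNIV \<psi>" "\<And>x. \<bar>\<psi> x\<bar> \<le> B"
    have "\<psi> \<in> borel_measurable borel" by (intro borel_measurable_continuous_onI \<psi>)
    from signed_integral_density[OF Gi this \<psi>(2)]
    have "(\<integral>x. \<psi> x \<partial>P) - (\<integral>x. \<psi> x \<partial>Q) = (\<integral>x. \<psi> x * G x \<partial>lborel)"
      by (simp add: signed_integral_def signed_density_def P_def Q_def mult.commute)
    then show "(\<integral>x. \<psi> x \<partial>\<mu>) + (\<integral>x. \<psi> x \<partial>Q) = (\<integral>x. \<psi> x \<partial>P)" using int[OF \<psi>] by simp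
  qed
  have "emeasure P {x. G x < 0} = (\<integral>\<^sup>+x. ennreal (G x) * indicator {x. G x < 0} x \<partial>lborel)"
    unfolding P_def by (rule emeasure_density) measurable
  also have "\<dots> = (\<integral>\<^sup>+x. 0 \<partial>(lborel :: (real ^ 'n) measure))"
    by (rule nn_integral_cong) (auto simp: indicator_def ennreal_neg)
  finally have "measure P {x. G x < 0} = 0" by (simp add: measure_def)
  then have Q1: "measure Q {x. G x < 0} = 0" using split[of "{x. G x < 0}"] by (simp add: add_nonneg_eq_0_iff)
  have "emeasure Q (- {x. G x < 0}) = (\<integral>\<^sup>+x. ennreal (- G x) * indicator (- {x. G x < 0}) x \<partial>lborel)"
    unfolding Q_def by (rule emeasure_density) measurable
  also have "\<dots> = (\<integral>\<^sup>+x. 0 \<partial>(lborel :: (real ^ 'n) measure))"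
    by (rule nn_integral_cong) (auto simp: indicator_def ennreal_neg)
  finally have Q2: "measure Q (- {x. G x < 0}) = 0" by (simp add: measure_def)
  interpret P: finite_measure P by (rule PQ)
  interpret Q: finite_measure Q by (rule PQ)
  have "measure Q A = 0" if A: "A \<in> sets borel" for A
  proof -
    have "measure Q A \<le> measure Q ({x. G x < 0} \<union> - {x. G x < 0})"
      by (intro Q.finite_measure_mono) (use PQ in auto)
    also have "\<dots> \<le> measure Q {x. G x < 0} + measure Q (- {x. G x < 0})"
      by (intro measure_Un_le) (use PQ Gm' in auto)
    finally show ?thesis using Q1 Q2 measure_nonneg[of Q A] by linarith
  qed
  then have mP: "measure \<mu> A = measure P A" if "A \<in> sets borel" for A using split that by simp
  have "\<mu> = P"
  proof (rule measure_eqI)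
    fix A assume "A \<in> sets \<mu>"
    then show "emeasure \<mu> A = emeasure P A"
      using mP \<mu>(2) by (simp add: \<mu>.emeasure_eq_measure P.emeasure_eq_measure)
  qed (use PQ \<mu> in simp)
  also have "P = density lborel (\<lambda>x. ennreal (max 0 (G x)))"
    unfolding P_def by (rule arg_cong[where f = "density lborel"]) (auto simp: max_def ennreal_neg)
  finally have "\<mu> = density lborel (\<lambda>x. ennreal (max 0 (G x)))" .
  moreover have "elog_ball (N0 + suminf N) (\<lambda>x. max 0 (G x))"
  proof -
    have "(\<integral>\<^sup>+x. ennreal (e_log (max 0 (G x) / (N0 + suminf N))) \<partial>lborel) \<le> (\<integral>\<^sup>+x. ennreal (e_log (G x / (N0 + suminf N))) \<partial>lborel)"
      by (intro nn_integral_mono ennreal_leI e_log_mono) (auto simp: divide_right_mono)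
    then show ?thesis using Gball by (auto simp: elog_ball_def intro: order_trans)
  qed
  ultimately show ?thesis by (intro exI[of _ "\<lambda>x. max 0 (G x)"]) (auto intro: elog_ball_in_L_elog)
qed

section \<open>One dyadic step\<close>

lemma weak_partial_from_sobolev:
  fixes f :: "real ^ 'n::finite \<Rightarrow> real"
  assumes S: "sobolev_norm_1plus k p f \<le> ennreal l" and \<alpha>: "mi_order \<alpha> \<le> k"
  shows "is_weak_partial \<alpha> f (weak_partial \<alpha> f)" "norm_1plus p (weak_partial \<alpha> f) \<le> ennreal l"
proof -
  have ex: "\<forall>\<alpha>. mi_order \<alpha> \<le> k \<longrightarrow> (\<exists>g. is_weak_partial \<alpha> f g)"
    using S unfolding sobolev_norm_1plus_def by (auto split: if_splits simp: top_unique)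
  then show "is_weak_partial \<alpha> f (weak_partial \<alpha> f)"
    using \<alpha> unfolding weak_partial_def by (metis someI_ex)
  have "norm_1plus p (weak_partial \<alpha> f) \<le> (\<Sum>\<alpha> | mi_order \<alpha> \<le> k. norm_1plus p (weak_partial \<alpha> f))"
    by (rule member_le_sum) (use \<alpha> finite_mi_order_le in auto)
  also have "\<dots> \<le> ennreal l" using S ex unfolding sobolev_norm_1plus_def by simp
  finally show "norm_1plus p (weak_partial \<alpha> f) \<le> ennreal l" .
qed

text \<open>The smoothed pure derivatives of order \<open>2 m\<close> of \<open>f\<close>: after the derivative has been moved to \<open>f\<close>, the
  bound does not depend on the scale \<open>h\<close>.\<close>

lemma derivative_part_ball:
  fixes f :: "real ^ 'n::finite \<Rightarrow> real"
  assumes f: "integrable lborel f" and S: "sobolev_norm_1plus (2 * m) p f \<le> ennreal l" and l: "0 \<le> l"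
    and b: "bumps b" and h: "0 < h"
  shows "elog_ball ((knorm b + 1) * (1 + 2 * l))
     (\<lambda>x. mollify (signed_density f) (pderiv_at i (2 * m) (scale h b)) x)"
proof -
  define u where "u = weak_partial (single_mi i (2 * m)) f"
  have u: "is_weak_partial (single_mi i (2 * m)) f u" "norm_1plus p u \<le> ennreal l"
    unfolding u_def using weak_partial_from_sobolev[OF S, of "single_mi i (2 * m)"] by auto
  have [measurable]: "u \<in> borel_measurable borel"
    using u(1) by (auto simp: is_weak_partial_def locally_integrable_def)
  have sb: "bumps (scale h b)" using bumps_scale[OF b] h by simp
  have "(\<integral>\<^sup>+x. ennreal (e_log (u x)) \<partial>lborel) \<le> 2 * norm_1plus p u" by (rule e_log_le_norm_1plus) measurable
  also have "\<dots> \<le> 2 * ennreal l" by (intro mult_left_mono u) simp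
  also have "\<dots> = ennreal (2 * l)" using l by (simp add: ennreal_mult)
  also have "\<dots> \<le> ennreal (1 + 2 * l)" by (rule ennreal_leI) simp
  finally have "elog_ball ((knorm (scale h b) + 1) * (1 + 2 * l)) (\<lambda>x. \<integral>y. u y * pker (scale h b) (y - x) \<partial>lborel)"
    using l by (intro elog_ball_convolution sb) auto
  moreover have "mollify (signed_density f) (pderiv_at i (2 * m) (scale h b)) x = (\<integral>y. u y * pker (scale h b) (y - x) \<partial>lborel)" for x
    unfolding mollify_density[OF f bumps_pderiv_at[OF sb]]
    by (rule weak_partial_kernel[OF u(1) sb]) simp
  ultimately show ?thesis unfolding knorm_scale[OF b h] by simp
qed

lemma mollify_density_difference:
  fixes a :: "'n::finite \<Rightarrow> real \<Rightarrow> real"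
  assumes f: "integrable lborel f" and a: "bumps a" "bumps a'" "\<And>i. bumps (c i)"
    and eq: "\<And>x. pker a x - pker a' x = q * (\<Sum>i\<in>UNIV. pker (c i) x)"
  shows "mollify (signed_density f) a x - mollify (signed_density f) a' x
    = q * (\<Sum>i\<in>(UNIV :: 'n set). mollify (signed_density f) (c i) x)"
proof -
  have int: "integrable lborel (\<lambda>y. f y * pker a (y - x))" if ab: "bumps a" for a
  proof -
    obtain B where B: "0 < B" "\<And>x. \<bar>pker a x\<bar> \<le> B" using pker_bounded[OF ab] by blast
    have [measurable]: "pker a \<in> borel_measurable borel" "f \<in> borel_measurable borel"
      using ab f by (auto intro: pker_measurable)
    show ?thesis
    proof (rule Bochner_Integration.integrable_bound)
      show "integrable lborel (\<lambda>y. B * f y)" using f by simp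
      have "\<bar>f y\<bar> * \<bar>pker a (y - x)\<bar> \<le> \<bar>f y\<bar> * B" for y by (intro mult_left_mono B) simp
      then show "AE y in lborel. norm (f y * pker a (y - x)) \<le> norm (B * f y)"
        using B(1) by (auto simp: abs_mult mult_ac)
    qed measurable
  qed
  have "mollify (signed_density f) a x - mollify (signed_density f) a' x
     = (\<integral>y. f y * (pker a (y - x) - pker a' (y - x)) \<partial>lborel)"
    unfolding mollify_density[OF f a(1)] mollify_density[OF f a(2)]
    using int[OF a(1)] int[OF a(2)] by (simp add: right_diff_distrib)
  also have "\<dots> = (\<integral>y. q * (\<Sum>i\<in>UNIV. f y * pker (c i) (y - x)) \<partial>lborel)"
    unfolding eq by (simp add: sum_distrib_left mult_ac)
  also have "\<dots> = q * (\<Sum>i\<in>UNIV. mollify (signed_density f) (c i) x)"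
    using int[OF a(3)] mollify_density[OF f a(3)] by simp
  finally show ?thesis .
qed

text \<open>The hypothesis of \<open>elog_ball_from_L1_Linf\<close> at scale \<open>2\<^bsup>-n\<^esup>\<close> in dimension \<open>k\<close>: the logarithm
  is at most of the order of \<open>n\<close>.\<close>

lemma dyadic_size_bound:
  fixes A d :: real
  assumes A: "0 < A" and d: "0 < d"
  shows "(A * 2 ^ n * d) * (1 + ln (1 + (A * (2 ^ n) ^ (k + 1) * d) / (A * (2 + real k) * (real n + 1) * 2 ^ n * d)))
     \<le> A * (2 + real k) * (real n + 1) * 2 ^ n * d"
proof -
  have "(A * (2 ^ n) ^ (k + 1) * d) / (A * (2 + real k) * (real n + 1) * 2 ^ n * d) = (2 ^ n) ^ k / ((2 + real k) * (real n + 1))"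
    using A d by simp
  also have "\<dots> \<le> (2 ^ n) ^ k / 1"
  proof (intro divide_left_mono)
    have "1 * 1 \<le> (2 + real k) * (real n + 1)" by (intro mult_mono) auto
    then show "1 \<le> (2 + real k) * (real n + 1)" by simp
  qed auto
  finally have le: "(A * (2 ^ n) ^ (k + 1) * d) / (A * (2 + real k) * (real n + 1) * 2 ^ n * d) \<le> 2 ^ (n * k)"
    by (simp add: power_mult)
  have "ln (1 + (A * (2 ^ n) ^ (k + 1) * d) / (A * (2 + real k) * (real n + 1) * 2 ^ n * d)) \<le> ln (2 * 2 ^ (n * k))"
  proof (rule ln_mono)
    have "(1::real) \<le> 2 ^ (n * k)" by simp
    then show "1 + (A * (2 ^ n) ^ (k + 1) * d) / (A * (2 + real k) * (real n + 1) * 2 ^ n * d) \<le> 2 * 2 ^ (n * k)"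
      using le by linarith
    have "0 \<le> (A * (2 ^ n) ^ (k + 1) * d) / (A * (2 + real k) * (real n + 1) * 2 ^ n * d)"
      using A d by (intro divide_nonneg_nonneg mult_nonneg_nonneg) auto
    then show "0 < 1 + (A * (2 ^ n) ^ (k + 1) * d) / (A * (2 + real k) * (real n + 1) * 2 ^ n * d)" by linarith
  qed
  also have "\<dots> = (1 + real (n * k)) * ln 2" by (simp add: ln_mult ln_realpow distrib_right)
  also have "\<dots> \<le> (1 + real (n * k)) * 1" using ln_2_less_1 by (intro mult_left_mono) auto
  finally have "1 + ln (1 + (A * (2 ^ n) ^ (k + 1) * d) / (A * (2 + real k) * (real n + 1) * 2 ^ n * d)) \<le> (2 + real k) * (real n + 1)"
    by (simp add: algebra_simps)
  then have "(A * 2 ^ n * d) * (1 + ln (1 + (A * (2 ^ n) ^ (k + 1) * d) / (A * (2 + real k) * (real n + 1) * 2 ^ n * d)))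
     \<le> (A * 2 ^ n * d) * ((2 + real k) * (real n + 1))"
    using A d by (intro mult_left_mono) auto
  then show ?thesis by (simp add: mult_ac)
qed

text \<open>The increment from scale \<open>2\<^bsup>-n\<^esup>\<close> to \<open>2\<^bsup>-n-1\<^esup>\<close> is the sum of two smoothed differences of \<open>\<mu>\<close> and \<open>f\<close>,
  named \<open>P\<close> below, and of the increment of \<open>f\<close>, a multiple of the sum of the functions \<open>Q i\<close>.\<close>

lemma dyadic_step:
  assumes "1 \<le> m"
  obtains a :: "'n::finite \<Rightarrow> real \<Rightarrow> real" and B \<kappa> where "bumps a" "(\<integral>x. pker a x \<partial>lborel) = 1" "0 < B" "0 < \<kappa>"
    "\<And>\<mu> f l d n p. \<lbrakk>finite_measure \<mu>; sets \<mu> = sets borel; integrable lborel f;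
       sobolev_norm_1plus (2 * m) p f \<le> ennreal l; 0 \<le> l;
       d1 (signed_of \<mu>) (signed_density f) \<le> ennreal d; 0 < d\<rbrakk> \<Longrightarrow>
       elog_ball (B * ((real n + 1) * 2 ^ n * d) + \<kappa> * ((1 / 2) ^ (2 * m * n) * (1 + 2 * l)))
         (\<lambda>x. mollify (signed_of \<mu>) (scale ((1 / 2) ^ Suc n) a) x - mollify (signed_of \<mu>) (scale ((1 / 2) ^ n) a) x)"
proof -
  obtain \<rho> \<sigma> where \<rho>: "bump \<rho>" "bump \<sigma>" "integral\<^sup>L lborel \<rho> = 1"
     "\<And>x. \<rho> x - \<rho> (x / 2) / 2 = (deriv ^^ (2 * m)) \<sigma> x"
    using kernel_1d[of "2 * m"] assms by auto
  define a :: "'n \<Rightarrow> real \<Rightarrow> real" where "a = (\<lambda>_. \<rho>)"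
  have a: "bumps a" using \<rho> by (simp add: a_def bumps_def)
  have ai: "(\<integral>x. pker a x \<partial>lborel) = 1" using integral_pker[OF a] \<rho>(3) by (simp add: a_def)
  have "bump (\<lambda>x. \<rho> (x / 2) / 2)" using bump_rescale[OF \<rho>(1), of "1/2" "1/2"] by simp
  from pker_telescope[OF \<rho>(1) this \<rho>(2) \<rho>(4)]
  obtain b :: "'n \<Rightarrow> 'n \<Rightarrow> real \<Rightarrow> real" where b: "\<And>i. bumps (b i)"
     "\<And>x. pker (\<lambda>_. \<rho>) x - pker (\<lambda>_ x. \<rho> (x / 2) / 2) x = (\<Sum>i\<in>UNIV. pker (pderiv_at i (2 * m) (b i)) x)" by blast
  obtain A where A: "0 < A"
    "\<And>h \<sigma> \<tau> (d :: real). \<lbrakk>0 < h; h \<le> 1; d1 \<sigma> \<tau> \<le> ennreal d; 0 \<le> d; finite_signed \<sigma>; finite_signed \<tau>\<rbrakk> \<Longrightarrow>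
        (\<integral>x. \<bar>mollify \<sigma> (scale h a) x - mollify \<tau> (scale h a) x\<bar> \<partial>lborel) \<le> A * (1 / h) * d"
    "\<And>h \<sigma> \<tau> (d :: real) x. \<lbrakk>0 < h; h \<le> 1; d1 \<sigma> \<tau> \<le> ennreal d; 0 \<le> d\<rbrakk> \<Longrightarrow>
        \<bar>mollify \<sigma> (scale h a) x - mollify \<tau> (scale h a) x\<bar> \<le> A * (1 / h) ^ (CARD('n) + 1) * d"
    using d1_mollify_bounds[OF a] by blast
  define \<kappa> where "\<kappa> = (\<Sum>i\<in>UNIV. knorm (b i) + 1)"
  have \<kappa>: "0 < \<kappa>" unfolding \<kappa>_def by (intro sum_pos) (auto intro: add_nonneg_pos)
  define B where "B = 6 * A * (2 + real CARD('n))"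
  have B: "0 < B" using A(1) by (simp add: B_def)
  show thesis
  proof (rule that[OF a ai B \<kappa>])
    fix \<mu> :: "(real ^ 'n) measure" and f :: "real ^ 'n \<Rightarrow> real" and l d :: real and n p :: nat
    assume \<mu>: "finite_measure \<mu>" "sets \<mu> = sets borel" and f: "integrable lborel f"
      and S: "sobolev_norm_1plus (2 * m) p f \<le> ennreal l" "0 \<le> l"
      and d: "d1 (signed_of \<mu>) (signed_density f) \<le> ennreal d" "0 < d"
    define s t where "s = signed_of \<mu>" and "t = signed_density f"
    have fin: "finite_signed s" "finite_signed t"
      unfolding s_def t_def using signed_of_finite[OF \<mu>] signed_density_finite[OF f] by auto
    have dst: "d1 s t \<le> ennreal d" using d by (simp add: s_def t_def)
    define P where "P k x = mollify s (scale ((1 / 2) ^ k) a) x - mollify t (scale ((1 / 2) ^ k) a) x" for k x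
    have Pball: "elog_ball (A * (2 + real CARD('n)) * (real k + 1) * 2 ^ k * d) (P k)" for k
    proof (rule elog_ball_from_L1_Linf)
      have sa: "bumps (scale ((1 / 2) ^ k) a)" using bumps_scale[OF a, of "(1 / 2) ^ k"] by simp
      have h: "0 < (1 / 2 :: real) ^ k" "(1 / 2 :: real) ^ k \<le> 1" by (auto intro: power_le_one)
      have inv: "1 / (1 / 2 :: real) ^ k = 2 ^ k" by (simp add: power_one_over)
      show "integrable lborel (P k)" unfolding P_def using mollify_integrable[OF fin(1) sa] mollify_integrable[OF fin(2) sa] by simp
      show "(\<integral>x. \<bar>P k x\<bar> \<partial>lborel) \<le> A * 2 ^ k * d"
        using A(2)[OF h dst _ fin] d(2) unfolding inv P_def by simp
      show "\<bar>P k x\<bar> \<le> A * (2 ^ k) ^ (CARD('n) + 1) * d" for x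
        using A(3)[OF h dst] d(2) unfolding inv P_def by simp
      show "0 < A * (2 + real CARD('n)) * (real k + 1) * 2 ^ k * d" using A d by simp
    qed (rule dyadic_size_bound[OF A(1) d(2)])
    define h :: real where "h = (1 / 2) ^ Suc n"
    have h: "0 < h" "2 * h = (1 / 2) ^ n" by (auto simp: h_def)
    define Q where "Q i x = mollify t (pderiv_at i (2 * m) (scale h (b i))) x" for i x
    have Qball: "elog_ball (h ^ (2 * m) * ((knorm (b i) + 1) * (1 + 2 * l))) (\<lambda>x. h ^ (2 * m) * Q i x)" for i
      unfolding Q_def t_def
      by (intro elog_ball_cmult derivative_part_ball[OF f S b(1) h(1)] zero_less_power h(1))
    have ker: "pker (scale h a) x - pker (scale (2 * h) a) x = h ^ (2 * m) * (\<Sum>i\<in>UNIV. pker (pderiv_at i (2 * m) (scale h (b i))) x)" for x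
    proof -
      have "scale (2 * h) a = scale h (\<lambda>_ x. \<rho> (x / 2) / 2)"
        unfolding scale_def a_def using h by (intro ext) (simp add: field_simps)
      then have e: "pker (scale (2 * h) a) x = pker (scale h (\<lambda>_ x. \<rho> (x / 2) / 2)) x" by simp
      have "pker (scale h a) x - pker (scale (2 * h) a) x
         = (1 / h) ^ CARD('n) * (pker (\<lambda>_. \<rho>) ((1 / h) *\<^sub>R x) - pker (\<lambda>_ x. \<rho> (x / 2) / 2) ((1 / h) *\<^sub>R x))"
        unfolding e unfolding pker_scale by (simp add: a_def right_diff_distrib)
      also have "\<dots> = (\<Sum>i\<in>UNIV. pker (scale h (pderiv_at i (2 * m) (b i))) x)"
        unfolding b(2) pker_scale sum_distrib_left ..
      also have "\<dots> = (\<Sum>i\<in>UNIV. h ^ (2 * m) * pker (pderiv_at i (2 * m) (scale h (b i))) x)"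
        unfolding pker_pderiv_at_scale[OF b(1)] using h by (simp add: power_one_over)
      finally show ?thesis by (simp add: sum_distrib_left)
    qed
    have sb: "bumps (scale h c)" if "bumps c" for c :: "'n \<Rightarrow> real \<Rightarrow> real" using bumps_scale[OF that] h by simp
    have sb2: "bumps (scale (2 * h) a)" using bumps_scale[OF a] h by simp
    have "mollify t (scale h a) x - mollify t (scale (2 * h) a) x = (\<Sum>i\<in>UNIV. h ^ (2 * m) * Q i x)" for x
      unfolding Q_def t_def sum_distrib_left[symmetric]
      by (rule mollify_density_difference[OF f sb[OF a] sb2 bumps_pderiv_at[OF sb[OF b(1)]] ker])
    then have eq: "mollify s (scale h a) x - mollify s (scale ((1 / 2) ^ n) a) x
      = (P (Suc n) x + - P n x) + (\<Sum>i\<in>UNIV. h ^ (2 * m) * Q i x)" for x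
      unfolding P_def h(2) h_def[symmetric] by (simp add: algebra_simps)
    define N where "N k = A * (2 + real CARD('n)) * (real k + 1) * 2 ^ k * d" for k :: nat
    have "elog_ball ((N (Suc n) + N n) + (\<Sum>i\<in>UNIV. h ^ (2 * m) * ((knorm (b i) + 1) * (1 + 2 * l))))
       (\<lambda>x. mollify s (scale h a) x - mollify s (scale ((1 / 2) ^ n) a) x)"
      unfolding eq N_def by (intro elog_ball_sum elog_ball_add Pball elog_ball_uminus Qball) auto
    then show "elog_ball (B * ((real n + 1) * 2 ^ n * d) + \<kappa> * ((1 / 2) ^ (2 * m * n) * (1 + 2 * l)))
         (\<lambda>x. mollify (signed_of \<mu>) (scale ((1 / 2) ^ Suc n) a) x - mollify (signed_of \<mu>) (scale ((1 / 2) ^ n) a) x)"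
      unfolding h_def s_def
    proof (rule elog_ball_mono)
      define q where "q = A * (2 + real CARD('n)) * 2 ^ n * d"
      have q: "0 \<le> q" using A d by (simp add: q_def)
      have "N (Suc n) + N n = q * (2 * (real n + 2) + (real n + 1))"
        unfolding N_def q_def by (simp add: algebra_simps)
      also have "\<dots> \<le> q * (6 * (real n + 1))" by (intro mult_left_mono q) simp
      also have "\<dots> = B * ((real n + 1) * 2 ^ n * d)" unfolding q_def B_def by simp
      finally have 1: "N (Suc n) + N n \<le> B * ((real n + 1) * 2 ^ n * d)" .
      have "((1 / 2 :: real) ^ Suc n) ^ (2 * m) \<le> ((1 / 2) ^ n) ^ (2 * m)" by (intro power_mono) auto
      also have "\<dots> = (1 / 2) ^ (2 * m * n)" by (simp add: power_mult[symmetric] mult_ac)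
      finally have hm: "((1 / 2 :: real) ^ Suc n) ^ (2 * m) \<le> (1 / 2) ^ (2 * m * n)" .
      have "(\<Sum>i\<in>UNIV. ((1 / 2) ^ Suc n) ^ (2 * m) * ((knorm (b i) + 1) * (1 + 2 * l)))
        = ((1 / 2) ^ Suc n) ^ (2 * m) * (\<kappa> * (1 + 2 * l))"
        unfolding \<kappa>_def by (simp add: sum_distrib_left sum_distrib_right)
      also have "\<dots> \<le> (1 / 2) ^ (2 * m * n) * (\<kappa> * (1 + 2 * l))"
        by (intro mult_right_mono hm) (use \<kappa> S in auto)
      also have "\<dots> = \<kappa> * ((1 / 2) ^ (2 * m * n) * (1 + 2 * l))" by simp
      finally show "(N (Suc n) + N n) + (\<Sum>i\<in>UNIV. ((1 / 2) ^ Suc n) ^ (2 * m) * ((knorm (b i) + 1) * (1 + 2 * l)))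
        \<le> B * ((real n + 1) * 2 ^ n * d) + \<kappa> * ((1 / 2) ^ (2 * m * n) * (1 + 2 * l))" using 1 by simp
    qed
  qed
qed

lemma mollify_in_elog_ball:
  fixes a :: "'n::finite \<Rightarrow> real \<Rightarrow> real"
  assumes \<mu>: "finite_measure \<mu>" "sets \<mu> = sets borel" and a: "bumps a"
  shows "\<exists>N. elog_ball N (mollify (signed_of \<mu>) a)"
proof -
  interpret finite_measure \<mu> by fact
  note \<mu>(2) [measurable_cong]
  have [measurable]: "pker a \<in> borel_measurable borel" using a by (rule pker_measurable)
  obtain B where B: "0 < B" "\<And>x. \<bar>pker a x\<bar> \<le> B" using pker_bounded[OF a] by blast
  define I where "I = (\<integral>x. \<bar>mollify (signed_of \<mu>) a x\<bar> \<partial>lborel)"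
  define M where "M = B * measure \<mu> (space \<mu>)"
  have I0: "0 \<le> I" unfolding I_def by simp
  have M0: "0 \<le> M" unfolding M_def using B by simp
  have bd: "\<bar>mollify (signed_of \<mu>) a x\<bar> \<le> M" for x
  proof -
    have "\<bar>\<integral>y. pker a (y - x) \<partial>\<mu>\<bar> \<le> (\<integral>y. \<bar>pker a (y - x)\<bar> \<partial>\<mu>)" by (rule integral_abs_bound)
    also have "\<dots> \<le> (\<integral>y. B \<partial>\<mu>)"
      using B by (intro integral_mono integrable_const_bound[where B = B]) auto
    finally show ?thesis by (simp add: mollify_def signed_integral_def signed_of_def M_def mult.commute)
  qed
  define N where "N = I * (1 + ln (1 + M)) + 1"
  have N1: "1 \<le> N" unfolding N_def using I0 M0 by (simp add: ln_ge_zero)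
  have "elog_ball N (mollify (signed_of \<mu>) a)"
  proof (rule elog_ball_from_L1_Linf[where a = I and M = M])
    show "integrable lborel (mollify (signed_of \<mu>) a)" by (intro mollify_integrable signed_of_finite \<mu> a)
    have "M / N \<le> M / 1" by (intro divide_left_mono) (use N1 M0 in auto)
    then have "ln (1 + M / N) \<le> ln (1 + M)" by (intro ln_mono) (use M0 N1 in \<open>auto intro: add_pos_nonneg\<close>)
    then have "I * (1 + ln (1 + M / N)) \<le> I * (1 + ln (1 + M))" by (intro mult_left_mono I0) simp
    then show "I * (1 + ln (1 + M / N)) \<le> N" by (simp add: N_def)
  qed (use bd N1 in \<open>auto simp: I_def\<close>)
  then show ?thesis by blast
qed

section \<open>Balancing the two errors\<close>

text \<open>The logarithm of the target \<open>2\<^bsup>2mn\<^esup> (n+1)\<^bsup>-1-\<epsilon>\<^esup>\<close> grows at least linearly in \<open>n\<close>.\<close>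

lemma ln_target_lower_bound:
  fixes \<epsilon> c :: real
  assumes m: "1 \<le> m" and \<epsilon>: "0 < \<epsilon>"
  shows "\<exists>n0. \<forall>n\<ge>n0. (real n + 1) / 2 + c \<le> ln (2 ^ (2 * m * n) * (real n + 1) powr (- 1 - \<epsilon>))"
proof -
  define s where "s = 1 / (8 * (1 + \<epsilon>))"
  have s: "0 < s" using \<epsilon> by (simp add: s_def)
  define c' where "c' = c - (1 + \<epsilon>) * ln s"
  obtain n0 :: nat where "(8 * c' + 5) / 3 \<le> real n0" using real_arch_simple by blast
  then have n0: "8 * c' + 5 \<le> 3 * real n0" by simp
  have "(real n + 1) / 2 + c \<le> ln (2 ^ (2 * m * n) * (real n + 1) powr (- 1 - \<epsilon>))" if n: "n0 \<le> n" for n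
  proof -
    have "ln (s * (real n + 1)) \<le> s * (real n + 1) - 1" by (rule ln_le_minus_one) (use s in auto)
    then have "ln (real n + 1) \<le> s * (real n + 1) - ln s" using s by (simp add: ln_mult)
    then have "(1 + \<epsilon>) * ln (real n + 1) \<le> (1 + \<epsilon>) * (s * (real n + 1) - ln s)"
      using \<epsilon> by (intro mult_left_mono) auto
    also have "\<dots> = (real n + 1) / 8 - (1 + \<epsilon>) * ln s" using \<epsilon> by (simp add: s_def field_simps)
    finally have 1: "(1 + \<epsilon>) * ln (real n + 1) \<le> (real n + 1) / 8 + (c' - c)" by (simp add: c'_def)
    have "real n = (2 * real n) * (1 / 2)" by simp
    also have "\<dots> \<le> real (2 * m * n) * ln 2"
    proof (intro mult_mono)
      have "2 * n \<le> 2 * m * n" using m by simp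
      then show "2 * real n \<le> real (2 * m * n)" by (metis of_nat_le_iff of_nat_mult of_nat_numeral)
      show "1 / 2 \<le> ln (2::real)" using ln2_ge_two_thirds by simp
    qed auto
    finally have 2: "real n \<le> real (2 * m * n) * ln 2" .
    have "ln (2 ^ (2 * m * n) * (real n + 1) powr (- 1 - \<epsilon>)) = real (2 * m * n) * ln 2 + (- 1 - \<epsilon>) * ln (real n + 1)"
      by (subst ln_mult) (auto simp: ln_realpow ln_powr)
    also have "\<dots> = real (2 * m * n) * ln 2 - (1 + \<epsilon>) * ln (real n + 1)" by (simp add: algebra_simps)
    finally have eq: "ln (2 ^ (2 * m * n) * (real n + 1) powr (- 1 - \<epsilon>)) = \<dots>" .
    have "real n0 \<le> real n" using n by simp
    then show ?thesis using 1 2 n0 unfolding eq by argo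
  qed
  then show ?thesis by blast
qed

text \<open>The choice of \<open>\<delta>\<close> for given \<open>n\<close>. Let \<open>S\<close> be the set of all \<open>\<delta>\<close> at which \<open>lam\<close> is at most the
  target \<open>T n\<close>. If \<open>S\<close> contains arbitrarily small numbers, one of them makes \<open>D \<delta>\<close> as small as desired.
  Otherwise \<open>\<delta>\<close> is the infimum of \<open>S\<close>: it belongs to \<open>S\<close> by right-continuity, while the bound on the
  jumps gives \<open>T n \<le> K * lam \<delta>\<close>, so that \<open>lam \<delta>\<close> and \<open>T n\<close> are comparable.\<close>

lemma balanced_parameter:
  fixes lam :: "real \<Rightarrow> real" and C r \<epsilon> K :: real
  assumes m: "1 \<le> m" and C: "0 < C" and r: "0 < r" and \<epsilon>: "0 < \<epsilon>"
    and rc: "\<And>\<delta>. \<delta> \<in> {0<..<1} \<Longrightarrow> continuous (at_right \<delta>) lam"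
    and mono: "antimono_on {0<..<1} lam"
    and pos: "\<And>\<delta>. \<delta> \<in> {0<..<1} \<Longrightarrow> 0 < lam \<delta>"
    and jump: "\<And>\<delta>. \<delta> \<in> {0<..<1} \<Longrightarrow> eventually (\<lambda>\<eta>. lam \<eta> \<le> K * lam \<delta>) (at_left \<delta>)"
    and growth: "\<And>\<delta>. \<delta> \<in> {0<..<1} \<Longrightarrow> lam \<delta> \<le> C * \<delta> powr (- r)"
  defines "D \<equiv> \<lambda>\<delta>. C / (lam \<delta> powr (1 / (2 * real m)) * ln (1 / \<delta>) powr (2 + 1 / (2 * real m) + \<epsilon>))"
  shows "\<exists>K' n0. \<forall>n\<ge>n0. \<exists>\<delta>\<in>{0<..<1}. lam \<delta> \<le> 2 ^ (2 * m * n) * (real n + 1) powr (- 1 - \<epsilon>)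
     \<and> (real n + 1) * 2 ^ n * D \<delta> \<le> K' * (real n + 1) powr (- 1 - \<epsilon> / 2)"
proof -
  define p where "p = 1 / (2 * real m)"
  define E where "E = 2 + p + \<epsilon>"
  have p: "0 < p" "p \<le> 1 / 2" using m by (auto simp: p_def field_simps)
  have E: "0 < E" using p \<epsilon> by (simp add: E_def)
  have D: "D \<delta> = C / (lam \<delta> powr p * ln (1 / \<delta>) powr E)" for \<delta> by (simp add: D_def p_def E_def)
  define K1 where "K1 = max K 1"
  have K1: "0 < K1" "K \<le> K1" by (auto simp: K1_def)
  define T where "T n = 2 ^ (2 * m * n) * (real n + 1) powr (- 1 - \<epsilon>)" for n
  have T: "0 < T n" for n by (simp add: T_def)
  define l0 where "l0 = lam (1 / 2)"
  have l0: "0 < l0" using pos[of "1/2"] by (simp add: l0_def)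
  obtain n0 where n0: "\<And>n. n0 \<le> n \<Longrightarrow> (real n + 1) / 2 + max (ln (K1 * C)) (ln l0) \<le> ln (T n)"
    using ln_target_lower_bound[OF m \<epsilon>, of "max (ln (K1 * C)) (ln l0)"] unfolding T_def by blast
  define K' where "K' = max 1 (C * K1 powr p * (2 * r) powr E)"
  have K': "1 \<le> K'" "C * K1 powr p * (2 * r) powr E \<le> K'" by (auto simp: K'_def)
  have anti: "lam y \<le> lam x" if "0 < x" "x \<le> y" "y < 1" for x y
    using mono that by (auto simp: monotone_on_def)
  have "\<exists>\<delta>\<in>{0<..<1}. lam \<delta> \<le> T n \<and> (real n + 1) * 2 ^ n * D \<delta> \<le> K' * (real n + 1) powr (- 1 - \<epsilon> / 2)" if n: "n0 \<le> n" for n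
  proof -
    define S where "S = {\<delta>. 0 < \<delta> \<and> \<delta> < 1 \<and> lam \<delta> \<le> T n}"
    have "ln l0 \<le> ln (T n)" using n0[OF n] max.cobounded2[of "ln l0" "ln (K1 * C)"] of_nat_0_le_iff[of n, where 'a = real]
      by argo
    then have half: "1 / 2 \<in> S" using l0 T by (simp add: S_def l0_def)
    show ?thesis
    proof (cases "\<exists>\<eta>>0. \<forall>\<delta>\<in>S. \<eta> \<le> \<delta>")
      case False
      define \<tau> where "\<tau> = (real n + 1) powr (- 1 - \<epsilon> / 2)"
      have \<tau>: "0 < \<tau>" by (simp add: \<tau>_def)
      \<comment> \<open>\<open>X\<close> is the size of \<open>ln (1 / \<delta>)\<close> at which the bound for \<open>D \<delta>\<close> reaches \<open>\<tau> / ((n + 1) 2\<^sup>n)\<close>\<close>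
      define Y where "Y = C * ((real n + 1) * 2 ^ n) / (l0 powr p * \<tau>)"
      have Y: "0 < Y" using C l0 \<tau> by (simp add: Y_def)
      define X where "X = Y powr (1 / E)"
      have X: "0 < X" using Y by (simp add: X_def)
      have XE: "X powr E = Y" unfolding X_def powr_powr using E Y by simp
      have "0 < min (1 / 2) (exp (- X))" by simp
      then obtain \<delta> where \<delta>: "\<delta> \<in> S" "\<delta> < min (1 / 2) (exp (- X))" using False by (meson not_le)
      have d0: "0 < \<delta>" "\<delta> < 1" using \<delta> by (auto simp: S_def)
      have "X \<le> ln (1 / \<delta>)"
      proof -
        have "ln \<delta> < ln (exp (- X))" using \<delta> d0 by (subst ln_less_cancel_iff) auto
        then show ?thesis using d0 by (simp add: ln_div)
      qed
      then have "X powr E \<le> ln (1 / \<delta>) powr E" using X E by (intro powr_mono2) auto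
      moreover have "l0 powr p \<le> lam \<delta> powr p"
        using anti[of \<delta> "1/2"] \<delta> d0 l0 p by (intro powr_mono2) (auto simp: l0_def)
      ultimately have "l0 powr p * X powr E \<le> lam \<delta> powr p * ln (1 / \<delta>) powr E" by (intro mult_mono) auto
      then have "D \<delta> \<le> C / (l0 powr p * X powr E)"
        unfolding D using C l0 X pos[of \<delta>] d0 by (intro divide_left_mono) auto
      also have "\<dots> = \<tau> / ((real n + 1) * 2 ^ n)"
      proof -
        have "C / (v * (C * w / (v * \<tau>))) = \<tau> / w" if "0 < v" "0 < w" for v w
          using that C \<tau> by simp
        then show ?thesis unfolding XE Y_def using l0 by simp
      qed
      finally have "(real n + 1) * 2 ^ n * D \<delta> \<le> \<tau>" by (simp add: le_divide_eq mult_ac)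
      also have "\<dots> \<le> K' * \<tau>" using K' \<tau> by simp
      finally show ?thesis using \<delta> by (intro bexI[of _ \<delta>]) (auto simp: S_def \<tau>_def)
    next
      case True
      then obtain \<eta>0 where \<eta>0: "0 < \<eta>0" "\<And>\<delta>. \<delta> \<in> S \<Longrightarrow> \<eta>0 \<le> \<delta>" by blast
      define \<delta> where "\<delta> = Inf S"
      have bdd: "bdd_below S" using \<eta>0 by (auto simp: bdd_below_def)
      have "\<eta>0 \<le> \<delta>" unfolding \<delta>_def using \<eta>0 half by (intro cInf_greatest) auto
      moreover have "\<delta> \<le> 1 / 2" unfolding \<delta>_def by (rule cInf_lower[OF half bdd])
      ultimately have d0: "0 < \<delta>" "\<delta> < 1" using \<eta>0 by auto
      have above: "lam x \<le> T n" if x: "\<delta> < x" "x < 1" for x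
      proof -
        obtain y where y: "y \<in> S" "y < x" using x(1) half bdd unfolding \<delta>_def by (subst (asm) cInf_less_iff) auto
        then show ?thesis using anti[of y x] x by (auto simp: S_def)
      qed
      have le: "lam \<delta> \<le> T n"
      proof (rule tendsto_upperbound[of lam _ "at_right \<delta>"])
        show "(lam \<longlongrightarrow> lam \<delta>) (at_right \<delta>)" using rc[of \<delta>] d0 by (simp add: continuous_within)
        show "\<forall>\<^sub>F x in at_right \<delta>. lam x \<le> T n" using above d0 by (intro eventually_at_rightI[of \<delta> 1]) auto
      qed simp
      have "\<forall>\<^sub>F x in at_left \<delta>. T n < lam x"
      proof (rule eventually_at_leftI[of 0])
        fix x assume "x \<in> {0<..<\<delta>}"
        then have "x \<notin> S" using cInf_lower[OF _ bdd, of x] by (auto simp: \<delta>_def)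
        then show "T n < lam x" using \<open>x \<in> {0<..<\<delta>}\<close> d0 by (auto simp: S_def)
      qed (use d0 in auto)
      moreover have "\<forall>\<^sub>F x in at_left \<delta>. lam x \<le> K * lam \<delta>" using jump d0 by simp
      ultimately have "\<forall>\<^sub>F x in at_left \<delta>. T n \<le> K * lam \<delta>" by eventually_elim linarith
      then have "T n \<le> K * lam \<delta>" by (simp add: eventually_const_iff)
      also have "\<dots> \<le> K1 * lam \<delta>" using pos[of \<delta>] d0 K1 by (intro mult_right_mono) auto
      finally have ge: "T n / K1 \<le> lam \<delta>" using K1 by (simp add: divide_le_eq mult.commute)
      define y where "y = (real n + 1) / (2 * r)"
      have y: "0 < y" using r by (simp add: y_def)
      have "ln (T n / K1) \<le> ln (C * \<delta> powr (- r))"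
        using ge growth[of \<delta>] d0 T[of n] K1 C by (subst ln_le_cancel_iff) auto
      also have "\<dots> = ln C + r * ln (1 / \<delta>)" using d0 C by (simp add: ln_mult ln_powr ln_div)
      finally have "ln (T n) - ln (K1 * C) \<le> r * ln (1 / \<delta>)" using T[of n] K1 C d0 by (simp add: ln_div ln_mult)
      moreover have "ln (K1 * C) + (real n + 1) / 2 \<le> ln (T n)" using n0[OF n] by linarith
      ultimately have "(real n + 1) / 2 \<le> r * ln (1 / \<delta>)" by linarith
      then have "y \<le> ln (1 / \<delta>)" using r by (simp add: y_def field_simps)
      then have "y powr E \<le> ln (1 / \<delta>) powr E" using y E by (intro powr_mono2) auto
      moreover have "(T n / K1) powr p \<le> lam \<delta> powr p" using ge T[of n] K1 p by (intro powr_mono2) auto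
      ultimately have "(T n / K1) powr p * y powr E \<le> lam \<delta> powr p * ln (1 / \<delta>) powr E" by (intro mult_mono) auto
      then have "D \<delta> \<le> C / ((T n / K1) powr p * y powr E)"
        unfolding D using C T[of n] K1 y pos[of \<delta>] d0 by (intro divide_left_mono) auto
      also have "(T n / K1) powr p = 2 ^ n * (real n + 1) powr (- ((1 + \<epsilon>) * p)) / K1 powr p"
      proof -
        have "(2 ^ (2 * m * n) :: real) powr p = 2 powr (real (2 * m * n) * p)"
          by (simp add: powr_realpow[symmetric] powr_powr)
        also have "real (2 * m * n) * p = real n" using m by (simp add: p_def)
        finally have "(2 ^ (2 * m * n) :: real) powr p = 2 ^ n" by (simp add: powr_realpow)
        moreover have "(- 1 - \<epsilon>) * p = - ((1 + \<epsilon>) * p)" by (simp add: algebra_simps)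
        ultimately show ?thesis unfolding T_def using K1 by (simp add: powr_divide powr_mult powr_powr)
      qed
      also have "y powr E = (real n + 1) powr E / (2 * r) powr E"
        unfolding y_def using r by (simp add: powr_divide)
      finally have "(real n + 1) * 2 ^ n * D \<delta> \<le> (real n + 1) * 2 ^ n *
        (C / (2 ^ n * (real n + 1) powr (- ((1 + \<epsilon>) * p)) / K1 powr p * ((real n + 1) powr E / (2 * r) powr E)))"
        by (intro mult_left_mono) auto
      also have "\<dots> = (C * K1 powr p * (2 * r) powr E) * ((real n + 1) / ((real n + 1) powr (- ((1 + \<epsilon>) * p)) * (real n + 1) powr E))"
      proof -
        have "x * c * (C / (c * u / k * (v / w))) = (C * k * w) * (x / (u * v))" if "0 < c" for x c u k v w :: real
          using that by simp
        then show ?thesis by simp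
      qed
      also have "(real n + 1) / ((real n + 1) powr (- ((1 + \<epsilon>) * p)) * (real n + 1) powr E)
        = (real n + 1) powr (1 - (- ((1 + \<epsilon>) * p) + E))"
        by (simp add: powr_diff powr_add powr_minus divide_inverse)
      also have "1 - (- ((1 + \<epsilon>) * p) + E) = - 1 - \<epsilon> + \<epsilon> * p" by (simp add: E_def algebra_simps)
      also have "(C * K1 powr p * (2 * r) powr E) * (real n + 1) powr (- 1 - \<epsilon> + \<epsilon> * p)
         \<le> K' * (real n + 1) powr (- 1 - \<epsilon> / 2)"
      proof (intro mult_mono K' powr_mono)
        have "\<epsilon> * p \<le> \<epsilon> * (1 / 2)" using p \<epsilon> by (intro mult_left_mono) auto
        then show "- 1 - \<epsilon> + \<epsilon> * p \<le> - 1 - \<epsilon> / 2" by linarith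
      qed (use K' in auto)
      finally show ?thesis using le d0 by (intro bexI[of _ \<delta>]) auto
    qed
  qed
  then show ?thesis unfolding T_def by blast
qed

lemma summable_powr_shift:
  fixes e :: real
  assumes "0 < e" shows "summable (\<lambda>n. (real n + 1) powr (- 1 - e))"
proof -
  have "summable (\<lambda>n. real n powr (- 1 - e))" using assms by (subst summable_real_powr_iff) simp
  then have "summable (\<lambda>n. real (Suc n) powr (- 1 - e))" by (subst summable_Suc_iff)
  then show ?thesis by (simp add: add.commute)
qed

section \<open>Existence of the density\<close>

theorem theorem2p9:
  fixes \<mu> :: "(real ^ 'n::finite) measure"
    and f :: "real \<Rightarrow> real ^ 'n \<Rightarrow> real"
    and m :: nat
    and C r \<epsilon> K :: real
    and lam :: "real \<Rightarrow> real"
  assumes "sets \<mu> = sets borel" and "finite_measure \<mu>"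
    and "\<And>\<delta>. 0 < \<delta> \<Longrightarrow> integrable lborel (f \<delta>)"
    and "1 \<le> m" and "0 < C" and "0 < r" and "0 < \<epsilon>"
    and right_continuous: "\<And>\<delta>. \<delta> \<in> {0<..<1} \<Longrightarrow> continuous (at_right \<delta>) lam"
    and non_increasing: "antimono_on {0<..<1} lam"
    and positive: "\<And>\<delta>. \<delta> \<in> {0<..<1} \<Longrightarrow> 0 < lam \<delta>"
    and bounded_jumps:
      "\<And>\<delta>. \<delta> \<in> {0<..<1} \<Longrightarrow> eventually (\<lambda>\<eta>. lam \<eta> \<le> K * lam \<delta>) (at_left \<delta>)"
    and "\<And>\<delta>. \<delta> \<in> {0<..<1} \<Longrightarrow> sobolev_norm_1plus (2 * m) (2 * m) (f \<delta>) \<le> ennreal (lam \<delta>)"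
    and "\<And>\<delta>. \<delta> \<in> {0<..<1} \<Longrightarrow> lam \<delta> \<le> C * \<delta> powr (- r)"
    and "\<And>\<delta>. \<delta> \<in> {0<..<1} \<Longrightarrow>
           ennreal (lam \<delta> powr (1 / (2 * real m))) * d1 (signed_of \<mu>) (signed_density (f \<delta>))
             \<le> ennreal (C / ln (1 / \<delta>) powr (2 + 1 / (2 * real m) + \<epsilon>))"
  shows "\<exists>g. g \<in> L_elog \<and> (\<forall>x. 0 \<le> g x) \<and> \<mu> = density lborel (\<lambda>x. ennreal (g x))"
proof -
  note sets_\<mu> = assms(1) and fin = assms(2) and f_int = assms(3) and m = assms(4) and C = assms(5)
    and r = assms(6) and \<epsilon> = assms(7) and sobolev = assms(12) and growth = assms(13) and approx = assms(14)
  define D where "D \<delta> = C / (lam \<delta> powr (1 / (2 * real m)) * ln (1 / \<delta>) powr (2 + 1 / (2 * real m) + \<epsilon>))" for \<delta>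
  have D: "0 < D \<delta>" "d1 (signed_of \<mu>) (signed_density (f \<delta>)) \<le> ennreal (D \<delta>)" if \<delta>: "\<delta> \<in> {0<..<1}" for \<delta>
  proof -
    define w where "w = lam \<delta> powr (1 / (2 * real m))"
    have w: "0 < w" using positive[OF \<delta>] by (simp add: w_def)
    have "0 < ln (1 / \<delta>)" using \<delta> by (simp add: ln_div)
    then show "0 < D \<delta>" using C positive[OF \<delta>] by (simp add: D_def)
    have "d1 (signed_of \<mu>) (signed_density (f \<delta>)) = ennreal (1 / w) * (ennreal w * d1 (signed_of \<mu>) (signed_density (f \<delta>)))"
      using w by (simp add: mult.assoc[symmetric] ennreal_mult[symmetric])
    also have "\<dots> \<le> ennreal (1 / w) * ennreal (C / ln (1 / \<delta>) powr (2 + 1 / (2 * real m) + \<epsilon>))"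
      unfolding w_def by (intro mult_left_mono approx \<delta>) simp
    also have "\<dots> = ennreal (D \<delta>)" using w C unfolding D_def w_def[symmetric] by (subst ennreal_mult[symmetric]) auto
    finally show "d1 (signed_of \<mu>) (signed_density (f \<delta>)) \<le> ennreal (D \<delta>)" .
  qed
  obtain K' n0 where "\<forall>n\<ge>n0. \<exists>\<delta>\<in>{0<..<1}. lam \<delta> \<le> 2 ^ (2 * m * n) * (real n + 1) powr (- 1 - \<epsilon>)
     \<and> (real n + 1) * 2 ^ n * D \<delta> \<le> K' * (real n + 1) powr (- 1 - \<epsilon> / 2)"
    using balanced_parameter[OF m C r \<epsilon> right_continuous non_increasing positive bounded_jumps growth]
    unfolding D_def by blast
  then obtain \<delta> where \<delta>: "\<And>n. n0 \<le> n \<Longrightarrow> \<delta> n \<in> {0<..<1}"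
    "\<And>n. n0 \<le> n \<Longrightarrow> lam (\<delta> n) \<le> 2 ^ (2 * m * n) * (real n + 1) powr (- 1 - \<epsilon>)"
    "\<And>n. n0 \<le> n \<Longrightarrow> (real n + 1) * 2 ^ n * D (\<delta> n) \<le> K' * (real n + 1) powr (- 1 - \<epsilon> / 2)" by metis
  obtain a :: "'n \<Rightarrow> real \<Rightarrow> real" and B \<kappa> where a: "bumps a" "(\<integral>x. pker a x \<partial>lborel) = 1" "0 < B" "0 < \<kappa>"
    and step: "\<And>\<mu> f l d n p. \<lbrakk>finite_measure \<mu>; sets \<mu> = sets borel; integrable lborel f;
       sobolev_norm_1plus (2 * m) p f \<le> ennreal l; 0 \<le> l;
       d1 (signed_of \<mu>) (signed_density f) \<le> ennreal d; 0 < d\<rbrakk> \<Longrightarrow>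
       elog_ball (B * ((real n + 1) * 2 ^ n * d) + \<kappa> * ((1 / 2) ^ (2 * m * n) * (1 + 2 * l)))
         (\<lambda>x. mollify (signed_of \<mu>) (scale ((1 / 2) ^ Suc n) a) x - mollify (signed_of \<mu>) (scale ((1 / 2) ^ n) a) x)"
    using dyadic_step[OF m] by blast
  \<comment> \<open>the parameters \<open>\<delta> n\<close> are available from \<open>n0\<close> on, so the sequence starts there\<close>
  define F where "F k = mollify (signed_of \<mu>) (scale ((1 / 2) ^ (k + n0)) a)" for k
  define N where "N n = B * (K' * (real n + 1) powr (- 1 - \<epsilon> / 2)) + \<kappa> * ((1 / 2) ^ n + 2 * (real n + 1) powr (- 1 - \<epsilon>))" for n
  have "summable N" unfolding N_def
    using summable_powr_shift[of "\<epsilon> / 2"] summable_powr_shift[OF \<epsilon>] \<epsilon>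
    by (intro summable_add summable_mult summable_geometric) auto
  then have sumN: "summable (\<lambda>k. N (k + n0))" by (rule summable_ignore_initial_segment)
  have "elog_ball (N (k + n0)) (\<lambda>x. F (Suc k) x - F k x)" for k
  proof -
    define n where "n = k + n0"
    have n: "n0 \<le> n" by (simp add: n_def)
    define q :: real where "q = (1 / 2) ^ (2 * m * n)"
    have q: "0 \<le> q" "q * 2 ^ (2 * m * n) = 1" by (auto simp: q_def power_mult_distrib[symmetric])
    have "q \<le> (1 / 2) ^ n" unfolding q_def by (intro power_decreasing) (use m in auto)
    moreover have "q * lam (\<delta> n) \<le> q * (2 ^ (2 * m * n) * (real n + 1) powr (- 1 - \<epsilon>))"
      by (intro mult_left_mono \<delta>(2)[OF n] q)
    then have "q * lam (\<delta> n) \<le> (real n + 1) powr (- 1 - \<epsilon>)" using q(2) by (simp add: mult.assoc[symmetric])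
    ultimately have "q * (1 + 2 * lam (\<delta> n)) \<le> (1 / 2) ^ n + 2 * (real n + 1) powr (- 1 - \<epsilon>)"
      by (simp add: algebra_simps)
    then have "B * ((real n + 1) * 2 ^ n * D (\<delta> n)) + \<kappa> * (q * (1 + 2 * lam (\<delta> n))) \<le> N n"
      unfolding N_def using a(3,4) \<delta>(3)[OF n] by (intro add_mono mult_left_mono) auto
    moreover have "elog_ball (B * ((real n + 1) * 2 ^ n * D (\<delta> n)) + \<kappa> * (q * (1 + 2 * lam (\<delta> n)))) (\<lambda>x. F (Suc k) x - F k x)"
      unfolding F_def q_def add_Suc n_def[symmetric]
      using \<delta>(1)[OF n] by (intro step[where p = "2 * m" and f = "f (\<delta> n)"] fin sets_\<mu> f_int sobolev D less_imp_le[OF positive]) auto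
    ultimately show ?thesis unfolding n_def by (rule elog_ball_mono[rotated])
  qed
  moreover obtain N0 where "elog_ball N0 (F 0)"
    using mollify_in_elog_ball[OF fin sets_\<mu> bumps_scale[OF a(1), of "(1 / 2) ^ n0"]] by (auto simp: F_def)
  moreover have "(\<lambda>k. \<integral>x. \<psi> x * F k x \<partial>lborel) \<longlonglongrightarrow> (\<integral>x. \<psi> x \<partial>\<mu>)"
    if \<psi>: "continuous_on UNIV \<psi>" "\<And>x. \<bar>\<psi> x\<bar> \<le> B'" for \<psi> B'
    unfolding F_def
  proof (rule mollify_weak_convergence[OF fin sets_\<mu> a(1,2) \<psi>])
    have "(\<lambda>k. (1 / 2 :: real) ^ k) \<longlonglongrightarrow> 0" by (rule LIMSEQ_power_zero) simp
    then show "(\<lambda>k. (1 / 2 :: real) ^ (k + n0)) \<longlonglongrightarrow> 0" by (rule LIMSEQ_ignore_initial_segment)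
  qed simp
  ultimately show ?thesis using sumN by (intro density_from_elog_balls[OF fin sets_\<mu>, where N = "\<lambda>k. N (k + n0)"]) auto
qed

end
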